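(* Let $E_{\mathbb{R}}$ be an elliptic curve over $\mathbb{R}$ whose complexification $E=E_{\mathbb{R}}\times_{\mathbb{R}}\mathbb{C}$ has complex multiplication. Let $\mathcal{J}_0(\mathbb{R},E_{\mathbb{R}})$ be the set of all $j(E'_{\mathbb{R}})$, where $E'_{\mathbb{R}}$ ranges over the elliptic curves over $\mathbb{R}$ such that (1) $E'_{\mathbb{R}}$ is isogenous to $E_{\mathbb{R}}$ over $\mathbb{R}$, and (2) the complexification $E'=E'_{\mathbb{R}}\times_{\mathbb{R}}\mathbb{C}$ has the same parity as $E$. Then the closure of $\mathcal{J}_0(\mathbb{R},E_{\mathbb{R}})$ in $\mathbb{R}$ is $(-\infty,1728]$ if $E$ is odd, and is all of $\mathbb{R}$ if $E$ is even.
   Context: For an order $O$ in a quadratic field $K$, its discriminant $\mathrm{discr}(O)\in\mathbb{Z}$ is the discriminant of the trace form $(a,b)\mapsto \mathrm{tr}_{K/\mathbb{Q}}(ab)$ on $O$; $O$ is odd (resp. even) if $\mathrm{discr}(O)$ is odd (resp. even). An elliptic curve $E$ over $\mathbb{C}$ with complex multiplication is called odd (resp. even) if the order $\mathrm{End}(E)$ in the imaginary quadratic field $\mathrm{End}(E)\otimes\mathbb{Q}$ is odd (resp. even). Two such curves have the same parity if both are odd or both are even. *)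

theory Defs
  imports "HOL-Analysis.Elementary_Topology" "HOL-Library.FuncSet" "HOL-Algebra.Ring"
begin

text \<open>
  The base fields are the reals and the complex numbers, so an elliptic curve is given by a short
  Weierstrass equation \<open>y\<^sup>2 = x\<^sup>3 + A x + B\<close> with nonzero discriminant; its
  origin is the point at infinity.
\<close>

datatype 'a weierstrass = Weierstrass (coeff_A: 'a) (coeff_B: 'a)

definition elliptic_curve :: "'a::field_char_0 weierstrass \<Rightarrow> bool" where
  "elliptic_curve E \<longleftrightarrow> 4 * coeff_A E ^ 3 + 27 * coeff_B E ^ 2 \<noteq> 0"

definition j_invariant :: "'a::field_char_0 weierstrass \<Rightarrow> 'a" where
  "j_invariant E = 1728 * (4 * coeff_A E ^ 3) / (4 * coeff_A E ^ 3 + 27 * coeff_B E ^ 2)"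

definition complexification :: "real weierstrass \<Rightarrow> complex weierstrass" where
  "complexification = map_weierstrass complex_of_real"

subsection \<open>Complex points and the group law\<close>

datatype 'a point = Infinity | Affine 'a 'a

fun on_curve :: "'a::field weierstrass \<Rightarrow> 'a point \<Rightarrow> bool" where
  "on_curve E Infinity \<longleftrightarrow> True"
| "on_curve E (Affine x y) \<longleftrightarrow> y ^ 2 = x ^ 3 + coeff_A E * x + coeff_B E"

definition points :: "'a::field weierstrass \<Rightarrow> 'a point set" where
  "points E = {P. on_curve E P}"

text \<open>
  The chord-tangent law. In the last branch with \<open>x1 = x2\<close>, two points of the curve
  satisfy \<open>y1 = y2 \<noteq> 0\<close>, and the slope is that of the tangent.
\<close>

fun point_add :: "'a::field weierstrass \<Rightarrow> 'a point \<Rightarrow> 'a point \<Rightarrow> 'a point" where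
  "point_add E Infinity Q = Q"
| "point_add E (Affine x1 y1) Infinity = Affine x1 y1"
| "point_add E (Affine x1 y1) (Affine x2 y2) =
     (if x1 = x2 \<and> y1 = - y2 then Infinity
      else let l = (if x1 = x2 then (3 * x1 ^ 2 + coeff_A E) / (2 * y1)
                    else (y2 - y1) / (x2 - x1));
               x3 = l ^ 2 - x1 - x2
           in Affine x3 (l * (x1 - x3) - y1))"

subsection \<open>Morphisms defined over a subfield of the complex numbers\<close>

fun hom_coords :: "'a::field point \<Rightarrow> 'a \<times> 'a \<times> 'a" where
  "hom_coords Infinity = (0, 1, 0)"
| "hom_coords (Affine x y) = (x, y, 1)"

text \<open>The point \<open>P\<close> is \<open>[X : Y : Z]\<close> in the projective plane.\<close>

definition has_hom_coords :: "'a::field point \<Rightarrow> 'a \<times> 'a \<times> 'a \<Rightarrow> bool" where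
  "has_hom_coords P = (\<lambda>(X, Y, Z). \<exists>c. c \<noteq> 0 \<and> hom_coords P = (c * X, c * Y, c * Z))"

text \<open>
  A ternary form of degree \<open>d\<close> is given by its coefficients: \<open>f i j\<close> is the coefficient of
  \<open>X^i Y^j Z^(d - i - j)\<close> for \<open>i + j \<le> d\<close>.
\<close>

definition form_eval :: "nat \<Rightarrow> (nat \<Rightarrow> nat \<Rightarrow> 'a) \<Rightarrow> 'a::field \<times> 'a \<times> 'a \<Rightarrow> 'a" where
  "form_eval d f = (\<lambda>(X, Y, Z). \<Sum>i\<le>d. \<Sum>j\<le>d - i. f i j * X ^ i * Y ^ j * Z ^ (d - i - j))"

text \<open>
  Morphisms of projective curves over \<open>k\<close>, seen as maps on complex points: around each point the
  map is given by three forms of the same degree with coefficients in \<open>k\<close>. Maps are extensional,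
  i.e. \<open>undefined\<close> off the curve, so that equality of functions is equality of morphisms.
\<close>

definition morphism_over ::
  "complex set \<Rightarrow> complex weierstrass \<Rightarrow> complex weierstrass \<Rightarrow> (complex point \<Rightarrow> complex point) \<Rightarrow> bool"
where
  "morphism_over k E E' \<phi> \<longleftrightarrow>
     \<phi> \<in> points E \<rightarrow>\<^sub>E points E' \<and>
     (\<forall>P\<in>points E. \<exists>d f g h.
        (\<forall>i j. f i j \<in> k \<and> g i j \<in> k \<and> h i j \<in> k) \<and>
        (let F = (\<lambda>Q. (form_eval d f (hom_coords Q), form_eval d g (hom_coords Q),
                       form_eval d h (hom_coords Q)))
         in F P \<noteq> (0, 0, 0) \<and>
            (\<forall>Q\<in>points E. F Q \<noteq> (0, 0, 0) \<longrightarrow> has_hom_coords (\<phi> Q) (F Q))))"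

definition isogeny_over ::
  "complex set \<Rightarrow> complex weierstrass \<Rightarrow> complex weierstrass \<Rightarrow> (complex point \<Rightarrow> complex point) \<Rightarrow> bool"
where
  "isogeny_over k E E' \<phi> \<longleftrightarrow>
     morphism_over k E E' \<phi> \<and> \<phi> Infinity = Infinity \<and> (\<exists>P\<in>points E. \<phi> P \<noteq> Infinity)"

definition isogenous_over_reals :: "real weierstrass \<Rightarrow> real weierstrass \<Rightarrow> bool" where
  "isogenous_over_reals E E' \<longleftrightarrow>
     (\<exists>\<phi>. isogeny_over \<real> (complexification E) (complexification E') \<phi>)"

subsection \<open>The endomorphism ring and complex multiplication\<close>

definition End_ring :: "complex weierstrass \<Rightarrow> (complex point \<Rightarrow> complex point) ring" where
  "End_ring E =
     \<lparr>carrier = {\<phi>. morphism_over UNIV E E \<phi> \<and> \<phi> Infinity = Infinity},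
      mult = (\<lambda>\<phi> \<psi>. compose (points E) \<phi> \<psi>),
      one = (\<lambda>P\<in>points E. P),
      zero = (\<lambda>P\<in>points E. Infinity),
      add = (\<lambda>\<phi> \<psi>. \<lambda>P\<in>points E. point_add E (\<phi> P) (\<psi> P))\<rparr>"

text \<open>The endomorphism ring is strictly larger than the integers, which embed as multiplication maps.\<close>

definition has_cm :: "complex weierstrass \<Rightarrow> bool" where
  "has_cm E \<longleftrightarrow> (\<exists>\<phi>\<in>carrier (End_ring E). \<forall>n::int. \<phi> \<noteq> [n] \<cdot>\<^bsub>End_ring E\<^esub> \<one>\<^bsub>End_ring E\<^esub>)"

subsection \<open>The discriminant of an order in a quadratic field\<close>

text \<open>
  An order \<open>R\<close> is a ring that is free of rank two as an abelian group. A basis \<open>a, b\<close> of \<open>R\<close> over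
  the integers is also a basis of the field \<open>K = R \<otimes> \<rat>\<close> over the rationals, so the field trace
  of \<open>x \<in> R\<close>, i.e. the trace of multiplication by \<open>x\<close> on \<open>K\<close>, can be read off from the matrix of
  this multiplication with respect to \<open>a, b\<close>.
\<close>

definition int_basis :: "('a, 'm) ring_scheme \<Rightarrow> 'a \<Rightarrow> 'a \<Rightarrow> bool" where
  "int_basis R a b \<longleftrightarrow> a \<in> carrier R \<and> b \<in> carrier R \<and>
     (\<forall>x\<in>carrier R. \<exists>!mn :: int \<times> int. x = [fst mn] \<cdot>\<^bsub>R\<^esub> a \<oplus>\<^bsub>R\<^esub> [snd mn] \<cdot>\<^bsub>R\<^esub> b)"

definition int_coords :: "('a, 'm) ring_scheme \<Rightarrow> 'a \<Rightarrow> 'a \<Rightarrow> 'a \<Rightarrow> int \<times> int" where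
  "int_coords R a b x = (THE mn. x = [fst mn] \<cdot>\<^bsub>R\<^esub> a \<oplus>\<^bsub>R\<^esub> [snd mn] \<cdot>\<^bsub>R\<^esub> b)"

definition field_trace :: "('a, 'm) ring_scheme \<Rightarrow> 'a \<Rightarrow> 'a \<Rightarrow> 'a \<Rightarrow> int" where
  "field_trace R a b x =
     fst (int_coords R a b (x \<otimes>\<^bsub>R\<^esub> a)) + snd (int_coords R a b (x \<otimes>\<^bsub>R\<^esub> b))"

text \<open>The determinant of the Gram matrix of the trace form, which is the same for all bases.\<close>

definition discr :: "('a, 'm) ring_scheme \<Rightarrow> int" where
  "discr R = (THE D. \<exists>a b. int_basis R a b \<and>
     D = field_trace R a b (a \<otimes>\<^bsub>R\<^esub> a) * field_trace R a b (b \<otimes>\<^bsub>R\<^esub> b)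
       - field_trace R a b (a \<otimes>\<^bsub>R\<^esub> b) * field_trace R a b (b \<otimes>\<^bsub>R\<^esub> a))"

definition odd_cm_curve :: "complex weierstrass \<Rightarrow> bool" where
  "odd_cm_curve E \<longleftrightarrow> has_cm E \<and> odd (discr (End_ring E))"

definition even_cm_curve :: "complex weierstrass \<Rightarrow> bool" where
  "even_cm_curve E \<longleftrightarrow> has_cm E \<and> even (discr (End_ring E))"

definition same_parity :: "complex weierstrass \<Rightarrow> complex weierstrass \<Rightarrow> bool" where
  "same_parity E E' \<longleftrightarrow>
     odd_cm_curve E \<and> odd_cm_curve E' \<or> even_cm_curve E \<and> even_cm_curve E'"

definition J0 :: "real weierstrass \<Rightarrow> real set" where
  "J0 E = {j_invariant E' | E'. elliptic_curve E' \<and> isogenous_over_reals E' E \<and>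
     same_parity (complexification E') (complexification E)}"

end

theory Submission
  imports Defs "HOL-Complex_Analysis.Complex_Analysis"
begin

text \<open>
  Every real elliptic curve is uniformized by a lattice \<open>c (\<int> + \<tau> \<int>)\<close> with \<open>\<tau> = i t\<close>
  (negative \<open>4 A\<^sup>3 + 27 B\<^sup>2\<close>) or \<open>\<tau> = 1/2 + i t\<close> (positive \<open>4 A\<^sup>3 + 27 B\<^sup>2\<close>), where \<open>c\<close> is real
  or purely imaginary, and \<open>j\<close> is a continuous function of \<open>t\<close> in each of the two families.
  Morphisms between uniformized curves that fix the origin are exactly the maps
  \<open>z \<mapsto> \<alpha> z\<close> with \<open>\<alpha> L \<subseteq> L'\<close>. Hence there is complex multiplication if and only if
  \<open>\<bar>\<tau>\<bar>\<^sup>2\<close> is a rational number \<open>p/q\<close> in lowest terms, and then the endomorphism ring is \<open>\<int>[q \<tau>]\<close>,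
  of discriminant \<open>- 4 p q\<close> or \<open>q\<^sup>2 - 4 p q\<close>. So odd curves occur only in the second family, where
  \<open>j \<le> 1728\<close>. Replacing \<open>t\<close> by a rational multiple gives an isogenous curve over the reals,
  and within each family the rational multiples that give the right parity are dense.
\<close>

subsection \<open>Lattices and elliptic functions\<close>

text \<open>\<open>morphism_over\<close> asks for forms with coefficients in the given field around
  every complex point, so an inclusion of lattices has to be turned into polynomials in
  \<open>x\<close> and \<open>y\<close>. The functions involved are arranged to have poles only at
  lattice points; then Liouville's theorem and order-by-order removal of the pole do the work of
  Laurent series, and real coefficients come from symmetry under conjugation. The invariant
  \<open>j\<close> alone does not fix a real curve: twisting by -1 changes the sign of
  \<open>B\<close> and keeps \<open>j\<close>. Therefore the uniformization matches \<open>A\<close>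
  and \<open>B\<close> themselves, up to a scaling \<open>c\<close>. Isogenous curves are built with
  the same \<open>c\<close>, which makes the isogeny multiplication by an integer, hence real.
  Surjectivity of the uniformization is an intermediate value argument that needs continuity up to
  the cusp; series in the nome provide it. Parity is a condition at the prime 2 on the ratio of
  parameters: odd over odd keeps an odd curve odd, and a large power of 2 in the denominator makes a
  curve of the second family even.\<close>

lemma removable_drop:
  fixes f :: "complex \<Rightarrow> complex"
  assumes "f holomorphic_on S - {0}" "open S" "0 \<in> S" "((\<lambda>z. z ^ Suc n * f z) \<longlongrightarrow> 0) (at 0)"
  shows "\<exists>M. ((\<lambda>z. z ^ n * f z) \<longlongrightarrow> M) (at 0)"
proof -
  \<comment> \<open>The function \<open>z ^ Suc n * f z\<close> extends holomorphically by 0, and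
    its difference quotient at 0 is \<open>z ^ n * f z\<close>. Each use of the lemma lowers the
    order of a pole by one once the leading coefficient is known to vanish.\<close>
  define g where "g = (\<lambda>z. if z = 0 then 0 else z ^ Suc n * f z)"
  have g: "g holomorphic_on S"
    unfolding g_def using assms by (intro removable_singularity holomorphic_intros) auto
  then have "(g has_field_derivative deriv g 0) (at 0)"
    using assms holomorphic_derivI by blast
  then have "((\<lambda>z. (g z - g 0) / (z - 0)) \<longlongrightarrow> deriv g 0) (at 0)"
    by (simp add: has_field_derivative_iff)
  then have "((\<lambda>z. z ^ n * f z) \<longlongrightarrow> deriv g 0) (at 0)"
    by (rule Lim_transform_eventually) (auto simp: eventually_at_filter g_def)
  then show ?thesis by blast
qed

text \<open>Substituting \<open>- z\<close> turns the limit into its negative. So an even function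
  has no coefficient at \<open>1 / z\<close>, and parity yields every second step of a pole
  reduction for free.\<close>

lemma limit_odd_even:
  fixes f :: "complex \<Rightarrow> complex"
  assumes "((\<lambda>z. z * f z) \<longlongrightarrow> M) (at 0)" "\<forall>\<^sub>F z in at 0. f (- z) = f z"
  shows "M = 0"
proof -
  have "((\<lambda>z. (- z) * f (- z)) \<longlongrightarrow> M) (at 0)"
    by (rule filterlim_compose[OF assms(1), of uminus "at 0"]) (simp add: filterlim_def filtermap_at_minus)
  then have "((\<lambda>z. - (z * f z)) \<longlongrightarrow> M) (at 0)"
    by (rule Lim_transform_eventually) (use assms(2) in \<open>auto elim: eventually_mono\<close>)
  moreover have "((\<lambda>z. - (z * f z)) \<longlongrightarrow> - M) (at 0)"
    by (intro tendsto_intros assms)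
  ultimately have "M = - M"
    by (intro LIM_unique)
  then show ?thesis by simp
qed

text \<open>The differences solve a linear system \<open>u' = k v\<close>, \<open>v' = s u\<close>
  with holomorphic \<open>s\<close>. By the Leibniz rule all their derivatives vanish at
  \<open>a\<close>, and the identity theorem spreads this over \<open>S\<close>. It is applied to
  \<open>x\<close> and \<open>y\<close>, with \<open>k = 2\<close> and \<open>c = 3\<close>.\<close>

lemma ode_unique:
  fixes f1 f2 g1 g2 :: "complex \<Rightarrow> complex"
  assumes S: "open S" "connected S" "a \<in> S"
    and d: "\<And>z. z \<in> S \<Longrightarrow> (f1 has_field_derivative k * g1 z) (at z)"
       "\<And>z. z \<in> S \<Longrightarrow> (g1 has_field_derivative c * f1 z ^ 2 + A) (at z)"
       "\<And>z. z \<in> S \<Longrightarrow> (f2 has_field_derivative k * g2 z) (at z)"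
       "\<And>z. z \<in> S \<Longrightarrow> (g2 has_field_derivative c * f2 z ^ 2 + A) (at z)"
    and eq: "f1 a = f2 a" "g1 a = g2 a"
    and z: "z \<in> S"
  shows "f1 z = f2 z" "g1 z = g2 z"
proof -
  define u where "u = (\<lambda>z. f1 z - f2 z)"
  define v where "v = (\<lambda>z. g1 z - g2 z)"
  define s where "s = (\<lambda>z. c * (f1 z + f2 z))"
  have hol: "f1 holomorphic_on S" "f2 holomorphic_on S" "g1 holomorphic_on S" "g2 holomorphic_on S"
    unfolding holomorphic_on_open[OF S(1)] using d by blast+
  have hu: "u holomorphic_on S" "v holomorphic_on S" "s holomorphic_on S"
    unfolding u_def v_def s_def by (intro holomorphic_intros hol)+
  have du: "deriv u z = k * v z" if "z \<in> S" for z
    by (rule DERIV_imp_deriv) (auto simp: u_def v_def intro!: derivative_eq_intros d that simp: algebra_simps)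
  have dv: "deriv v z = s z * u z" if "z \<in> S" for z
    by (rule DERIV_imp_deriv)
      (auto simp: u_def v_def s_def power2_eq_square intro!: derivative_eq_intros d that simp: algebra_simps)
  have Du: "(deriv ^^ Suc n) u z = k * (deriv ^^ n) v z" if "z \<in> S" for n z
  proof -
    have "(deriv ^^ Suc n) u z = (deriv ^^ n) (deriv u) z"
      by (simp add: funpow_swap1)
    also have "\<dots> = (deriv ^^ n) (\<lambda>z. k * v z) z"
      by (rule higher_deriv_transform_within_open[OF _ _ S(1) that])
         (use du hu S in \<open>auto intro!: holomorphic_intros holomorphic_deriv\<close>)
    also have "\<dots> = k * (deriv ^^ n) v z"
      using higher_deriv_cmult[OF hu(2) that S(1)] by simp
    finally show ?thesis .
  qed
  have Dv: "(deriv ^^ Suc n) v z = (\<Sum>i=0..n. of_nat (n choose i) * (deriv ^^ i) s z * (deriv ^^ (n - i)) u z)" if "z \<in> S" for n z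
  proof -
    have "(deriv ^^ Suc n) v z = (deriv ^^ n) (deriv v) z"
      by (simp add: funpow_swap1)
    also have "\<dots> = (deriv ^^ n) (\<lambda>z. s z * u z) z"
      by (rule higher_deriv_transform_within_open[OF _ _ S(1) that])
         (use dv hu S in \<open>auto intro!: holomorphic_intros holomorphic_deriv\<close>)
    finally show ?thesis
      using higher_deriv_mult[OF hu(3,1) S(1) that] by simp
  qed
  have 0: "(deriv ^^ n) u a = 0 \<and> (deriv ^^ n) v a = 0" for n
  proof (induction n rule: less_induct)
    case (less n)
    show ?case
    proof (cases n)
      case 0
      then show ?thesis using eq by (simp add: u_def v_def)
    next
      case (Suc m)
      have "(deriv ^^ (m - i)) u a = 0" for i
        using less[of "m - i"] Suc by auto
      then show ?thesis
        unfolding Suc Du[OF S(3)] Dv[OF S(3)] using less[of m] Suc by auto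
    qed
  qed
  show "f1 z = f2 z"
    using holomorphic_fun_eq_0_on_connected[OF hu(1) S(1,2) _ S(3) z] 0 by (simp add: u_def)
  show "g1 z = g2 z"
    using holomorphic_fun_eq_0_on_connected[OF hu(2) S(1,2) _ S(3) z] 0 by (simp add: v_def)
qed

lemma DERIV_zero_connected_const:
  fixes f :: "complex \<Rightarrow> complex"
  assumes S: "open S" "connected S" and d: "\<And>z. z \<in> S \<Longrightarrow> (f has_field_derivative 0) (at z)" and ab: "a \<in> S" "b \<in> S"
  shows "f a = f b"
proof -
  have "continuous_on S f"
    using d DERIV_isCont continuous_at_imp_continuous_on by blast
  then obtain c where "\<And>z. z \<in> S \<Longrightarrow> f z = c"
    using DERIV_zero_connected_constant[OF S(2,1), of "{}" f] d by auto
  then show ?thesis using ab by simp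
qed

section \<open>Plane lattices and Liouville's theorem on the torus\<close>

locale lattice2 =
  fixes w1 w2 :: complex
  assumes indep: "Im (w2 / w1) \<noteq> 0"
begin

definition L :: "complex set" where
  "L = {of_int m * w1 + of_int n * w2 | m n. True}"

lemma w1_nz [simp]: "w1 \<noteq> 0"
  using indep by auto

definition coord2 :: "complex \<Rightarrow> real" where "coord2 z = Im (z / w1) / Im (w2 / w1)"
definition coord1 :: "complex \<Rightarrow> real" where "coord1 z = Re (z / w1) - coord2 z * Re (w2 / w1)"

lemma coords: "z = of_real (coord1 z) * w1 + of_real (coord2 z) * w2"
proof -
  define r where "r = w2 / w1"
  have "z / w1 = of_real (coord1 z) + of_real (coord2 z) * r"
    using indep by (simp add: complex_eq_iff coord1_def coord2_def r_def[symmetric])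
  then have "z / w1 = of_real (coord1 z) + of_real (coord2 z) * (w2 / w1)" by (simp add: r_def)
  then show ?thesis by (simp add: field_simps)
qed

lemma coord_combination: "coord1 (of_real a * w1 + of_real b * w2) = a" "coord2 (of_real a * w1 + of_real b * w2) = b"
proof -
  have e: "(of_real a * w1 + of_real b * w2) / w1 = of_real a + of_real b * (w2 / w1)"
    by (simp add: field_simps)
  show "coord2 (of_real a * w1 + of_real b * w2) = b"
    unfolding coord2_def e using indep by (simp del: times_divide_eq_right)
  then show "coord1 (of_real a * w1 + of_real b * w2) = a"
    unfolding coord1_def e by (simp del: times_divide_eq_right)
qed

lemma L_iff: "z \<in> L \<longleftrightarrow> coord1 z \<in> \<int> \<and> coord2 z \<in> \<int>"
proof
  assume "z \<in> L"
  then obtain m n where "z = of_real (of_int m) * w1 + of_real (of_int n) * w2"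
    by (auto simp: L_def)
  then show "coord1 z \<in> \<int> \<and> coord2 z \<in> \<int>" using coord_combination Ints_of_int by metis
next
  assume "coord1 z \<in> \<int> \<and> coord2 z \<in> \<int>"
  then obtain m n where "coord1 z = of_int m" "coord2 z = of_int n" by (auto elim!: Ints_cases)
  then show "z \<in> L" using coords[of z] by (auto simp: L_def)
qed

lemma L_I: "of_int m * w1 + of_int n * w2 \<in> L"
  by (auto simp: L_def)

lemma L_0 [simp]: "0 \<in> L" and w1_L [simp]: "w1 \<in> L" and w2_L [simp]: "w2 \<in> L"
  using L_I[of 0 0] L_I[of 1 0] L_I[of 0 1] by simp_all

lemma coord1_add: "coord1 (a + b) = coord1 a + coord1 b" and coord2_add: "coord2 (a + b) = coord2 a + coord2 b"
  and coord1_minus: "coord1 (- a) = - coord1 a" and coord2_minus: "coord2 (- a) = - coord2 a"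
  by (auto simp: coord1_def coord2_def add_divide_distrib algebra_simps)

lemma L_add [intro]: "a \<in> L \<Longrightarrow> b \<in> L \<Longrightarrow> a + b \<in> L"
  unfolding L_iff by (simp add: coord1_add coord2_add)

lemma L_uminus: "- a \<in> L \<longleftrightarrow> a \<in> L"
  unfolding L_iff by (simp add: coord1_minus coord2_minus)

lemma L_diff [intro]: "a \<in> L \<Longrightarrow> b \<in> L \<Longrightarrow> a - b \<in> L"
  using L_add[of a "-b"] L_uminus by simp

lemma L_add_iff: "b \<in> L \<Longrightarrow> a + b \<in> L \<longleftrightarrow> a \<in> L" "b \<in> L \<Longrightarrow> b + a \<in> L \<longleftrightarrow> a \<in> L"
  "b \<in> L \<Longrightarrow> a - b \<in> L \<longleftrightarrow> a \<in> L" "b \<in> L \<Longrightarrow> b - a \<in> L \<longleftrightarrow> a \<in> L"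
proof -
  show 1: "a + b \<in> L \<longleftrightarrow> a \<in> L" if "b \<in> L" for a b
    using L_add[of a b] L_diff[of "a+b" b] that by auto
  show "b \<in> L \<Longrightarrow> b + a \<in> L \<longleftrightarrow> a \<in> L"
    using 1[of b a] by (simp add: add.commute)
  show "b \<in> L \<Longrightarrow> a - b \<in> L \<longleftrightarrow> a \<in> L"
    using 1[of "-b" a] by (simp add: L_uminus)
  show "b \<in> L \<Longrightarrow> b - a \<in> L \<longleftrightarrow> a \<in> L"
    using 1[of b "-a"] by (simp add: L_uminus add.commute)
qed

lemma L_of_int: "a \<in> L \<Longrightarrow> of_int k * a \<in> L"
proof -
  assume "a \<in> L"
  then obtain m n where "a = of_int m * w1 + of_int n * w2" by (auto simp: L_def)
  then show ?thesis using L_I[of "k * m" "k * n"] by (simp add: algebra_simps)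
qed

lemma half_notin: "w1 / 2 \<notin> L" "w2 / 2 \<notin> L" "(w1 + w2) / 2 \<notin> L" "w1 / 2 - w2 / 2 \<notin> L"
proof -
  have h: "(1/2::real) \<notin> \<int>" 
    by (auto elim!: Ints_cases simp: field_simps)
  have "w1 / 2 = of_real (1/2) * w1 + of_real 0 * w2" "w2 / 2 = of_real 0 * w1 + of_real (1/2) * w2"
    "(w1 + w2) / 2 = of_real (1/2) * w1 + of_real (1/2) * w2"
    "w1 / 2 - w2 / 2 = of_real (1/2) * w1 + of_real (-1/2) * w2"
    by (auto simp: field_simps)
  then have "coord1 (w1 / 2) = 1/2" "coord2 (w2/2) = 1/2" "coord1 ((w1 + w2)/2) = 1/2" "coord1 (w1 / 2 - w2 / 2) = 1/2"
    using coord_combination by metis+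
  then show "w1 / 2 \<notin> L" "w2 / 2 \<notin> L" "(w1 + w2) / 2 \<notin> L" "w1 / 2 - w2 / 2 \<notin> L"
    using h unfolding L_iff by metis+
qed

lemma L_discrete: "\<exists>e>0. \<forall>z\<in>L. norm z < e \<longrightarrow> z = 0"
proof -
  define I where "I = \<bar>Im (w2 / w1)\<bar>"
  define R where "R = \<bar>Re (w2 / w1)\<bar>"
  have I: "I > 0" using indep by (simp add: I_def)
  have R: "R \<ge> 0" by (simp add: R_def)
  \<comment> \<open>The first bound forces \<open>\<bar>coord2 z\<bar> < 1\<close>, hence
    \<open>coord2 z = 0\<close> by integrality; then \<open>coord1 z\<close> is a real part, and the
    second bound makes it less than 1 in absolute value.\<close>
  define e where "e = norm w1 * min I (1 / (1 + R / I))"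
  have e: "e > 0" using I R by (auto simp: e_def intro!: mult_pos_pos divide_pos_pos add_pos_nonneg)
  have "z = 0" if "z \<in> L" "norm z < e" for z
  proof -
    have n: "norm (z / w1) < min I (1 / (1 + R / I))"
      using that(2) by (simp add: e_def norm_divide pos_divide_less_eq mult.commute del: min_less_iff_conj)
    have "\<bar>coord2 z\<bar> = \<bar>Im (z / w1)\<bar> / I" by (simp add: coord2_def I_def abs_divide)
    also have "\<dots> \<le> norm (z / w1) / I" using abs_Im_le_cmod I by (intro divide_right_mono) auto
    finally have b: "\<bar>coord2 z\<bar> \<le> norm (z / w1) / I" .
    also have "\<dots> < 1" using n I by (simp add: field_simps)
    finally have "\<bar>coord2 z\<bar> < 1" .
    with that have cb0: "coord2 z = 0" using L_iff[of z] by (auto elim!: Ints_cases)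
    have "\<bar>coord1 z\<bar> \<le> norm (z / w1)" using abs_Re_le_cmod[of "z/w1"] by (simp add: coord1_def cb0)
    also have "\<dots> < 1 / (1 + R / I)" using n by simp
    also have "\<dots> \<le> 1" using I R by (simp add: field_simps)
    finally have "coord1 z = 0" using that L_iff[of z] by (auto elim!: Ints_cases)
    then show ?thesis using coords[of z] cb0 by simp
  qed
  then show ?thesis using e by blast
qed

lemma L_open: "open (- L)"
proof -
  obtain e where e: "e > 0" "\<And>z. z \<in> L \<Longrightarrow> norm z < e \<Longrightarrow> z = 0" using L_discrete by blast
  have "closed L"
    by (rule discrete_imp_closed[OF e(1)]) (use e(2) L_diff in \<open>force simp: dist_norm\<close>)
  then show "open (- L)" by auto
qed

lemma L_countable: "countable L"
proof -
  have "L = (\<lambda>(m::int, n::int). of_int m * w1 + of_int n * w2) ` UNIV"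
    by (auto simp: L_def)
  then show ?thesis by simp
qed

text \<open>A countable set does not disconnect the plane. The extra set \<open>T\<close> is for
  identities between translates, where further lattice-like sets of singular arguments must be left
  out.\<close>

lemma connected_minus_countable: "countable T \<Longrightarrow> connected (- L - T)"
proof -
  assume "countable T"
  then have "connected (UNIV - (L \<union> T))"
    by (intro connected_open_diff_countable) (auto simp: L_countable)
  then show ?thesis by (simp add: Compl_eq_Diff_UNIV Diff_Diff_Int Un_Diff Diff_Un set_diff_eq Int_def conj_comms)
qed

lemma L_connected: "connected (- L)"
  using connected_minus_countable[of "{}"] by simp

text \<open>Rounding both coordinates down moves \<open>z\<close> into a bounded parallelogram. This
  makes a periodic entire function bounded.\<close>

lemma L_reduce: "\<exists>R. \<forall>z. \<exists>l\<in>L. norm (z - l) \<le> R"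
proof (intro exI allI)
  fix z
  let ?l = "of_int \<lfloor>coord1 z\<rfloor> * w1 + of_int \<lfloor>coord2 z\<rfloor> * w2"
  have "z - ?l = of_real (coord1 z - \<lfloor>coord1 z\<rfloor>) * w1 + of_real (coord2 z - \<lfloor>coord2 z\<rfloor>) * w2"
    by (subst (1) coords[of z]) (simp add: algebra_simps)
  also have "norm \<dots> \<le> norm (of_real (coord1 z - \<lfloor>coord1 z\<rfloor>) * w1) + norm (of_real (coord2 z - \<lfloor>coord2 z\<rfloor>) * w2)"
    by (rule norm_triangle_ineq)
  also have "\<dots> \<le> 1 * norm w1 + 1 * norm w2"
    unfolding norm_mult norm_of_real by (intro add_mono mult_right_mono) (auto, linarith+)
  finally show "\<exists>l\<in>L. norm (z - l) \<le> norm w1 + norm w2"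
    by (intro bexI[of _ ?l]) (auto simp: L_def)
qed

lemma L_ev: "\<forall>\<^sub>F z in at z0. z \<notin> L"
proof -
  obtain e where e: "e > 0" "\<And>z. z \<in> L \<Longrightarrow> norm z < e \<Longrightarrow> z = 0" using L_discrete by blast
  show ?thesis
  proof (cases "z0 \<in> L")
    case True
    then show ?thesis
      unfolding eventually_at using e L_diff[of _ z0] by (intro exI[of _ e]) (force simp: dist_norm)
  next
    case False
    then show ?thesis using L_open eventually_at_in_open'[of "-L" z0] by auto
  qed
qed

text \<open>Functions on the torus that are holomorphic outside the origin.\<close>

definition ell :: "(complex \<Rightarrow> complex) \<Rightarrow> bool" where
  "ell f \<longleftrightarrow> f holomorphic_on - L \<and> (\<forall>z l. z \<notin> L \<longrightarrow> l \<in> L \<longrightarrow> f (z + l) = f z)"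

lemma ell_const [intro]: "ell (\<lambda>z. c)"
  and ell_add [intro]: "ell f \<Longrightarrow> ell g \<Longrightarrow> ell (\<lambda>z. f z + g z)"
  and ell_diff [intro]: "ell f \<Longrightarrow> ell g \<Longrightarrow> ell (\<lambda>z. f z - g z)"
  and ell_mult [intro]: "ell f \<Longrightarrow> ell g \<Longrightarrow> ell (\<lambda>z. f z * g z)"
  and ell_power [intro]: "ell f \<Longrightarrow> ell (\<lambda>z. f z ^ n)"
  by (auto simp: ell_def intro!: holomorphic_intros)

lemma ell_prod: "(\<And>i. i \<in> I \<Longrightarrow> ell (f i)) \<Longrightarrow> ell (\<lambda>z. \<Prod>i\<in>I. f i z)"
  by (auto simp: ell_def intro!: holomorphic_intros prod.cong)

lemma ell_uminus: "ell f \<Longrightarrow> ell (\<lambda>z. f (- z))"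
  unfolding ell_def
proof (intro conjI allI impI)
  assume f: "f holomorphic_on - L \<and> (\<forall>z l. z \<notin> L \<longrightarrow> l \<in> L \<longrightarrow> f (z + l) = f z)"
  show "(\<lambda>z. f (- z)) holomorphic_on - L"
    using f by (intro holomorphic_on_compose_gen[of uminus _ f "-L", unfolded o_def])
      (auto intro!: holomorphic_intros simp: L_uminus)
  fix z l assume "z \<notin> L" "l \<in> L"
  then have "f (- z + - l) = f (- z)" using f L_uminus by blast
  then show "f (- (z + l)) = f (- z)" by simp
qed

lemma ell_hol0: "ell f \<Longrightarrow> \<exists>S. open S \<and> 0 \<in> S \<and> f holomorphic_on S - {0}"
proof -
  assume f: "ell f"
  obtain e where e: "e > 0" "\<And>z. z \<in> L \<Longrightarrow> norm z < e \<Longrightarrow> z = 0" using L_discrete by blast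
  have "ball 0 e - {0} \<subseteq> - L" using e by auto
  then have "f holomorphic_on ball 0 e - {0}"
    using f holomorphic_on_subset unfolding ell_def by blast
  then show ?thesis using e(1) by (intro exI[of _ "ball 0 e"]) auto
qed

lemma ell_drop:
  "ell f \<Longrightarrow> ((\<lambda>z. z ^ Suc n * f z) \<longlongrightarrow> 0) (at 0) \<Longrightarrow> \<exists>M. ((\<lambda>z. z ^ n * f z) \<longlongrightarrow> M) (at 0)"
  using ell_hol0[of f] removable_drop[of f] by blast

text \<open>The limit fills the singularity at 0, periodicity copies this to every lattice point,
  and the resulting entire function takes all its values on a compact disc.\<close>

lemma ell_liouville:
  assumes f: "ell f" and lim: "(f \<longlongrightarrow> c) (at 0)" and z: "z \<notin> L"
  shows "f z = c"
proof -
  define g where "g = (\<lambda>z. if z \<in> L then c else f z)"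
  have per: "g (z + l) = g z" if "l \<in> L" for z l
    using that f by (auto simp: g_def ell_def L_add_iff)
  obtain S where S: "open S" "0 \<in> S" "f holomorphic_on S - {0}" using ell_hol0[OF f] by blast
  obtain e where e: "e > 0" "\<And>z. z \<in> L \<Longrightarrow> norm z < e \<Longrightarrow> z = 0" using L_discrete by blast
  have g0: "g holomorphic_on S \<inter> ball 0 e"
  proof -
    have "(\<lambda>y. if y = 0 then c else f y) holomorphic_on S"
      by (rule removable_singularity[OF S(3,1) lim])
    then have "(\<lambda>y. if y = 0 then c else f y) holomorphic_on S \<inter> ball 0 e"
      by (rule holomorphic_on_subset) auto
    then show ?thesis
      by (rule holomorphic_transform) (use e in \<open>auto simp: g_def\<close>)
  qed
  have "g field_differentiable (at w)" for w
  proof (cases "w \<in> L")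
    case False
    have "f field_differentiable (at w)"
      using f False L_open holomorphic_on_imp_differentiable_at unfolding ell_def by blast
    then have "(f has_field_derivative deriv f w) (at w)"
      by (simp add: DERIV_deriv_iff_field_differentiable)
    then have "(g has_field_derivative deriv f w) (at w)"
      by (rule has_field_derivative_transform_within_open[OF _ L_open]) (use False in \<open>auto simp: g_def\<close>)
    then show ?thesis by (auto simp: field_differentiable_def)
  next
    case True
    have "g field_differentiable (at 0)"
      by (rule holomorphic_on_imp_differentiable_at[OF g0]) (use S e in auto)
    then have "(g has_field_derivative deriv g 0) (at (w - w))"
      by (simp add: DERIV_deriv_iff_field_differentiable)
    then have "((\<lambda>z. g (z - w)) has_field_derivative deriv g 0) (at w)"
      using DERIV_shift[of g "deriv g 0" w "-w"] by simp
    moreover have "(\<lambda>z. g (z - w)) = g"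
      using per[of "-w"] True L_uminus by (auto simp: fun_eq_iff)
    ultimately show ?thesis by (auto simp: field_differentiable_def)
  qed
  then have hol: "g holomorphic_on UNIV"
    by (simp add: holomorphic_on_def)
  obtain R where R: "\<And>z. \<exists>l\<in>L. norm (z - l) \<le> R" using L_reduce by blast
  have "bounded (g ` cball 0 R)"
    by (intro compact_imp_bounded compact_continuous_image continuous_on_subset[OF holomorphic_on_imp_continuous_on[OF hol]]) auto
  moreover have "range g \<subseteq> g ` cball 0 R"
  proof clarify
    fix z
    obtain l where "l \<in> L" "norm (z - l) \<le> R" using R by blast
    then show "g z \<in> g ` cball 0 R" using per[of "-l" z] L_uminus by (intro image_eqI[of _ _ "z - l"]) auto
  qed
  ultimately have "bounded (range g)" using bounded_subset by blast
  then obtain k where "\<And>z. g z = k"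
    using Liouville_theorem[OF hol] by (auto simp: constant_on_def)
  then have "g z = g 0" by metis
  then show ?thesis using z by (simp add: g_def)
qed

text \<open>The hypothesis removes the pole of order two, parity the one of order one, and Liouville
  does the rest. Most identities between elliptic functions below are instances: compare the leading
  coefficients of two even functions with a double pole.\<close>

lemma ell_even_const:
  assumes f: "ell f" and ev: "\<And>z. z \<notin> L \<Longrightarrow> f (- z) = f z" and lim: "((\<lambda>z. z ^ 2 * f z) \<longlongrightarrow> 0) (at 0)"
  shows "\<exists>c. (f \<longlongrightarrow> c) (at 0) \<and> (\<forall>z. z \<notin> L \<longrightarrow> f z = c)"
proof -
  obtain M where M: "((\<lambda>z. z ^ 1 * f z) \<longlongrightarrow> M) (at 0)"
    using ell_drop[OF f, of 1] lim by (auto simp: eval_nat_numeral)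
  have "M = 0"
    by (rule limit_odd_even[of f]) (use M ev eventually_mono[OF L_ev] in auto)
  then obtain c where "((\<lambda>z. z ^ 0 * f z) \<longlongrightarrow> c) (at 0)"
    using ell_drop[OF f, of 0] M by auto
  then show ?thesis using ell_liouville[OF f] by auto
qed

end

subsection \<open>Uniformized curves and the addition theorem\<close>

text \<open>Consequences of two points lying on one cubic. The first computes the derivative of the
  chord slope when the two arguments move in opposite directions. The second rewrites the sum
  formula so that nothing cancels when one point tends to infinity. The third makes the derivative
  of the second coordinate vanish.\<close>

lemma chord_aux:
  fixes x1 x2 y1 y2 A B :: complex
  assumes "x1 \<noteq> x2" "y1 ^ 2 = x1 ^ 3 + A * x1 + B" "y2 ^ 2 = x2 ^ 3 + A * x2 + B"
  defines "l \<equiv> (y2 - y1) / (x2 - x1)"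
  shows "((- (3 * x2\<^sup>2 + A) - (3 * x1\<^sup>2 + A)) * (x2 - x1) - (y2 - y1) * (- (2 * y2) - 2 * y1)) / ((x2 - x1) * (x2 - x1)) = x1 - x2"
    and "l ^ 2 - x1 - x2 = (x1\<^sup>2 * x2 + x1 * x2\<^sup>2 + A * (x1 + x2) + 2 * B - 2 * y1 * y2) / (x2 - x1) ^ 2"
    and "3 * x1 ^ 2 + A - 2 * l * y1 = (x1 - x2) * (x1 - (l ^ 2 - x1 - x2))"
proof -
  define d where "d = x2 - x1"
  have d: "d \<noteq> 0" using assms(1) by (simp add: d_def)
  have x2: "x2 = x1 + d" by (simp add: d_def)
  have B: "B = y1 * y1 - x1 * x1 * x1 - A * x1"
    using assms(2) by (simp add: power2_eq_square power3_eq_cube)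
  define l' where "l' = l"
  have y2: "y2 = y1 + l' * d" using d by (simp add: l'_def l_def d_def[symmetric])
  have "(y2 * y2 - x2 * x2 * x2 - A * x2 - B) = 0"
    using assms(3) by (simp add: power2_eq_square power3_eq_cube)
  then have "d * (2 * y1 * l' + l' * l' * d - (3 * x1 * x1 + 3 * x1 * d + d * d) - A) = 0"
    unfolding B x2 y2 by (simp add: algebra_simps)
  then have A: "A = 2 * y1 * l' + l' * l' * d - (3 * x1 * x1 + 3 * x1 * d + d * d)"
    unfolding mult_eq_0_iff using d by (simp add: algebra_simps)
  have "(- (3 * x2\<^sup>2 + A) - (3 * x1\<^sup>2 + A)) * (x2 - x1) - (y2 - y1) * (- (2 * y2) - 2 * y1) = (x1 - x2) * ((x2 - x1) * (x2 - x1))"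
    unfolding B y2 x2 A by (simp add: algebra_simps power2_eq_square)
  then show "((- (3 * x2\<^sup>2 + A) - (3 * x1\<^sup>2 + A)) * (x2 - x1) - (y2 - y1) * (- (2 * y2) - 2 * y1)) / ((x2 - x1) * (x2 - x1)) = x1 - x2"
    using assms(1) by (simp add: divide_eq_eq)
  have "(l' ^ 2 - x1 - x2) * d ^ 2 = x1\<^sup>2 * x2 + x1 * x2\<^sup>2 + A * (x1 + x2) + 2 * B - 2 * y1 * y2"
    unfolding B y2 x2 A by (simp add: algebra_simps power2_eq_square)
  then show "l ^ 2 - x1 - x2 = (x1\<^sup>2 * x2 + x1 * x2\<^sup>2 + A * (x1 + x2) + 2 * B - 2 * y1 * y2) / (x2 - x1) ^ 2"
    using d by (simp add: eq_divide_eq d_def[symmetric] l'_def)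
  have "3 * x1 ^ 2 + A - 2 * l' * y1 = (x1 - x2) * (x1 - (l' ^ 2 - x1 - x2))"
    unfolding y2 x2 A by (simp add: algebra_simps power2_eq_square)
  then show "3 * x1 ^ 2 + A - 2 * l * y1 = (x1 - x2) * (x1 - (l ^ 2 - x1 - x2))"
    by (simp add: l'_def)
qed

text \<open>The Weierstrass function \<open>x\<close> and half its derivative \<open>y\<close>; their values at lattice points are arbitrary.\<close>

locale wp = lattice2 +
  fixes x y :: "complex \<Rightarrow> complex" and A B :: complex
  assumes dx: "z \<notin> L \<Longrightarrow> (x has_field_derivative 2 * y z) (at z)"
    and dy: "z \<notin> L \<Longrightarrow> (y has_field_derivative 3 * x z ^ 2 + A) (at z)"
    and eqn: "z \<notin> L \<Longrightarrow> y z ^ 2 = x z ^ 3 + A * x z + B"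
    and x_per: "z \<notin> L \<Longrightarrow> l \<in> L \<Longrightarrow> x (z + l) = x z"
    and y_per: "z \<notin> L \<Longrightarrow> l \<in> L \<Longrightarrow> y (z + l) = y z"
    and x_even: "z \<notin> L \<Longrightarrow> x (- z) = x z"
    and y_odd: "z \<notin> L \<Longrightarrow> y (- z) = - y z"
    and x_lim: "((\<lambda>z. z ^ 2 * x z) \<longlongrightarrow> 1) (at 0)"
    and y_lim: "((\<lambda>z. z ^ 3 * y z) \<longlongrightarrow> - 1) (at 0)"
begin

abbreviation "EC \<equiv> Weierstrass A B"

definition Phi :: "complex \<Rightarrow> complex point" where
  "Phi z = (if z \<in> L then Infinity else Affine (x z) (y z))"

lemma Phi_points: "Phi z \<in> points EC"
  by (simp add: Phi_def points_def eqn)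

lemma Phi_per: "l \<in> L \<Longrightarrow> Phi (z + l) = Phi z"
  by (auto simp: Phi_def L_add_iff x_per y_per)

lemma Phi_cong: "z - w \<in> L \<Longrightarrow> Phi z = Phi w"
  using Phi_per[of "z - w" w] by simp

lemma ell_x: "ell x" and ell_y: "ell y"
  unfolding ell_def holomorphic_on_open[OF L_open] using dx dy x_per y_per by blast+

lemma x_isCont: "z \<notin> L \<Longrightarrow> isCont x z" and y_isCont: "z \<notin> L \<Longrightarrow> isCont y z"
  using dx dy DERIV_isCont by blast+

lemma eventually_nz_at0: "\<forall>\<^sub>F z in at (0::complex). z \<noteq> 0"
  by (simp add: eventually_at_filter)

text \<open>Arguments with the same image give solutions of the same initial value problem, so they differ
  by a period.\<close>

lemma Phi_inj:
  assumes "Phi u = Phi w"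
  shows "u - w \<in> L"
proof (cases "u \<in> L")
  case True
  then show ?thesis using assms by (auto simp: Phi_def split: if_splits)
next
  case False
  then have uw: "u \<notin> L" "w \<notin> L" "x u = x w" "y u = y w"
    using assms by (auto simp: Phi_def split: if_splits)
  define d where "d = w - u"
  define S where "S = - L \<inter> (\<lambda>z. z + d) -` (- L)"
  have "open S" unfolding S_def by (intro open_Int L_open open_vimage continuous_intros)
  have "S = - L - (\<lambda>l. l - d) ` L"
    by (force simp: S_def image_iff algebra_simps)
  then have "connected S" using connected_minus_countable[of "(\<lambda>l. l - d) ` L"] L_countable by simp
  have eq: "x z = x (z + d)" if "z \<in> S" for z
  proof (rule ode_unique(1)[OF \<open>open S\<close> \<open>connected S\<close>, of u x 2 y 3 A "\<lambda>z. x (z + d)" "\<lambda>z. y (z + d)"])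
    show "u \<in> S" using uw by (simp add: S_def d_def)
    show "((\<lambda>z. x (z + d)) has_field_derivative 2 * y (z + d)) (at z)" if "z \<in> S" for z
      using that DERIV_shift[of x _ z d] dx[of "z + d"] by (auto simp: S_def)
    show "((\<lambda>z. y (z + d)) has_field_derivative 3 * x (z + d) ^ 2 + A) (at z)" if "z \<in> S" for z
      using that DERIV_shift[of y _ z d] dy[of "z + d"] by (auto simp: S_def)
    show "(x has_field_derivative 2 * y z) (at z)" "(y has_field_derivative 3 * x z ^ 2 + A) (at z)" if "z \<in> S" for z
      using that dx dy by (simp_all add: S_def)
    show "x u = x (u + d)" "y u = y (u + d)" using uw by (simp_all add: d_def)
  qed fact
  \<comment> \<open>Otherwise \<open>x (z + d)\<close> stays bounded as \<open>z\<close> tends to 0,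
    whereas \<open>x\<close> has a double pole there.\<close>
  have "d \<in> L"
  proof (rule ccontr)
    assume d: "d \<notin> L"
    have "((\<lambda>z. z + d) \<longlongrightarrow> d) (at 0)" by (auto intro!: tendsto_eq_intros)
    then have c: "((\<lambda>z. x (z + d)) \<longlongrightarrow> x d) (at 0)"
      using isCont_tendsto_compose[OF x_isCont[OF d]] by blast
    have ev: "\<forall>\<^sub>F z in at 0. z + d \<notin> L"
    proof -
      have "open ((\<lambda>z. z + d) -` (- L))" by (intro L_open open_vimage continuous_intros)
      then show ?thesis using eventually_at_in_open'[of _ 0] d by force
    qed
    have "((\<lambda>z. z ^ 2 * x (z + d)) \<longlongrightarrow> 0 ^ 2 * x d) (at 0)"
      by (intro tendsto_intros c)
    then have "((\<lambda>z. z ^ 2 * x (z + d)) \<longlongrightarrow> 0) (at 0)" by simp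
    then have "((\<lambda>z. z ^ 2 * x z) \<longlongrightarrow> 0) (at 0)"
      by (rule Lim_transform_eventually)
        (use ev L_ev[of 0] in \<open>eventually_elim, use eq in \<open>auto simp: S_def\<close>\<close>)
    then show False using LIM_unique[OF x_lim] zero_neq_one by metis
  qed
  then show ?thesis using L_uminus[of "u - w"] by (simp add: d_def)
qed

lemma Phi_eq_iff: "Phi u = Phi w \<longleftrightarrow> u - w \<in> L"
  using Phi_inj Phi_cong by blast

text \<open>If \<open>x\<close> omitted the value \<open>a\<close>, then
  \<open>1 / (x z - a)\<close> would be elliptic with limit 0 at the origin, hence identically 0 by
  Liouville.\<close>

lemma x_surj: "\<exists>z. z \<notin> L \<and> x z = a"
proof (rule ccontr)
  assume "\<not> ?thesis"
  then have n: "\<And>z. z \<notin> L \<Longrightarrow> x z - a \<noteq> 0" by auto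
  define g where "g = (\<lambda>z. 1 / (x z - a))"
  have "ell g"
    using ell_x n by (auto simp: ell_def g_def intro!: holomorphic_intros)
  moreover have "(g \<longlongrightarrow> 0) (at 0)"
  proof -
    have "((\<lambda>z. z ^ 2 / (z ^ 2 * x z - z ^ 2 * a)) \<longlongrightarrow> 0 ^ 2 / (1 - 0 ^ 2 * a)) (at 0)"
      by (intro tendsto_intros x_lim) auto
    then have "((\<lambda>z. z ^ 2 / (z ^ 2 * x z - z ^ 2 * a)) \<longlongrightarrow> 0) (at 0)" by simp
    then show ?thesis
      by (rule Lim_transform_eventually)
        (use eventually_nz_at0 in \<open>eventually_elim, auto simp: g_def right_diff_distrib[symmetric]\<close>)
  qed
  ultimately have "g (w1 / 2) = 0" using ell_liouville half_notin(1) by blast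
  then show False using n[OF half_notin(1)] by (simp add: g_def)
qed

lemma Phi_surj: "P \<in> points EC \<Longrightarrow> \<exists>z. Phi z = P"
proof (cases P)
  case Infinity
  then show ?thesis by (intro exI[of _ 0]) (simp add: Phi_def)
next
  case (Affine a b)
  assume "P \<in> points EC"
  then have b: "b ^ 2 = a ^ 3 + A * a + B" by (simp add: points_def Affine)
  obtain z where z: "z \<notin> L" "x z = a" using x_surj by blast
  then have "y z ^ 2 = b ^ 2" using eqn b by simp
  then have "y z = b \<or> y z = - b" by (simp add: power2_eq_iff)
  then show ?thesis
  proof
    assume "y z = b"
    then show ?thesis using z Affine by (intro exI[of _ z]) (simp add: Phi_def)
  next
    assume "y z = - b"
    then show ?thesis using z Affine x_even y_odd L_uminus by (intro exI[of _ "- z"]) (simp add: Phi_def)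
  qed
qed

lemma Phi_0 [simp]: "Phi 0 = Infinity"
  by (simp add: Phi_def)

lemma Phi_Infinity_iff: "Phi z = Infinity \<longleftrightarrow> z \<in> L"
  by (simp add: Phi_def)

lemma x_eq_iff: "u \<notin> L \<Longrightarrow> w \<notin> L \<Longrightarrow> x u = x w \<longleftrightarrow> u - w \<in> L \<or> u + w \<in> L"
proof
  assume uw: "u \<notin> L" "w \<notin> L" and "x u = x w"
  then have "y u ^ 2 = y w ^ 2" using eqn by simp
  then have "y u = y w \<or> y u = - y w" by (simp add: power2_eq_iff)
  then have "Phi u = Phi w \<or> Phi u = Phi (- w)"
    using uw \<open>x u = x w\<close> by (auto simp: Phi_def L_uminus x_even y_odd)
  then show "u - w \<in> L \<or> u + w \<in> L" by (auto simp: Phi_eq_iff)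
next
  assume uw: "u \<notin> L" "w \<notin> L" and "u - w \<in> L \<or> u + w \<in> L"
  then have "Phi u = Phi w \<or> Phi u = Phi (- w)" by (auto simp: Phi_eq_iff)
  then show "x u = x w" using uw by (auto simp: Phi_def L_uminus x_even)
qed

lemma y_zero_iff: "u \<notin> L \<Longrightarrow> y u = 0 \<longleftrightarrow> 2 * u \<in> L"
proof -
  assume u: "u \<notin> L"
  have "y u = 0 \<longleftrightarrow> Phi u = Phi (- u)"
    using u by (auto simp: Phi_def L_uminus x_even y_odd)
  then show ?thesis by (simp add: Phi_eq_iff)
qed

definition slope :: "complex \<Rightarrow> complex \<Rightarrow> complex" where
  "slope u w = (y w - y u) / (x w - x u)"

text \<open>Moving the two points in opposite directions leaves the third intersection point of the chord
  fixed, so it suffices to let one of them tend to the origin.\<close>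

lemma addition_chord:
  assumes u: "u \<notin> L" "w \<notin> L" "u + w \<notin> L" "u - w \<notin> L"
  shows "x (u + w) = slope u w ^ 2 - x u - x w"
    and "y (u + w) = slope u w * (x u - x (u + w)) - y u"
proof -
  define c where "c = u + w"
  have c: "c \<notin> L" using u by (simp add: c_def)
  \<comment> \<open>The arguments \<open>s\<close> at which both points are affine and the chord is
    not vertical: as \<open>c\<close> is no period, \<open>x s = x (c - s)\<close> happens only if
    \<open>2 * s - c\<close> is a period.\<close>
  define S where "S = - L \<inter> (\<lambda>s. c - s) -` (- L) \<inter> (\<lambda>s. 2 * s - c) -` (- L)"
  have S_iff: "s \<in> S \<longleftrightarrow> s \<notin> L \<and> c - s \<notin> L \<and> 2 * s - c \<notin> L" for s
    by (auto simp: S_def)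
  have opS: "open ((\<lambda>s. c - s) -` (- L) \<inter> (\<lambda>s. 2 * s - c) -` (- L))"
    by (intro open_Int L_open open_vimage continuous_intros)
  have "open S" unfolding S_def Int_assoc using opS L_open by blast
  have "S = - L - ((\<lambda>l. c - l) ` L \<union> (\<lambda>l. (l + c) / 2) ` L)"
  proof -
    have "c - s \<in> L \<longleftrightarrow> s \<in> (\<lambda>l. c - l) ` L" for s
      by (auto simp: image_iff intro: bexI[of _ "c - s"])
    moreover have "2 * s - c \<in> L \<longleftrightarrow> s \<in> (\<lambda>l. (l + c) / 2) ` L" for s
      by (auto simp: image_iff field_simps intro!: bexI[of _ "2 * s - c"] dest: arg_cong[where f = "\<lambda>t. t - c"])
    ultimately show ?thesis using S_iff by blast
  qed
  then have "connected S" using connected_minus_countable L_countable by simp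
  have evS: "\<forall>\<^sub>F s in at 0. s \<in> S"
    using eventually_at_in_open'[OF opS, of 0] L_ev[of 0] c
    by (auto simp: L_uminus S_iff elim: eventually_elim2)
  define l where "l = (\<lambda>s. slope s (c - s))"
  \<comment> \<open>\<open>G s\<close> and \<open>H s\<close> are the coordinates that the chord law
    assigns to the sum of the points at \<open>s\<close> and \<open>c - s\<close>. Both have
    derivative zero, so their values at \<open>u\<close> can be computed as limits for
    \<open>s\<close> tending to 0.\<close>
  define G where "G = (\<lambda>s. l s ^ 2 - x s - x (c - s))"
  define H where "H = (\<lambda>s. l s * (x s - G s) - y s)"
  have ne: "x s \<noteq> x (c - s)" if "s \<in> S" for s
    using that x_eq_iff[of s "c - s"] c by (simp add: S_iff algebra_simps)
  have dm: "((\<lambda>s. c - s) has_field_derivative -1) (at s)" for s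
    by (auto intro!: derivative_eq_intros)
  have dx': "((\<lambda>s. x (c - s)) has_field_derivative - (2 * y (c - s))) (at s)" if "s \<in> S" for s
    using DERIV_chain2[OF dx dm, of s] that by (auto simp: S_iff)
  have dy': "((\<lambda>s. y (c - s)) has_field_derivative - (3 * x (c - s) ^ 2 + A)) (at s)" if "s \<in> S" for s
    using DERIV_chain2[OF dy dm, of s] that by (auto simp: S_iff)
  have dl: "(l has_field_derivative (x s - x (c - s))) (at s)" if s: "s \<in> S" for s
  proof -
    have "(l has_field_derivative ((- (3 * (x (c - s))\<^sup>2 + A) - (3 * (x s)\<^sup>2 + A)) * (x (c - s) - x s) - (y (c - s) - y s) * (- (2 * y (c - s)) - 2 * y s)) / ((x (c - s) - x s) * (x (c - s) - x s))) (at s)"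
      unfolding l_def slope_def
      by (intro DERIV_divide DERIV_diff dx' dy' dx dy s) (use s ne[OF s] in \<open>auto simp: S_iff\<close>)
    also have "((- (3 * (x (c - s))\<^sup>2 + A) - (3 * (x s)\<^sup>2 + A)) * (x (c - s) - x s) - (y (c - s) - y s) * (- (2 * y (c - s)) - 2 * y s)) / ((x (c - s) - x s) * (x (c - s) - x s)) = x s - x (c - s)"
      using s ne[OF s] by (intro chord_aux(1)[of _ _ _ A B] eqn) (auto simp: S_iff)
    finally show ?thesis .
  qed
  have ls: "l s * (x (c - s) - x s) = y (c - s) - y s" if "s \<in> S" for s
    using ne[OF that] by (simp add: l_def slope_def)
  have dG: "(G has_field_derivative 0) (at s)" if s: "s \<in> S" for s
  proof -
    have "(G has_field_derivative 2 * l s * (x s - x (c - s)) - 2 * y s + 2 * y (c - s)) (at s)"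
      unfolding G_def using s by (auto intro!: derivative_eq_intros dl dx dx' simp: S_iff)
    also have "2 * l s * (x s - x (c - s)) - 2 * y s + 2 * y (c - s) = 0"
    proof -
      have "2 * l s * (x s - x (c - s)) - 2 * y s + 2 * y (c - s) = 2 * ((y (c - s) - y s) - l s * (x (c - s) - x s))"
        by (simp add: algebra_simps)
      then show ?thesis using ls[OF s] by simp
    qed
    finally show ?thesis .
  qed
  have dH: "(H has_field_derivative 0) (at s)" if s: "s \<in> S" for s
  proof -
    have "(H has_field_derivative (x s - x (c - s)) * (x s - G s) + l s * (2 * y s) - (3 * x s ^ 2 + A)) (at s)"
      unfolding H_def using s by (auto intro!: derivative_eq_intros dl dx dy dG simp: S_iff)
    also have "(x s - x (c - s)) * (x s - G s) + l s * (2 * y s) - (3 * x s ^ 2 + A) = 0"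
      using chord_aux(3)[OF ne[OF s] eqn eqn] s by (simp add: S_iff G_def l_def slope_def algebra_simps)
    finally show ?thesis .
  qed
  have Gc: "G s = G u" and Hc: "H s = H u" if "s \<in> S" for s
  proof -
    have "u \<in> S" using u by (simp add: S_iff c_def)
    then show "G s = G u" "H s = H u"
      using DERIV_zero_connected_const[OF \<open>open S\<close> \<open>connected S\<close>] dG dH that by blast+
  qed
  have lx: "((\<lambda>s. x (c - s)) \<longlongrightarrow> x c) (at 0)" and ly: "((\<lambda>s. y (c - s)) \<longlongrightarrow> y c) (at 0)"
  proof -
    have "((\<lambda>s. c - s) \<longlongrightarrow> c) (at 0)" by (auto intro!: tendsto_eq_intros)
    then show "((\<lambda>s. x (c - s)) \<longlongrightarrow> x c) (at 0)" "((\<lambda>s. y (c - s)) \<longlongrightarrow> y c) (at 0)"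
      using isCont_tendsto_compose x_isCont[OF c] y_isCont[OF c] by blast+
  qed
  have id: "((\<lambda>s. s) \<longlongrightarrow> (0::complex)) (at 0)" by (rule tendsto_ident_at)
  have s2: "((\<lambda>s. (s ^ 2 * x (c - s) - s ^ 2 * x s)) \<longlongrightarrow> 0 ^ 2 * x c - 1) (at 0)"
    by (intro tendsto_intros lx x_lim)
  \<comment> \<open>Numerator and denominator of the second identity in \<open>chord_aux\<close>,
    both multiplied by \<open>s ^ 4\<close>. In the limit only the leading term
    \<open>(s ^ 2 * x s) ^ 2 * x (c - s)\<close> survives.\<close>
  have "((\<lambda>s. ((s ^ 2 * x s) ^ 2 * x (c - s) + s ^ 2 * (s ^ 2 * x s) * x (c - s) ^ 2 + A * (s ^ 2 * (s ^ 2 * x s) + s ^ 4 * x (c - s)) + 2 * B * s ^ 4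
       - 2 * s * (s ^ 3 * y s) * y (c - s)) / (s ^ 2 * x (c - s) - s ^ 2 * x s) ^ 2) \<longlongrightarrow>
     (1 ^ 2 * x c + 0 ^ 2 * 1 * x c ^ 2 + A * (0 ^ 2 * 1 + 0 ^ 4 * x c) + 2 * B * 0 ^ 4 - 2 * 0 * (- 1) * y c) / (0 ^ 2 * x c - 1) ^ 2) (at 0)"
    (is "((\<lambda>s. ?p s / ?q s) \<longlongrightarrow> _) _")
    by (intro tendsto_intros lx ly x_lim y_lim) auto
  then have lim: "((\<lambda>s. ?p s / ?q s) \<longlongrightarrow> x c) (at 0)" by simp
  have "((\<lambda>s::complex. G u) \<longlongrightarrow> x c) (at 0)"
  proof (rule Lim_transform_eventually[OF lim])
    show "\<forall>\<^sub>F s in at 0. ?p s / ?q s = G u"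
      using evS eventually_nz_at0
    proof eventually_elim
      case (elim s)
      have "G s = ((x s)\<^sup>2 * x (c - s) + x s * (x (c - s))\<^sup>2 + A * (x s + x (c - s)) + 2 * B - 2 * y s * y (c - s)) / (x (c - s) - x s) ^ 2"
        unfolding G_def l_def slope_def
        using elim ne[of s] by (intro chord_aux(2) eqn) (auto simp: S_iff)
      also have "\<dots> = (s ^ 4 * ((x s)\<^sup>2 * x (c - s) + x s * (x (c - s))\<^sup>2 + A * (x s + x (c - s)) + 2 * B - 2 * y s * y (c - s))) / (s ^ 4 * (x (c - s) - x s) ^ 2)"
        using elim by simp
      also have "s ^ 4 * (x (c - s) - x s) ^ 2 = ?q s"
        by (simp add: algebra_simps power2_eq_square power3_eq_cube power4_eq_xxxx)
      also have "s ^ 4 * ((x s)\<^sup>2 * x (c - s) + x s * (x (c - s))\<^sup>2 + A * (x s + x (c - s)) + 2 * B - 2 * y s * y (c - s)) = ?p s"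
        by (simp add: algebra_simps power2_eq_square power3_eq_cube power4_eq_xxxx)
      finally show ?case using Gc elim by simp
    qed
  qed
  then have G: "G u = x c" by (simp add: tendsto_const_iff)
  then show "x (u + w) = slope u w ^ 2 - x u - x w"
    by (simp add: G_def l_def c_def)
  have q: "((\<lambda>s. (x (c - s) - x c) / s) \<longlongrightarrow> - (2 * y c)) (at 0)"
  proof -
    have "((\<lambda>s. x (c - s)) has_field_derivative - (2 * y c)) (at 0)"
      using DERIV_chain2[OF dx dm, of 0] c by auto
    then show ?thesis by (simp add: has_field_derivative_iff)
  qed
  \<comment> \<open>The pole of \<open>y\<close> at 0 has order three, one more than the factor
    \<open>s ^ 2\<close> absorbs. Since \<open>G\<close> is already known to be \<open>x c\<close>,
    it meets the difference \<open>x (c - s) - x c\<close>, whose quotient by \<open>s\<close>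
    converges.\<close>
  have "((\<lambda>s. (y (c - s) * (s ^ 2 * x s - s ^ 2 * x c) - (s ^ 3 * y s) * ((x (c - s) - x c) / s)) / (s ^ 2 * x (c - s) - s ^ 2 * x s))
     \<longlongrightarrow> (y c * (1 - 0 ^ 2 * x c) - (- 1) * (- (2 * y c))) / (0 ^ 2 * x c - 1)) (at 0)"
    (is "((\<lambda>s. ?p s / ?q s) \<longlongrightarrow> _) _")
    by (intro tendsto_intros lx ly x_lim y_lim q) auto
  then have lim: "((\<lambda>s. ?p s / ?q s) \<longlongrightarrow> y c) (at 0)" by simp
  have "((\<lambda>s::complex. H u) \<longlongrightarrow> y c) (at 0)"
  proof (rule Lim_transform_eventually[OF lim])
    show "\<forall>\<^sub>F s in at 0. ?p s / ?q s = H u"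
      using evS eventually_nz_at0
    proof eventually_elim
      case (elim s)
      have n: "x (c - s) - x s \<noteq> 0" using elim ne[of s] by auto
      have "H s * (x (c - s) - x s) = y (c - s) * (x s - x c) - y s * (x (c - s) - x c)"
      proof -
        have "G s = x c" using Gc G elim by simp
        then have "H s * (x (c - s) - x s) = (l s * (x (c - s) - x s)) * (x s - x c) - y s * (x (c - s) - x s)"
          by (simp add: H_def algebra_simps)
        also have "\<dots> = (y (c - s) - y s) * (x s - x c) - y s * (x (c - s) - x s)"
          using ls[OF elim(1)] by simp
        finally show ?thesis by (simp add: algebra_simps)
      qed
      then have "H s = (y (c - s) * (x s - x c) - y s * (x (c - s) - x c)) / (x (c - s) - x s)"
        using n by (simp add: eq_divide_eq)
      also have "\<dots> = (s ^ 2 * (y (c - s) * (x s - x c) - y s * (x (c - s) - x c))) / (s ^ 2 * (x (c - s) - x s))"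
        using elim by simp
      also have "s ^ 2 * (y (c - s) * (x s - x c) - y s * (x (c - s) - x c)) = ?p s"
        using elim by (simp add: field_simps power2_eq_square power3_eq_cube)
      also have "s ^ 2 * (x (c - s) - x s) = ?q s" by (simp add: algebra_simps)
      finally show ?case using Hc elim by simp
    qed
  qed
  then have "H u = y c" by (simp add: tendsto_const_iff)
  then show "y (u + w) = slope u w * (x u - x (u + w)) - y u"
    using G by (simp add: H_def l_def c_def)
qed

text \<open>The limit of the chord formulas for \<open>w\<close> tending to \<open>u\<close>. The
  slope is a quotient of two difference quotients, and \<open>y u \<noteq> 0\<close> because
  \<open>2 * u\<close> is no period.\<close>

lemma addition_tangent:
  assumes u: "u \<notin> L" "2 * u \<notin> L"
  defines "l \<equiv> (3 * x u ^ 2 + A) / (2 * y u)"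
  shows "x (2 * u) = l ^ 2 - x u - x u"
    and "y (2 * u) = l * (x u - x (2 * u)) - y u"
proof -
  have yu: "y u \<noteq> 0" using u y_zero_iff by simp
  have ev: "\<forall>\<^sub>F w in at u. w \<notin> L \<and> u + w \<notin> L \<and> u - w \<notin> L \<and> w \<noteq> u"
  proof -
    have "open ((\<lambda>w. u + w) -` (- L))" by (intro open_vimage L_open continuous_intros)
    then have "\<forall>\<^sub>F w in at u. u + w \<notin> L"
      using eventually_at_in_open'[of "(\<lambda>w. u + w) -` (- L)" u] u by simp
    moreover obtain e where e: "e > 0" "\<And>z. z \<in> L \<Longrightarrow> norm z < e \<Longrightarrow> z = 0" using L_discrete by blast
    then have "\<forall>\<^sub>F w in at u. u - w \<notin> L"
      unfolding eventually_at by (intro exI[of _ e]) (force simp: dist_norm norm_minus_commute)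
    ultimately show ?thesis using L_ev[of u] eventually_neq_at_within[of u u UNIV]
      by eventually_elim auto
  qed
  have q: "((\<lambda>w. (x w - x u) / (w - u)) \<longlongrightarrow> 2 * y u) (at u)" "((\<lambda>w. (y w - y u) / (w - u)) \<longlongrightarrow> 3 * x u ^ 2 + A) (at u)"
    using dx[OF u(1)] dy[OF u(1)] by (simp_all add: has_field_derivative_iff)
  have "((\<lambda>w. ((y w - y u) / (w - u)) / ((x w - x u) / (w - u))) \<longlongrightarrow> l) (at u)"
    unfolding l_def by (intro tendsto_intros q) (use yu in auto)
  then have sl: "(slope u \<longlongrightarrow> l) (at u)"
    by (rule Lim_transform_eventually) (use ev in \<open>eventually_elim, auto simp: slope_def\<close>)
  have c: "(x \<longlongrightarrow> x u) (at u)" using x_isCont[OF u(1)] by (simp add: isCont_def)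
  have cx: "((\<lambda>w. x (u + w)) \<longlongrightarrow> x (2 * u)) (at u)" and cy: "((\<lambda>w. y (u + w)) \<longlongrightarrow> y (2 * u)) (at u)"
  proof -
    have "((\<lambda>w. u + w) \<longlongrightarrow> 2 * u) (at u)" by (auto intro!: tendsto_eq_intros)
    then show "((\<lambda>w. x (u + w)) \<longlongrightarrow> x (2 * u)) (at u)" "((\<lambda>w. y (u + w)) \<longlongrightarrow> y (2 * u)) (at u)"
      using isCont_tendsto_compose x_isCont[OF u(2)] y_isCont[OF u(2)] by blast+
  qed
  have "((\<lambda>w. slope u w ^ 2 - x u - x w) \<longlongrightarrow> l ^ 2 - x u - x u) (at u)"
    by (intro tendsto_intros sl c)
  then have "((\<lambda>w. x (u + w)) \<longlongrightarrow> l ^ 2 - x u - x u) (at u)"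
    by (rule Lim_transform_eventually)
       (use ev in \<open>eventually_elim, use addition_chord(1)[OF u(1)] in auto\<close>)
  then show "x (2 * u) = l ^ 2 - x u - x u" using LIM_unique[OF cx] by blast
  have "((\<lambda>w. slope u w * (x u - x (u + w)) - y u) \<longlongrightarrow> l * (x u - x (2 * u)) - y u) (at u)"
    by (intro tendsto_intros sl cx)
  then have "((\<lambda>w. y (u + w)) \<longlongrightarrow> l * (x u - x (2 * u)) - y u) (at u)"
    by (rule Lim_transform_eventually)
       (use ev in \<open>eventually_elim, use addition_chord(2)[OF u(1)] in auto\<close>)
  then show "y (2 * u) = l * (x u - x (2 * u)) - y u" using LIM_unique[OF cy] by blast
qed

text \<open>The branches of \<open>point_add\<close> become lattice conditions: opposite points mean
  \<open>u + w \<in> L\<close>, and an equal \<open>x\<close> otherwise means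
  \<open>u - w \<in> L\<close>, where the tangent formula applies.\<close>

lemma Phi_add: "point_add EC (Phi u) (Phi w) = Phi (u + w)"
proof (cases "u \<in> L \<or> w \<in> L")
  case True
  then show ?thesis
  proof
    assume "u \<in> L"
    then show ?thesis using Phi_per[of u w] by (simp add: Phi_Infinity_iff[THEN iffD2] add.commute)
  next
    assume "w \<in> L"
    then have "Phi w = Infinity" "Phi (u + w) = Phi u" using Phi_per by (simp_all add: Phi_Infinity_iff)
    then show ?thesis by (cases "Phi u") auto
  qed
next
  case False
  then have uw: "u \<notin> L" "w \<notin> L" by auto
  have inf: "x u = x w \<and> y u = - y w \<longleftrightarrow> u + w \<in> L"
  proof -
    have "x u = x w \<and> y u = - y w \<longleftrightarrow> Phi u = Phi (- w)"
      using uw by (auto simp: Phi_def L_uminus x_even y_odd)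
    then show ?thesis by (simp add: Phi_eq_iff)
  qed
  show ?thesis
  proof (cases "u + w \<in> L")
    case True
    then show ?thesis using uw inf by (simp add: Phi_def)
  next
    case sum: False
    show ?thesis
    proof (cases "x u = x w")
      case True
      then have d: "u - w \<in> L" using x_eq_iff uw sum by blast
      have e: "Phi (u + w) = Phi (2 * u)" by (rule Phi_cong) (use d L_uminus[of "u - w"] in \<open>simp add: algebra_simps\<close>)
      have u2: "2 * u \<notin> L" using sum d L_add_iff(1)[of "u - w" "u + w"] by (simp add: algebra_simps)
      have "Phi u = Phi w" using d Phi_cong by blast
      then have "y u = y w" using uw by (simp add: Phi_def)
      then show ?thesis
        unfolding e using uw u2 True inf sum addition_tangent[OF uw(1) u2] by (simp add: Phi_def Let_def)
    next
      case False
      then have d: "u - w \<notin> L" using x_eq_iff uw by blast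
      then show ?thesis
        using uw sum False addition_chord[OF uw sum d] by (simp add: Phi_def Let_def slope_def)
    qed
  qed
qed

end

subsection \<open>Elliptic functions with poles at the lattice points\<close>

lemma sum_sum_single:
  fixes t :: "nat \<Rightarrow> nat \<Rightarrow> 'a::comm_monoid_add"
  assumes "i + j \<le> d"
  shows "(\<Sum>i'\<le>d. \<Sum>j'\<le>d - i'. if i' = i \<and> j' = j then t i' j' else 0) = t i j"
proof -
  have "(\<Sum>i'\<le>d. \<Sum>j'\<le>d - i'. if i' = i \<and> j' = j then t i' j' else 0)
      = (\<Sum>i'\<le>d. if i' = i then t i j else 0)"
  proof (rule sum.cong[OF refl])
    fix i' assume "i' \<in> {..d}"
    show "(\<Sum>j'\<le>d - i'. if i' = i \<and> j' = j then t i' j' else 0) = (if i' = i then t i j else 0)"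
      using assms by (cases "i' = i") (auto simp: sum.delta)
  qed
  also have "\<dots> = t i j" using assms by simp
  finally show ?thesis .
qed

lemma form_eval_infinity: "form_eval d f (0, 1, 0) = f 0 d"
proof -
  have "form_eval d f (0, 1, 0) = (\<Sum>i\<le>d. \<Sum>j\<le>d - i. if i = 0 \<and> j = d then f i j else 0)"
    unfolding form_eval_def by (auto intro!: sum.cong simp: power_0_left)
  also have "\<dots> = f 0 d" by (rule sum_sum_single) simp
  finally show ?thesis .
qed

lemma form_eval_scale: "form_eval d f (k * X, k * Y, k * Z) = k ^ d * form_eval d f (X, Y, Z)"
proof -
  have "k ^ d = k ^ i * k ^ j * k ^ (d - i - j)" if "i \<le> d" "j \<le> d - i" for i j
    using that by (simp add: power_add[symmetric])
  then show ?thesis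
    unfolding form_eval_def
    by (auto simp: sum_distrib_left power_mult_distrib intro!: sum.cong)
qed

context wp
begin

text \<open>Up to a constant, a function with one simple pole would be odd, hence zero at the half periods;
  then its square \<open>M\<^sup>2 x + k\<close> shows that \<open>x\<close> has the same value at two of them.\<close>

lemma ell_pole1:
  assumes f: "ell f" and lim: "((\<lambda>z. z * f z) \<longlongrightarrow> M) (at 0)"
  shows "M = 0"
proof (rule ccontr)
  assume M: "M \<noteq> 0"
  have "((\<lambda>z. (- z) * f (- z)) \<longlongrightarrow> M) (at 0)"
    by (rule filterlim_compose[OF lim, of uminus "at 0"]) (simp add: filterlim_def filtermap_at_minus)
  then have lim': "((\<lambda>z. z * f (- z)) \<longlongrightarrow> - M) (at 0)"
    using tendsto_minus by fastforce
  define g where "g = (\<lambda>z. f z + f (- z))"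
  have "ell g" unfolding g_def by (intro ell_add f ell_uminus)
  moreover have "g (- z) = g z" for z by (simp add: g_def)
  moreover have "((\<lambda>z. z ^ 2 * g z) \<longlongrightarrow> 0) (at 0)"
  proof -
    have "((\<lambda>z. z * (z * f z + z * f (- z))) \<longlongrightarrow> 0 * (M + - M)) (at 0)"
      by (intro tendsto_intros lim lim')
    then show ?thesis by (simp add: g_def power2_eq_square algebra_simps)
  qed
  ultimately obtain k where k: "\<And>z. z \<notin> L \<Longrightarrow> g z = k"
    using ell_even_const by blast
  define h where "h = (\<lambda>z. f z - k / 2)"
  have h: "ell h" unfolding h_def by (intro ell_diff f ell_const)
  have odd: "h (- z) = - h z" if "z \<notin> L" for z
  proof -
    have "k = f z + f (- z)" using k[OF that] by (simp add: g_def)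
    then show ?thesis by (simp add: h_def field_simps)
  qed
  have hl: "((\<lambda>z. z * h z) \<longlongrightarrow> M) (at 0)"
  proof -
    have "((\<lambda>z. z * f z - z * (k / 2)) \<longlongrightarrow> M - 0 * (k / 2)) (at 0)"
      by (intro tendsto_intros lim)
    then show ?thesis by (simp add: h_def algebra_simps)
  qed
  define q where "q = (\<lambda>z. h z ^ 2 - M ^ 2 * x z)"
  have "ell q" unfolding q_def by (intro ell_diff ell_power ell_mult h ell_const ell_x)
  moreover have "q (- z) = q z" if "z \<notin> L" for z
    using that odd x_even by (simp add: q_def)
  moreover have "((\<lambda>z. z ^ 2 * q z) \<longlongrightarrow> 0) (at 0)"
  proof -
    have "((\<lambda>z. (z * h z) ^ 2 - M ^ 2 * (z ^ 2 * x z)) \<longlongrightarrow> M ^ 2 - M ^ 2 * 1) (at 0)"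
      by (intro tendsto_intros hl x_lim)
    then show ?thesis by (simp add: q_def algebra_simps)
  qed
  ultimately obtain k' where k': "\<And>z. z \<notin> L \<Longrightarrow> q z = k'"
    using ell_even_const by blast
  have zero: "h a = 0" if "a \<notin> L" "2 * a \<in> L" for a
  proof -
    have "h (- a + 2 * a) = h (- a)"
      using h that L_uminus unfolding ell_def by blast
    then show ?thesis using odd[OF that(1)] by simp
  qed
  have "h (w1 / 2) = 0" "h (w2 / 2) = 0" using zero half_notin by simp_all
  then have "- (M ^ 2 * x (w1 / 2)) = k'" "- (M ^ 2 * x (w2 / 2)) = k'"
    using k'[OF half_notin(1)] k'[OF half_notin(2)] unfolding q_def by simp_all
  then have "M ^ 2 * x (w1 / 2) = M ^ 2 * x (w2 / 2)" by (metis add.inverse_inverse)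
  then have "x (w1 / 2) = x (w2 / 2)" using M by simp
  then have "w1 / 2 - w2 / 2 \<in> L \<or> w1 / 2 + w2 / 2 \<in> L"
    using x_eq_iff half_notin by blast
  then show False using half_notin(3,4) by (simp add: add_divide_distrib)
qed

definition pol :: "nat \<Rightarrow> (nat \<Rightarrow> nat \<Rightarrow> complex) \<Rightarrow> complex \<Rightarrow> complex" where
  "pol d c z = (\<Sum>i\<le>d. \<Sum>j\<le>d - i. c i j * x z ^ i * y z ^ j)"

lemma form_eval_pol: "form_eval d c (x z, y z, 1) = pol d c z"
  by (simp add: form_eval_def pol_def)

lemma pol_add: "pol d (\<lambda>i j. c i j + c' i j) z = pol d c z + pol d c' z"
  by (simp add: pol_def sum.distrib algebra_simps)

lemma pol_monom: "i + j \<le> d \<Longrightarrow> pol d (\<lambda>i' j'. if i' = i \<and> j' = j then m else 0) z = m * x z ^ i * y z ^ j"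
proof -
  assume "i + j \<le> d"
  then show ?thesis
    unfolding pol_def using sum_sum_single[of i j d "\<lambda>i' j'. m * x z ^ i' * y z ^ j'"]
    by (simp add: if_distrib[where f = "\<lambda>t. t * _"] cong: if_cong)
qed

lemma monom_lim:
  "((\<lambda>z. z ^ (2 * i + 3 * j) * (x z ^ i * y z ^ j)) \<longlongrightarrow> (- 1) ^ j) (at 0)"
proof -
  have "((\<lambda>z. (z ^ 2 * x z) ^ i * (z ^ 3 * y z) ^ j) \<longlongrightarrow> 1 ^ i * (- 1) ^ j) (at 0)"
    by (intro tendsto_intros x_lim y_lim)
  moreover have "(z ^ 2 * x z) ^ i * (z ^ 3 * y z) ^ j = z ^ (2 * i + 3 * j) * (x z ^ i * y z ^ j)" for z
    by (simp add: power_mult_distrib power_add power_mult[symmetric] mult_ac)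
  ultimately show ?thesis by simp
qed

lemma ell_monom: "ell (\<lambda>z. x z ^ i * y z ^ j)"
  by (intro ell_mult ell_power ell_x ell_y)

text \<open>The pole orders 2 and 3 of \<open>x\<close> and \<open>y\<close> generate every order
  except 1. Using as many factors \<open>y\<close> as possible keeps the degree within
  \<open>d\<close> for all orders up to \<open>3 * d\<close>.\<close>

lemma exists_monom_order:
  assumes "n \<le> 3 * d" "n \<noteq> 1"
  shows "\<exists>i j. n = 2 * i + 3 * j \<and> i + j \<le> (d::nat)"
proof -
  define m where "m = n div 3"
  have "n = 3 * m \<or> n = 3 * m + 1 \<or> n = 3 * m + 2" unfolding m_def by linarith
  then consider "n = 3 * m" | "n = 3 * m + 2" | "n = 3 * m + 1" "m \<ge> 1" using assms(2) by fastforce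
  then show ?thesis
  proof cases
    case 1
    then show ?thesis using assms by (intro exI[of _ 0] exI[of _ m]) auto
  next
    case 2
    then show ?thesis using assms by (intro exI[of _ 1] exI[of _ m]) auto
  next
    case 3
    then show ?thesis using assms by (intro exI[of _ 2] exI[of _ "m - 1"]) auto
  qed
qed

text \<open>Induction on the pole order: a monomial with the same order removes the leading term.
  The one order without a monomial is 1, and it cannot occur by \<open>ell_pole1\<close>.\<close>

lemma pol_exists:
  assumes "ell f" "((\<lambda>z. z ^ n * f z) \<longlongrightarrow> M) (at 0)" "n \<le> 3 * d"
  shows "\<exists>c. \<forall>z. z \<notin> L \<longrightarrow> f z = pol d c z"
  using assms
proof (induction n arbitrary: f M)
  case 0
  then have "f z = M" if "z \<notin> L" for z using ell_liouville that by simp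
  then show ?case
    using pol_monom[of 0 0 d M] by (intro exI[of _ "\<lambda>i' j'. if i' = 0 \<and> j' = 0 then M else 0"]) simp
next
  case (Suc n)
  show ?case
  proof (cases "n = 0")
    case True
    then have "M = 0" using ell_pole1 Suc.prems by simp
    then obtain M' where "((\<lambda>z. z ^ n * f z) \<longlongrightarrow> M') (at 0)"
      using ell_drop Suc.prems by blast
    then show ?thesis using Suc by simp
  next
    case False
    then obtain i j where ij: "Suc n = 2 * i + 3 * j" "i + j \<le> d"
      using exists_monom_order[of "Suc n" d] Suc.prems by auto
    \<comment> \<open>The monomial has leading coefficient \<open>(- 1) ^ j\<close>, which is its
      own inverse.\<close>
    define k where "k = M * (- 1) ^ j"
    define f' where "f' = (\<lambda>z. f z - k * (x z ^ i * y z ^ j))"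
    have e: "ell f'" unfolding f'_def by (intro ell_diff ell_mult[OF ell_const] ell_monom Suc.prems)
    have "((\<lambda>z. z ^ Suc n * f z - k * (z ^ (2 * i + 3 * j) * (x z ^ i * y z ^ j))) \<longlongrightarrow> M - k * (- 1) ^ j) (at 0)"
      by (intro tendsto_intros Suc.prems monom_lim)
    moreover have "M - k * (- 1) ^ j = 0"
      by (simp add: k_def power_add[symmetric] mult_2[symmetric])
    ultimately have "((\<lambda>z. z ^ Suc n * f' z) \<longlongrightarrow> 0) (at 0)"
      unfolding ij(1)[symmetric] f'_def by (simp add: algebra_simps)
    then obtain M' where "((\<lambda>z. z ^ n * f' z) \<longlongrightarrow> M') (at 0)"
      using ell_drop e by blast
    then obtain c where c: "\<And>z. z \<notin> L \<Longrightarrow> f' z = pol d c z"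
      using Suc.IH[of f' M'] e Suc.prems by auto
    have "f z = pol d (\<lambda>i' j'. c i' j' + (if i' = i \<and> j' = j then k else 0)) z" if "z \<notin> L" for z
      using c[OF that] pol_monom[OF ij(2), of k z] unfolding pol_add f'_def by (simp add: algebra_simps)
    then show ?thesis by blast
  qed
qed

text \<open>Among the monomials of degree at most \<open>d\<close>, only the power
  \<open>y ^ d\<close> has a pole of order \<open>3 * d\<close>. So this limit detects the value of
  the form at the point \<open>[0 : 1 : 0]\<close>.\<close>

lemma pol_lim: "((\<lambda>z. z ^ (3 * d) * pol d c z) \<longlongrightarrow> (- 1) ^ d * c 0 d) (at 0)"
proof -
  have t: "((\<lambda>z. z ^ (3 * d) * (c i j * x z ^ i * y z ^ j)) \<longlongrightarrow> (if i = 0 \<and> j = d then (- 1) ^ j * c i j else 0)) (at 0)"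
    if "i \<le> d" "j \<le> d - i" for i j
  proof -
    define r where "r = 3 * d - (2 * i + 3 * j)"
    have r: "3 * d = r + (2 * i + 3 * j)" using that by (simp add: r_def)
    have r0: "r = 0 \<longleftrightarrow> i = 0 \<and> j = d" using that by (auto simp: r_def)
    have "((\<lambda>z. z ^ r * c i j * (z ^ (2 * i + 3 * j) * (x z ^ i * y z ^ j))) \<longlongrightarrow> 0 ^ r * c i j * (- 1) ^ j) (at 0)"
      by (intro tendsto_intros monom_lim)
    then have "((\<lambda>z. z ^ (3 * d) * (c i j * x z ^ i * y z ^ j)) \<longlongrightarrow> 0 ^ r * c i j * (- 1) ^ j) (at 0)"
      unfolding r power_add by (simp only: mult_ac)
    moreover have "0 ^ r * c i j * (- 1) ^ j = (if i = 0 \<and> j = d then (- 1) ^ j * c i j else 0)"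
      using r0 by (simp add: power_0_left)
    ultimately show ?thesis by simp
  qed
  have "((\<lambda>z. \<Sum>i\<le>d. \<Sum>j\<le>d - i. z ^ (3 * d) * (c i j * x z ^ i * y z ^ j)) \<longlongrightarrow>
      (\<Sum>i\<le>d. \<Sum>j\<le>d - i. if i = 0 \<and> j = d then (- 1) ^ j * c i j else 0)) (at 0)"
    by (intro tendsto_sum t) auto
  then show ?thesis
    using sum_sum_single[of 0 d d "\<lambda>i j. (- 1) ^ j * c i j"] by (simp add: pol_def sum_distrib_left)
qed

text \<open>Conjugating the representation of \<open>f\<close> gives another one with conjugate
  coefficients; their average has real coefficients.\<close>

lemma pol_Re:
  assumes sym: "\<And>z. z \<in> L \<longleftrightarrow> cnj z \<in> L" "\<And>z. z \<notin> L \<Longrightarrow> x (cnj z) = cnj (x z)" "\<And>z. z \<notin> L \<Longrightarrow> y (cnj z) = cnj (y z)"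
    and f: "\<And>z. z \<notin> L \<Longrightarrow> f (cnj z) = cnj (f z)" and c: "\<And>z. z \<notin> L \<Longrightarrow> f z = pol d c z" and z: "z \<notin> L"
  shows "f z = pol d (\<lambda>i j. of_real (Re (c i j))) z"
proof -
  have z': "cnj z \<notin> L" using sym(1) z by blast
  have "f z = cnj (f (cnj z))" using f[OF z'] by simp
  also have "\<dots> = cnj (pol d c (cnj z))" using c[OF z'] by simp
  also have "\<dots> = pol d (\<lambda>i j. cnj (c i j)) z"
    using sym(2,3)[OF z] by (simp add: pol_def)
  finally have 1: "f z = pol d (\<lambda>i j. cnj (c i j)) z" .
  have "2 * f z = pol d (\<lambda>i j. c i j + cnj (c i j)) z"
    using 1 c[OF z] by (simp add: pol_add)
  also have "\<dots> = 2 * pol d (\<lambda>i j. of_real (Re (c i j))) z"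
    by (simp add: pol_def sum_distrib_left complex_add_cnj mult.assoc)
  finally show ?thesis by simp
qed

end

section \<open>Homothety and uniqueness of the Weierstrass functions\<close>

lemma (in lattice2) scale_L:
  assumes "c \<noteq> 0"
  shows "lattice2 (c * w1) (c * w2)" "z \<in> lattice2.L (c * w1) (c * w2) \<longleftrightarrow> z / c \<in> L"
proof -
  show l: "lattice2 (c * w1) (c * w2)" using assms indep by (simp add: lattice2_def)
  show "z \<in> lattice2.L (c * w1) (c * w2) \<longleftrightarrow> z / c \<in> L"
  proof -
    have "z = of_int m * (c * w1) + of_int n * (c * w2) \<longleftrightarrow> z / c = of_int m * w1 + of_int n * w2" for m n
      using assms by (simp add: field_simps)
    then show ?thesis by (simp add: lattice2.L_def[OF l] L_def)
  qed
qed

text \<open>Homogeneity: \<open>x\<close>, \<open>y\<close>, \<open>A\<close>, \<open>B\<close> have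
  weights 2, 3, 4, 6 under scaling of the lattice.\<close>

lemma wp_scale:
  assumes "wp w1 w2 x y A B" and c: "c \<noteq> 0"
  shows "wp (c * w1) (c * w2) (\<lambda>z. x (z / c) / c ^ 2) (\<lambda>z. y (z / c) / c ^ 3) (A / c ^ 4) (B / c ^ 6)"
proof -
  interpret wp w1 w2 x y A B by fact
  interpret S: lattice2 "c * w1" "c * w2" using scale_L c by blast
  note SL = scale_L(2)[OF c]
  have d: "((\<lambda>z. z / c) has_field_derivative 1 / c) (at z)" for z
    using c by (auto intro!: derivative_eq_intros)
  have lim: "filterlim (\<lambda>z. z / c) (at 0) (at 0)"
    using c by (auto simp: filterlim_at eventually_at_filter intro!: tendsto_eq_intros)
  show ?thesis
  proof
    fix z assume z: "z \<notin> S.L"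
    then have z': "z / c \<notin> L" using SL by simp
    show "((\<lambda>z. x (z / c) / c ^ 2) has_field_derivative 2 * (y (z / c) / c ^ 3)) (at z)"
      using DERIV_cdivide[OF DERIV_chain2[OF dx[OF z'] d], of "c ^ 2"] c by (simp add: power2_eq_square power3_eq_cube mult_ac)
    show "((\<lambda>z. y (z / c) / c ^ 3) has_field_derivative 3 * (x (z / c) / c ^ 2) ^ 2 + A / c ^ 4) (at z)"
    proof -
      have "(3 * x (z / c) ^ 2 + A) * (1 / c) / c ^ 3 = 3 * (x (z / c) / c ^ 2) ^ 2 + A / c ^ 4"
        using c by (simp add: field_simps eval_nat_numeral)
      then show ?thesis using DERIV_cdivide[OF DERIV_chain2[OF dy[OF z'] d], of "c ^ 3"] by simp
    qed
    show "(y (z / c) / c ^ 3) ^ 2 = (x (z / c) / c ^ 2) ^ 3 + A / c ^ 4 * (x (z / c) / c ^ 2) + B / c ^ 6"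
      using eqn[OF z'] c by (simp add: power_divide add_divide_distrib power_mult[symmetric] power_add[symmetric])
    show "x (- z / c) / c ^ 2 = x (z / c) / c ^ 2" "y (- z / c) / c ^ 3 = - (y (z / c) / c ^ 3)"
      using x_even[OF z'] y_odd[OF z'] by simp_all
    fix l assume "l \<in> S.L"
    then have "l / c \<in> L" using SL by simp
    then show "x ((z + l) / c) / c ^ 2 = x (z / c) / c ^ 2" "y ((z + l) / c) / c ^ 3 = y (z / c) / c ^ 3"
      using x_per[OF z'] y_per[OF z'] by (simp_all add: add_divide_distrib)
  next
    show "((\<lambda>z. z ^ 2 * (x (z / c) / c ^ 2)) \<longlongrightarrow> 1) (at 0)"
      using filterlim_compose[OF x_lim lim] by (simp add: power_divide)
    show "((\<lambda>z. z ^ 3 * (y (z / c) / c ^ 3)) \<longlongrightarrow> - 1) (at 0)"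
      using filterlim_compose[OF y_lim lim] by (simp add: power_divide)
  qed
qed

text \<open>The lattice determines the curve, because the principal part of \<open>x\<close> at the origin is fixed.\<close>

lemma wp_unique:
  assumes "wp w1 w2 x y A B" "wp u1 u2 x' y' A' B'" "lattice2.L w1 w2 = lattice2.L u1 u2"
  shows "A = A' \<and> B = B'"
proof -
  interpret wp w1 w2 x y A B by fact
  interpret T: wp u1 u2 x' y' A' B' by fact
  note L = assms(3)
  define f where "f = (\<lambda>z. x z - x' z)"
  have "ell x'" using T.ell_x by (simp add: ell_def T.ell_def L)
  then have "ell f" unfolding f_def by (intro ell_diff ell_x)
  moreover have "f (- z) = f z" if "z \<notin> L" for z using that x_even T.x_even L by (simp add: f_def)
  moreover have "((\<lambda>z. z ^ 2 * f z) \<longlongrightarrow> 0) (at 0)"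
    using tendsto_diff[OF x_lim T.x_lim] by (simp add: f_def algebra_simps)
  ultimately obtain k where "\<And>z. z \<notin> L \<Longrightarrow> f z = k" using ell_even_const by blast
  then have xx: "x' z = x z - k" if "z \<notin> L" for z using that by (simp add: f_def algebra_simps)
  have yy: "y' z = y z" if z: "z \<notin> L" for z
  proof -
    have "((\<lambda>z. x z - k) has_field_derivative 2 * y z) (at z)"
      using dx[OF z] by (auto intro!: derivative_eq_intros)
    then have "(x' has_field_derivative 2 * y z) (at z)"
      by (rule has_field_derivative_transform_within_open[OF _ L_open]) (use z xx in auto)
    then show ?thesis using DERIV_unique T.dx z L by fastforce
  qed
  have e: "3 * x z ^ 2 + A = 3 * (x z - k) ^ 2 + A'" if z: "z \<notin> L" for z
  proof -
    have "(y' has_field_derivative 3 * x z ^ 2 + A) (at z)"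
      by (rule has_field_derivative_transform_within_open[OF dy[OF z] L_open]) (use z yy in auto)
    then show ?thesis using DERIV_unique[OF _ T.dy] z L xx by fastforce
  qed
  \<comment> \<open>The identity \<open>3 * x z ^ 2 + A = 3 * (x z - k) ^ 2 + A'\<close> is linear
    in \<open>x z\<close>, so two values of \<open>x\<close> determine both of its
    coefficients.\<close>
  obtain a b where ab: "a \<notin> L" "x a = 0" "b \<notin> L" "x b = 1" using x_surj by meson
  have "k = 0"
    using e[OF ab(1)] e[OF ab(3)] ab by (simp add: power2_eq_square algebra_simps)
  then have "A = A'" using e[OF ab(1)] ab by simp
  moreover have "B = B'" using eqn[OF ab(1)] T.eqn[of a] ab L xx yy \<open>k = 0\<close> by simp
  ultimately show ?thesis by simp
qed

subsection \<open>Multiplication maps are morphisms\<close>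

lemma shift_to_0: "filterlim (\<lambda>z. z - k) (at 0) (at (k::complex))"
  by (auto simp: filterlim_at eventually_at_filter intro!: tendsto_eq_intros)

context wp
begin

lemma x_lim_at: "k \<in> L \<Longrightarrow> ((\<lambda>z. (z - k) ^ 2 * x z) \<longlongrightarrow> 1) (at k)"
  and y_lim_at: "k \<in> L \<Longrightarrow> ((\<lambda>z. (z - k) ^ 3 * y z) \<longlongrightarrow> - 1) (at k)"
proof -
  assume k: "k \<in> L"
  have per: "x (z - k) = x z" "y (z - k) = y z" if "z \<notin> L" for z
    using x_per[OF that, of "- k"] y_per[OF that, of "- k"] k L_uminus by auto
  show "((\<lambda>z. (z - k) ^ 2 * x z) \<longlongrightarrow> 1) (at k)"
    by (rule Lim_transform_eventually[OF filterlim_compose[OF x_lim shift_to_0]])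
       (use L_ev[of k] in \<open>eventually_elim, auto simp: per\<close>)
  show "((\<lambda>z. (z - k) ^ 3 * y z) \<longlongrightarrow> - 1) (at k)"
    by (rule Lim_transform_eventually[OF filterlim_compose[OF y_lim shift_to_0]])
       (use L_ev[of k] in \<open>eventually_elim, auto simp: per\<close>)
qed

lemma y_ev_nz: "k \<in> L \<Longrightarrow> \<forall>\<^sub>F z in at k. y z \<noteq> 0"
proof -
  assume "k \<in> L"
  then have "\<forall>\<^sub>F z in at k. (z - k) ^ 3 * y z \<noteq> 0"
    using y_lim_at by (intro tendsto_imp_eventually_ne[of _ "- 1"]) auto
  then show ?thesis by (rule eventually_mono) auto
qed

text \<open>Near a lattice point \<open>x / y\<close> and \<open>1 / y\<close> are the affine
  coordinates in the chart around \<open>[0 : 1 : 0]\<close>; the first one has a simple zero and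
  serves as a local parameter.\<close>

lemma inverse_y_lim: "k \<in> L \<Longrightarrow> ((\<lambda>z. 1 / y z) \<longlongrightarrow> 0) (at k)"
  and x_div_y_lim: "k \<in> L \<Longrightarrow> ((\<lambda>z. x z / y z) \<longlongrightarrow> 0) (at k)"
  and x_div_y_quot: "k \<in> L \<Longrightarrow> ((\<lambda>z. x z / y z / (z - k)) \<longlongrightarrow> - 1) (at k)"
proof -
  assume k: "k \<in> L"
  have i: "((\<lambda>z. z - k) \<longlongrightarrow> 0) (at k)" by (auto intro!: tendsto_eq_intros)
  have ev: "\<forall>\<^sub>F z in at k. z \<noteq> k" by (simp add: eventually_at_filter)
  have "((\<lambda>z. (z - k) ^ 3 / ((z - k) ^ 3 * y z)) \<longlongrightarrow> 0 ^ 3 / - 1) (at k)"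
    by (intro tendsto_intros i y_lim_at k) auto
  then have "((\<lambda>z. (z - k) ^ 3 / ((z - k) ^ 3 * y z)) \<longlongrightarrow> 0) (at k)" by simp
  then show "((\<lambda>z. 1 / y z) \<longlongrightarrow> 0) (at k)"
    by (rule Lim_transform_eventually) (use ev in \<open>eventually_elim, auto\<close>)
  have "((\<lambda>z. ((z - k) ^ 2 * x z) / ((z - k) ^ 3 * y z)) \<longlongrightarrow> 1 / - 1) (at k)"
    by (intro tendsto_intros i x_lim_at y_lim_at k) auto
  then have "((\<lambda>z. ((z - k) ^ 2 * x z) / ((z - k) ^ 3 * y z)) \<longlongrightarrow> - 1) (at k)" by simp
  then show q: "((\<lambda>z. x z / y z / (z - k)) \<longlongrightarrow> - 1) (at k)"
    by (rule Lim_transform_eventually)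
       (use ev in \<open>eventually_elim, auto simp: power2_eq_square power3_eq_cube\<close>)
  have "((\<lambda>z. x z / y z / (z - k) * (z - k)) \<longlongrightarrow> - 1 * 0) (at k)"
    by (intro tendsto_mult q i)
  then have "((\<lambda>z. x z / y z / (z - k) * (z - k)) \<longlongrightarrow> 0) (at k)" by simp
  then show "((\<lambda>z. x z / y z) \<longlongrightarrow> 0) (at k)"
    by (rule Lim_transform_eventually) (use ev in \<open>eventually_elim, auto\<close>)
qed


definition cnj_sym :: bool where
  "cnj_sym \<longleftrightarrow> (\<forall>z. z \<in> L \<longleftrightarrow> cnj z \<in> L) \<and>
     (\<forall>z. z \<notin> L \<longrightarrow> x (cnj z) = cnj (x z) \<and> y (cnj z) = cnj (y z))"

text \<open>The two fields of definition that occur. Over the reals, \<open>f\<close> has to commute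
  with conjugation so that its coefficients can be replaced by their real parts.\<close>

definition coeff_ok :: "complex set \<Rightarrow> (complex \<Rightarrow> complex) \<Rightarrow> bool" where
  "coeff_ok k f \<longleftrightarrow> k = UNIV \<or> k = \<real> \<and> cnj_sym \<and> (\<forall>z. z \<notin> L \<longrightarrow> f (cnj z) = cnj (f z))"

lemma pol_exists_over:
  assumes "ell f" "((\<lambda>z. z ^ n * f z) \<longlongrightarrow> M) (at 0)" "n \<le> 3 * d" "coeff_ok k f"
  shows "\<exists>c. (\<forall>i j. c i j \<in> k) \<and> (\<forall>z. z \<notin> L \<longrightarrow> f z = pol d c z)"
proof -
  obtain c where c: "\<And>z. z \<notin> L \<Longrightarrow> f z = pol d c z"
    using pol_exists[OF assms(1-3)] by blast
  show ?thesis
  proof (cases "k = UNIV")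
    case True
    then show ?thesis using c by auto
  next
    case False
    then have k: "k = \<real>" "cnj_sym" "\<And>z. z \<notin> L \<Longrightarrow> f (cnj z) = cnj (f z)"
      using assms(4) by (auto simp: coeff_ok_def)
    have "f z = pol d (\<lambda>i j. of_real (Re (c i j))) z" if "z \<notin> L" for z
    proof (rule pol_Re[OF _ _ _ k(3) c that])
      show "w \<in> L \<longleftrightarrow> cnj w \<in> L" for w using k(2) unfolding cnj_sym_def by blast
      show "x (cnj w) = cnj (x w)" "y (cnj w) = cnj (y w)" if "w \<notin> L" for w
        using k(2) that unfolding cnj_sym_def by blast+
    qed
    then show ?thesis
      using k(1) by (intro exI[of _ "\<lambda>i j. of_real (Re (c i j))"]) simp
  qed
qed

text \<open>Otherwise the constants \<open>x a\<close> and 0 would solve the initial value problem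
  of \<open>x\<close> and \<open>y\<close> at \<open>a\<close>, and \<open>x\<close> would be
  constant. This is smoothness of the curve at the points of order two.\<close>

lemma y_simple:
  assumes "a \<notin> L" "y a = 0"
  shows "3 * x a ^ 2 + A \<noteq> 0"
proof
  assume 0: "3 * x a ^ 2 + A = 0"
  obtain z where z: "z \<notin> L" "x z = x a + 1" using x_surj by blast
  have "x z = x a"
  proof (rule ode_unique(1)[OF L_open L_connected, of a x 2 y 3 A "\<lambda>_. x a" "\<lambda>_. 0"])
    show "((\<lambda>_. x a) has_field_derivative 2 * 0) (at w)" for w by simp
    show "((\<lambda>_. 0) has_field_derivative 3 * (x a)\<^sup>2 + A) (at w)" for w unfolding 0 by simp
  qed (use assms z dx dy in auto)
  then show False using z by simp
qed

end

text \<open>After rescaling the target, a map \<open>z \<mapsto> \<alpha> z\<close> becomes the projection for an inclusion of lattices.\<close>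

locale wp_sub = S: wp w1 w2 x y A B + K: wp u1 u2 X Y A' B'
  for w1 w2 x y A B u1 u2 X Y A' B' +
  assumes sub: "S.L \<subseteq> K.L"
begin

lemma finite_K_ball: "finite (K.L \<inter> cball 0 R)"
proof -
  have "finite (cball 0 R \<inter> K.L)"
    by (rule finite_not_islimpt_in_compact) (use K.L_ev in \<open>auto simp: islimpt_iff_eventually\<close>)
  then show ?thesis by (simp add: Int_commute)
qed

text \<open>The kernel of the projection consists of the classes of \<open>K.L\<close> modulo
  \<open>S.L\<close>; \<open>V\<close> collects the \<open>x\<close>-coordinates of its affine
  points, where denominators have to be cleared.\<close>

definition V :: "complex set" where "V = x ` (K.L - S.L)"

lemma finite_V: "finite V"
proof -
  obtain R where R: "\<And>z. \<exists>l\<in>S.L. norm (z - l) \<le> R" using S.L_reduce by blast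
  have "V \<subseteq> x ` (K.L \<inter> cball 0 R)"
  proof
    fix v assume "v \<in> V"
    then obtain k where k: "k \<in> K.L" "k \<notin> S.L" "v = x k" by (auto simp: V_def)
    obtain l where l: "l \<in> S.L" "norm (k - l) \<le> R" using R by blast
    have "x (k - l) = v" using S.x_per[OF k(2), of "- l"] l k S.L_uminus by simp
    moreover have "k - l \<in> K.L" using k l sub by blast
    ultimately show "v \<in> x ` (K.L \<inter> cball 0 R)" using l by (intro image_eqI[of _ _ "k - l"]) auto
  qed
  then show ?thesis using finite_K_ball finite_subset by blast
qed

lemma x_notin_V: "z \<notin> K.L \<Longrightarrow> x z \<notin> V"
proof
  assume z: "z \<notin> K.L" and "x z \<in> V"
  then obtain k where k: "k \<in> K.L" "k \<notin> S.L" "x z = x k" by (auto simp: V_def)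
  then have "z - k \<in> K.L \<or> z + k \<in> K.L" using S.x_eq_iff z sub by blast
  then show False using z k K.L_add_iff by blast
qed

text \<open>The values of \<open>X\<close> and \<open>Y\<close> at points of \<open>K.L\<close> are
  arbitrary, so products with them are redefined there by limits.\<close>

definition ext :: "(complex \<Rightarrow> complex) \<Rightarrow> complex \<Rightarrow> complex" where
  "ext f z = (if z \<in> K.L then Lim (at z) f else f z)"

lemma ext_lim:
  assumes "\<exists>M. (f \<longlongrightarrow> M) (at k)" "k \<in> K.L"
  shows "(f \<longlongrightarrow> ext f k) (at k)"
  using assms by (auto simp: ext_def tendsto_Lim)

lemma ext_ell:
  assumes hol: "f holomorphic_on - K.L"
    and per: "\<And>z l. z \<notin> K.L \<Longrightarrow> l \<in> S.L \<Longrightarrow> f (z + l) = f z"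
    and lim: "\<And>k. k \<in> K.L \<Longrightarrow> k \<notin> S.L \<Longrightarrow> \<exists>M. (f \<longlongrightarrow> M) (at k)"
  shows "S.ell (ext f)"
proof -
  have hol0: "\<exists>f'. (ext f has_field_derivative f') (at z)" if z: "z \<notin> S.L" for z
  proof (cases "z \<in> K.L")
    case False
    then have "f field_differentiable (at z)"
      using hol K.L_open holomorphic_on_imp_differentiable_at by blast
    then obtain f' where "(f has_field_derivative f') (at z)"
      by (auto simp: field_differentiable_def)
    then have "(ext f has_field_derivative f') (at z)"
      by (rule has_field_derivative_transform_within_open[OF _ K.L_open]) (use False in \<open>auto simp: ext_def\<close>)
    then show ?thesis by blast
  next
    case True
    obtain e where e: "e > 0" "\<And>z. z \<in> K.L \<Longrightarrow> norm z < e \<Longrightarrow> z = 0" using K.L_discrete by blast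
    have sub': "w \<notin> K.L" if "w \<in> ball z e - {z}" for w
      using e(2)[of "w - z"] True that by (auto simp: dist_norm norm_minus_commute)
    have "f holomorphic_on ball z e - {z}"
      by (rule holomorphic_on_subset[OF hol]) (use sub' in blast)
    then have "(\<lambda>w. if w = z then ext f z else f w) holomorphic_on ball z e"
      using ext_lim[OF lim[OF True z] True] by (intro removable_singularity) auto
    then have "ext f holomorphic_on ball z e"
      by (rule holomorphic_transform) (use sub' in \<open>auto simp: ext_def\<close>)
    then show ?thesis using e(1) by (simp add: holomorphic_on_open)
  qed
  have "ext f (z + l) = ext f z" if z: "z \<notin> S.L" and l: "l \<in> S.L" for z l
  proof (cases "z \<in> K.L")
    case False
    then show ?thesis using per[OF False l] l sub K.L_add_iff(1)[of l z] by (auto simp: ext_def)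
  next
    case True
    have k: "z + l \<in> K.L" "z + l \<notin> S.L" using True l z sub K.L_add S.L_add_iff by blast+
    have "(f \<longlongrightarrow> ext f (z + l)) (at (z + l))" using ext_lim[OF lim] k by blast
    then have "((\<lambda>w. f (w + l)) \<longlongrightarrow> ext f (z + l)) (at z)"
      using LIM_offset[of f "ext f (z + l)" "z + l" l] by simp
    then have "(f \<longlongrightarrow> ext f (z + l)) (at z)"
      by (rule Lim_transform_eventually) (use K.L_ev[of z] per l in \<open>auto elim: eventually_mono\<close>)
    then show ?thesis using ext_lim[OF lim[OF True z] True] LIM_unique by blast
  qed
  then show ?thesis using hol0 by (auto simp: S.ell_def holomorphic_on_open[OF S.L_open])
qed

lemma ell_isCont: "S.ell f \<Longrightarrow> z \<notin> S.L \<Longrightarrow> isCont f z"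
  unfolding S.ell_def using S.L_open
  by (meson ComplI holomorphic_on_imp_continuous_on continuous_on_eq_continuous_at)

text \<open>The function \<open>c\<close> is a common denominator of the projection. If
  \<open>c * Y\<close> has limits at \<open>K.L - S.L\<close>, then \<open>a X c\<close>,
  \<open>b Y c\<close> and \<open>c\<close> have poles only at \<open>S.L\<close> and are
  polynomials in \<open>x\<close> and \<open>y\<close>. The largest pole order at 0 is
  \<open>n + 3\<close>; when it equals \<open>3 * d\<close>, the middle form does not vanish at
  infinity.\<close>

lemma forms_exist:
  assumes c: "S.ell c" and cY: "\<And>k. k \<in> K.L \<Longrightarrow> k \<notin> S.L \<Longrightarrow> \<exists>M. ((\<lambda>z. c z * Y z) \<longlongrightarrow> M) (at k)"
    and n: "((\<lambda>z. z ^ n * c z) \<longlongrightarrow> C) (at 0)" "n + 3 \<le> 3 * d"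
    and ab: "a \<noteq> 0" "b \<noteq> 0"
    and k: "k = UNIV \<or> k = \<real> \<and> S.cnj_sym \<and> K.cnj_sym \<and> a \<in> \<real> \<and> b \<in> \<real> \<and> (\<forall>z. z \<notin> S.L \<longrightarrow> c (cnj z) = cnj (c z))"
  shows "\<exists>f g h. (\<forall>i j. f i j \<in> k \<and> g i j \<in> k \<and> h i j \<in> k) \<and>
     (\<forall>z. z \<notin> S.L \<longrightarrow> z \<in> K.L \<longrightarrow> S.pol d f z = 0 \<and> S.pol d h z = 0 \<and> ((\<lambda>w. c w * Y w) \<longlongrightarrow> S.pol d g z / b) (at z)) \<and>
     (\<forall>z. z \<notin> K.L \<longrightarrow> S.pol d f z = a * X z * c z \<and> S.pol d g z = b * Y z * c z \<and> S.pol d h z = c z) \<and>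
     f 0 d = 0 \<and> h 0 d = 0 \<and> (n + 3 = 3 * d \<longrightarrow> C \<noteq> 0 \<longrightarrow> g 0 d \<noteq> 0)"
proof -
  define F where "F = ext (\<lambda>z. c z * X z)"
  define G where "G = ext (\<lambda>z. c z * Y z)"
  have chol: "c holomorphic_on - S.L" "c holomorphic_on - K.L"
    using c sub holomorphic_on_subset[of c "- S.L" "- K.L"] by (auto simp: S.ell_def)
  have Xhol: "X holomorphic_on - K.L" "Y holomorphic_on - K.L"
    using K.ell_x K.ell_y by (auto simp: K.ell_def)
  have per: "c (z + l) = c z" "X (z + l) = X z" "Y (z + l) = Y z" if "z \<notin> K.L" "l \<in> S.L" for z l
    using that sub c K.x_per K.y_per by (auto simp: S.ell_def)
  \<comment> \<open>Both follow from the limit of \<open>c * Y\<close>, because \<open>X / Y\<close>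
    and \<open>1 / Y\<close> vanish at the points of \<open>K.L\<close>.\<close>
  have cX0: "((\<lambda>z. c z * X z) \<longlongrightarrow> 0) (at k)" and den0: "(c \<longlongrightarrow> 0) (at k)" if k: "k \<in> K.L" "k \<notin> S.L" for k
  proof -
    obtain M where M: "((\<lambda>z. c z * Y z) \<longlongrightarrow> M) (at k)" using cY k by blast
    have "((\<lambda>z. (c z * Y z) * (X z / Y z)) \<longlongrightarrow> M * 0) (at k)"
      by (intro tendsto_mult M K.x_div_y_lim k)
    then have "((\<lambda>z. (c z * Y z) * (X z / Y z)) \<longlongrightarrow> 0) (at k)" by simp
    then show "((\<lambda>z. c z * X z) \<longlongrightarrow> 0) (at k)"
      by (rule Lim_transform_eventually) (use K.y_ev_nz[OF k(1)] in \<open>eventually_elim, auto\<close>)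
    have "((\<lambda>z. (c z * Y z) * (1 / Y z)) \<longlongrightarrow> M * 0) (at k)"
      by (intro tendsto_mult M K.inverse_y_lim k)
    then have "((\<lambda>z. (c z * Y z) * (1 / Y z)) \<longlongrightarrow> 0) (at k)" by simp
    then show "(c \<longlongrightarrow> 0) (at k)"
      by (rule Lim_transform_eventually) (use K.y_ev_nz[OF k(1)] in \<open>eventually_elim, auto\<close>)
  qed
  have Fell: "S.ell F" unfolding F_def
  proof (rule ext_ell)
    show "(\<lambda>z. c z * X z) holomorphic_on - K.L" by (intro holomorphic_intros chol Xhol)
    show "\<exists>M. ((\<lambda>z. c z * X z) \<longlongrightarrow> M) (at k)" if "k \<in> K.L" "k \<notin> S.L" for k
      using cX0 that by blast
  qed (simp add: per)
  have Gell: "S.ell G" unfolding G_def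
  proof (rule ext_ell)
    show "(\<lambda>z. c z * Y z) holomorphic_on - K.L" by (intro holomorphic_intros chol Xhol)
    show "\<exists>M. ((\<lambda>z. c z * Y z) \<longlongrightarrow> M) (at k)" if "k \<in> K.L" "k \<notin> S.L" for k
      using cY that by blast
  qed (simp add: per)
  have F_K: "F z = 0" if "z \<in> K.L" "z \<notin> S.L" for z
    using cX0[OF that] that by (simp add: F_def ext_def tendsto_Lim)
  have G_K: "((\<lambda>w. c w * Y w) \<longlongrightarrow> G z) (at z)" if "z \<in> K.L" "z \<notin> S.L" for z
    unfolding G_def using ext_lim[OF cY] that by blast
  have c_K: "c z = 0" if "z \<in> K.L" "z \<notin> S.L" for z
    by (rule LIM_unique[OF ell_isCont[OF c that(2), unfolded isCont_def] den0[OF that]])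
  have FG: "F z = c z * X z" "G z = c z * Y z" if "z \<notin> K.L" for z
    using that by (auto simp: F_def G_def ext_def)
  have evK: "\<forall>\<^sub>F z in at 0. z \<notin> K.L" by (rule K.L_ev)
  define r where "r = 3 * d - (n + 3)"
  have r: "3 * d = r + n + 3" using n by (simp add: r_def)
  have "((\<lambda>z. z ^ Suc r * (z ^ n * c z) * (z ^ 2 * X z)) \<longlongrightarrow> 0 ^ Suc r * C * 1) (at 0)"
    by (intro tendsto_intros n K.x_lim)
  then have "((\<lambda>z. z ^ Suc r * (z ^ n * c z) * (z ^ 2 * X z)) \<longlongrightarrow> 0) (at 0)" by simp
  then have limF: "((\<lambda>z. z ^ (3 * d) * F z) \<longlongrightarrow> 0) (at 0)"
    by (rule Lim_transform_eventually)
       (use evK in \<open>eventually_elim, simp add: FG r power_add power2_eq_square power3_eq_cube\<close>)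
  have "((\<lambda>z. z ^ r * (z ^ n * c z) * (z ^ 3 * Y z)) \<longlongrightarrow> 0 ^ r * C * - 1) (at 0)"
    by (intro tendsto_intros n K.y_lim)
  then have limG: "((\<lambda>z. z ^ (3 * d) * G z) \<longlongrightarrow> 0 ^ r * C * - 1) (at 0)"
    by (rule Lim_transform_eventually) (use evK in \<open>eventually_elim, simp add: FG r power_add\<close>)
  have "((\<lambda>z. z ^ (r + 3) * (z ^ n * c z)) \<longlongrightarrow> 0 ^ (r + 3) * C) (at 0)"
    by (intro tendsto_intros n)
  then have limc: "((\<lambda>z. z ^ (3 * d) * c z) \<longlongrightarrow> 0) (at 0)"
    unfolding r by (simp add: power_add mult_ac)
  have sym: "S.coeff_ok k (\<lambda>z. a * F z)" "S.coeff_ok k (\<lambda>z. b * G z)" "S.coeff_ok k c"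
  proof -
    have "S.coeff_ok k (\<lambda>z. a * F z) \<and> S.coeff_ok k (\<lambda>z. b * G z) \<and> S.coeff_ok k c"
    proof (cases "k = UNIV")
      case True
      then show ?thesis by (simp add: S.coeff_ok_def)
    next
      case False
      then have k: "k = \<real>" "S.cnj_sym" "K.cnj_sym" "a \<in> \<real>" "b \<in> \<real>" "\<And>z. z \<notin> S.L \<Longrightarrow> c (cnj z) = cnj (c z)"
        using k by auto
      have K: "cnj z \<in> K.L \<longleftrightarrow> z \<in> K.L" for z using k(3) by (simp add: K.cnj_sym_def)
      have SS: "cnj z \<in> S.L \<longleftrightarrow> z \<in> S.L" for z using k(2) by (simp add: S.cnj_sym_def)
      \<comment> \<open>At \<open>K.L - S.L\<close> the values are limits, so symmetry is verified
        off \<open>K.L\<close> and extended by continuity.\<close>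
      have sym_ext: "H (cnj z) = cnj (H z)"
        if H: "S.ell H" "\<And>z. z \<notin> K.L \<Longrightarrow> H (cnj z) = cnj (H z)" and z: "z \<notin> S.L" for H z
      proof -
        have "((\<lambda>w. H (cnj w)) \<longlongrightarrow> H (cnj z)) (at z)"
          by (rule isCont_tendsto_compose[OF ell_isCont[OF H(1)] tendsto_cnj[OF tendsto_ident_at]])
             (use z SS in simp)
        moreover have "((\<lambda>w. cnj (H w)) \<longlongrightarrow> cnj (H z)) (at z)"
          using ell_isCont[OF H(1) z] by (intro tendsto_intros) (simp add: isCont_def)
        then have "((\<lambda>w. H (cnj w)) \<longlongrightarrow> cnj (H z)) (at z)"
          by (rule Lim_transform_eventually) (use K.L_ev[of z] H(2) in \<open>auto elim: eventually_mono\<close>)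
        ultimately show ?thesis by (rule LIM_unique)
      qed
      have FGs: "F (cnj z) = cnj (F z)" "G (cnj z) = cnj (G z)" if z: "z \<notin> K.L" for z
      proof -
        have "cnj z \<notin> K.L" "z \<notin> S.L" using K z sub by blast+
        then show "F (cnj z) = cnj (F z)" "G (cnj z) = cnj (G z)"
          using k(3) k(6)[of z] z by (simp_all add: FG K.cnj_sym_def)
      qed
      have "F (cnj z) = cnj (F z)" "G (cnj z) = cnj (G z)" if "z \<notin> S.L" for z
        using sym_ext[OF Fell FGs(1) that] sym_ext[OF Gell FGs(2) that] by blast+
      then show ?thesis
        using k by (auto simp: S.coeff_ok_def Reals_cnj_iff)
    qed
    then show "S.coeff_ok k (\<lambda>z. a * F z)" "S.coeff_ok k (\<lambda>z. b * G z)" "S.coeff_ok k c" by auto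
  qed
  have l1: "((\<lambda>z. z ^ (3 * d) * (a * F z)) \<longlongrightarrow> 0) (at 0)"
    using tendsto_mult[OF tendsto_const[of a] limF] by (simp add: mult_ac)
  have l2: "((\<lambda>z. z ^ (3 * d) * (b * G z)) \<longlongrightarrow> b * (0 ^ r * C * - 1)) (at 0)"
    using tendsto_mult[OF tendsto_const[of b] limG] by (simp add: mult_ac)
  obtain f where f: "\<And>i j. f i j \<in> k" "\<And>z. z \<notin> S.L \<Longrightarrow> a * F z = S.pol d f z"
    using S.pol_exists_over[OF S.ell_mult[OF S.ell_const Fell] l1 order_refl sym(1)] by auto
  obtain g where g: "\<And>i j. g i j \<in> k" "\<And>z. z \<notin> S.L \<Longrightarrow> b * G z = S.pol d g z"
    using S.pol_exists_over[OF S.ell_mult[OF S.ell_const Gell] l2 order_refl sym(2)] by auto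
  obtain h where h: "\<And>i j. h i j \<in> k" "\<And>z. z \<notin> S.L \<Longrightarrow> c z = S.pol d h z"
    using S.pol_exists_over[OF c limc order_refl sym(3)] by auto
  \<comment> \<open>Recovers the coefficient of \<open>Y ^ d\<close> of each form from the growth of
    the function that it represents.\<close>
  have lead: "(- 1) ^ d * q 0 d = M" if "((\<lambda>z. z ^ (3 * d) * p z) \<longlongrightarrow> M) (at 0)" "\<And>z. z \<notin> S.L \<Longrightarrow> p z = S.pol d q z" for p q M
  proof -
    have "((\<lambda>z. z ^ (3 * d) * S.pol d q z) \<longlongrightarrow> M) (at 0)"
      by (rule Lim_transform_eventually[OF that(1)]) (use S.L_ev[of 0] that(2) in \<open>auto elim: eventually_mono\<close>)
    then show ?thesis using LIM_unique S.pol_lim by blast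
  qed
  have "f 0 d = 0" "h 0 d = 0" using lead[OF l1 f(2)] lead[OF limc h(2)] by simp_all
  moreover have "g 0 d \<noteq> 0" if "n + 3 = 3 * d" "C \<noteq> 0"
    using lead[OF l2 g(2)] that ab by (auto simp: r_def)
  moreover have "S.pol d f z = 0 \<and> S.pol d h z = 0 \<and> ((\<lambda>w. c w * Y w) \<longlongrightarrow> S.pol d g z / b) (at z)"
    if z: "z \<notin> S.L" "z \<in> K.L" for z
    using f(2)[OF z(1)] g(2)[OF z(1)] h(2)[OF z(1)] F_K[OF z(2,1)] G_K[OF z(2,1)] c_K[OF z(2,1)] ab
    by (simp flip: f(2)[OF z(1)] g(2)[OF z(1)] h(2)[OF z(1)])
  moreover have "S.pol d f z = a * X z * c z \<and> S.pol d g z = b * Y z * c z \<and> S.pol d h z = c z"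
    if z: "z \<notin> K.L" for z
  proof -
    have z': "z \<notin> S.L" using z sub by blast
    show ?thesis using FG[OF z] by (simp flip: f(2)[OF z'] g(2)[OF z'] h(2)[OF z'])
  qed
  ultimately show ?thesis
    using f(1) g(1) h(1) by (intro exI[of _ f] exI[of _ g] exI[of _ h] conjI allI impI) simp_all
qed

text \<open>Multiplication by \<open>den0\<close> clears the denominators of the projection, but all three coordinates then
  vanish at points of order two in \<open>K.L\<close>. The function \<open>den1\<close> vanishes to order exactly three at every
  point of \<open>K.L - S.L\<close>: at a point of order two, \<open>x - v\<close> has a double zero and \<open>y\<close> a simple one.\<close>

definition den0 :: "complex \<Rightarrow> complex" where "den0 z = (\<Prod>v\<in>V. (x z - v) ^ 3)"

definition expo :: "complex \<Rightarrow> nat" where "expo v = (if v ^ 3 + A * v + B = 0 then 1 else 3)"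

definition den1 :: "complex \<Rightarrow> complex" where "den1 z = y z * (\<Prod>v\<in>V. (x z - v) ^ expo v)"

lemma prod_lim:
  "((\<lambda>z. z ^ (\<Sum>v\<in>V. 2 * e v) * (\<Prod>v\<in>V. (x z - v) ^ e v)) \<longlongrightarrow> 1) (at 0)"
proof -
  have "((\<lambda>z. \<Prod>v\<in>V. (z ^ 2 * x z - z ^ 2 * v) ^ e v) \<longlongrightarrow> (\<Prod>v\<in>V. (1 - 0 ^ 2 * v) ^ e v)) (at 0)"
    by (intro tendsto_intros S.x_lim)
  moreover have "(\<Prod>v\<in>V. (z ^ 2 * x z - z ^ 2 * v) ^ e v) = z ^ (\<Sum>v\<in>V. 2 * e v) * (\<Prod>v\<in>V. (x z - v) ^ e v)" for z
    by (simp add: power_sum prod.distrib[symmetric] power_mult power_mult_distrib[symmetric] right_diff_distrib)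
  ultimately show ?thesis by simp
qed

lemma ell_prod_V: "S.ell (\<lambda>z. \<Prod>v\<in>V. (x z - v) ^ e v)"
  by (intro S.ell_prod S.ell_power S.ell_diff S.ell_x S.ell_const)

lemma x_quot: "z0 \<notin> S.L \<Longrightarrow> ((\<lambda>z. (x z - x z0) / (z - z0)) \<longlongrightarrow> 2 * y z0) (at z0)"
  and y_quot: "z0 \<notin> S.L \<Longrightarrow> ((\<lambda>z. (y z - y z0) / (z - z0)) \<longlongrightarrow> 3 * x z0 ^ 2 + A) (at z0)"
  using S.dx S.dy by (simp_all add: has_field_derivative_iff)

lemma rest_lim:
  "k \<notin> S.L \<Longrightarrow> ((\<lambda>z. \<Prod>v\<in>V - {x k}. (x z - v) ^ e v) \<longlongrightarrow> (\<Prod>v\<in>V - {x k}. (x k - v) ^ e v)) (at k)"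
  using S.x_isCont[of k] by (intro tendsto_intros) (auto simp: isCont_def)

lemma split_V: "k \<in> K.L \<Longrightarrow> k \<notin> S.L \<Longrightarrow> (\<Prod>v\<in>V. p v) = p (x k) * (\<Prod>v\<in>V - {x k}. p v)"
  using finite_V by (intro prod.remove) (auto simp: V_def)

text \<open>The triple pole of \<open>Y\<close> meets three zeros of \<open>x - x k\<close>. They
  are simple unless \<open>y k = 0\<close>; in that case the limit is 0, and this is where
  \<open>den0\<close> fails to separate the point.\<close>

lemma cube_lim:
  assumes k: "k \<in> K.L" "k \<notin> S.L"
  shows "((\<lambda>z. (x z - x k) ^ 3 * Y z) \<longlongrightarrow> - ((2 * y k) ^ 3)) (at k)"
proof -
  have "((\<lambda>z. ((x z - x k) / (z - k)) ^ 3 * ((z - k) ^ 3 * Y z)) \<longlongrightarrow> (2 * y k) ^ 3 * - 1) (at k)"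
    by (intro tendsto_intros x_quot K.y_lim_at k)
  then have "((\<lambda>z. ((x z - x k) / (z - k)) ^ 3 * ((z - k) ^ 3 * Y z)) \<longlongrightarrow> - ((2 * y k) ^ 3)) (at k)" by simp
  then show ?thesis
    by (rule Lim_transform_eventually) (auto simp: eventually_at_filter power_divide)
qed

lemma den0_Y: 
  assumes k: "k \<in> K.L" "k \<notin> S.L"
  shows "\<exists>M. ((\<lambda>z. den0 z * Y z) \<longlongrightarrow> M) (at k)"
  using tendsto_mult[OF cube_lim[OF k] rest_lim[OF k(2), of "\<lambda>_. 3"]]
  unfolding den0_def split_V[OF k] by (auto simp: mult_ac)

lemma den1_Y:
  assumes k: "k \<in> K.L" "k \<notin> S.L"
  shows "\<exists>M. M \<noteq> 0 \<and> ((\<lambda>z. den1 z * Y z) \<longlongrightarrow> M) (at k)"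
proof -
  have rest: "(\<Prod>v\<in>V - {x k}. (x k - v) ^ expo v) \<noteq> 0" using finite_V by auto
  have main: "\<exists>M. M \<noteq> 0 \<and> ((\<lambda>z. y z * (x z - x k) ^ expo (x k) * Y z) \<longlongrightarrow> M) (at k)"
  proof (cases "y k = 0")
    case False
    then have "expo (x k) = 3" using S.eqn[OF k(2)] by (auto simp: expo_def)
    moreover have "((\<lambda>z. y z * ((x z - x k) ^ 3 * Y z)) \<longlongrightarrow> y k * - ((2 * y k) ^ 3)) (at k)"
      using S.y_isCont[OF k(2)] by (intro tendsto_intros cube_lim k) (simp add: isCont_def)
    ultimately show ?thesis using False by (intro exI[of _ "y k * - ((2 * y k) ^ 3)"]) (simp add: mult_ac)
  next
    case True
    then have root: "x k ^ 3 + A * x k + B = 0" using S.eqn[OF k(2)] by simp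
    then have e: "expo (x k) = 1" by (simp add: expo_def)
    define D where "D = 3 * x k ^ 2 + A"
    have D: "D \<noteq> 0" using S.y_simple[OF k(2) True] by (simp add: D_def)
    \<comment> \<open>Subtracting the equation of the root factors \<open>y ^ 2\<close> as
      \<open>(x - x k) * q\<close>, where \<open>q\<close> tends to \<open>D\<close>, the derivative
      of \<open>y\<close> at \<open>k\<close>. Hence \<open>y * (x - x k) = y ^ 3 / q\<close> has a
      zero of exact order three, matching the pole of \<open>Y\<close>.\<close>
    define q where "q = (\<lambda>z. x z ^ 2 + x z * x k + x k ^ 2 + A)"
    have "(q \<longlongrightarrow> x k ^ 2 + x k * x k + x k ^ 2 + A) (at k)"
      unfolding q_def using S.x_isCont[OF k(2)] by (intro tendsto_intros) (simp_all add: isCont_def)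
    then have ql: "(q \<longlongrightarrow> D) (at k)" by (simp add: D_def power2_eq_square algebra_simps)
    have yq: "((\<lambda>z. y z / (z - k)) \<longlongrightarrow> D) (at k)" using y_quot[OF k(2)] True by (simp add: D_def)
    have "((\<lambda>z. (y z / (z - k)) ^ 3 / q z * ((z - k) ^ 3 * Y z)) \<longlongrightarrow> D ^ 3 / D * - 1) (at k)"
      by (intro tendsto_intros yq ql K.y_lim_at k D)
    moreover have "\<forall>\<^sub>F z in at k. (y z / (z - k)) ^ 3 / q z * ((z - k) ^ 3 * Y z) = y z * (x z - x k) * Y z"
      using S.L_ev[of k] tendsto_imp_eventually_ne[OF ql D] eventually_neq_at_within[of k k UNIV]
    proof eventually_elim
      case (elim z)
      have "y z ^ 2 = y z ^ 2 - (x k ^ 3 + A * x k + B)" using root by simp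
      also have "\<dots> = (x z - x k) * q z"
        unfolding S.eqn[OF elim(1)] q_def by (simp add: power2_eq_square power3_eq_cube algebra_simps)
      finally have "y z ^ 3 = y z * (x z - x k) * q z" by (simp add: power3_eq_cube power2_eq_square)
      then show ?case using elim by (simp add: power_divide)
    qed
    ultimately have "((\<lambda>z. y z * (x z - x k) * Y z) \<longlongrightarrow> D ^ 3 / D * - 1) (at k)"
      by (rule Lim_transform_eventually)
    then show ?thesis using D e by (intro exI[of _ "D ^ 3 / D * - 1"]) simp
  qed
  then obtain M where M: "M \<noteq> 0" "((\<lambda>z. y z * (x z - x k) ^ expo (x k) * Y z) \<longlongrightarrow> M) (at k)" by blast
  show ?thesis
    using tendsto_mult[OF M(2) rest_lim[OF k(2), of expo]] M(1) rest
    unfolding den1_def split_V[OF k]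
    by (intro exI[of _ "M * (\<Prod>v\<in>V - {x k}. (x k - v) ^ expo v)"]) (simp add: mult_ac)
qed

text \<open>Two triples of forms cover the curve: the one built from \<open>den0\<close> is nonzero
  at infinity and outside the kernel, the one built from \<open>den1\<close> at the affine points of
  the kernel.\<close>

lemma sub_morphism:
  assumes phi: "\<phi> \<in> points S.EC \<rightarrow>\<^sub>E points E'"
    and phi': "\<And>z. \<phi> (S.Phi z) = (if z \<in> K.L then Infinity else Affine (a * X z) (b * Y z))"
    and ab: "a \<noteq> 0" "b \<noteq> 0"
    and k: "k = UNIV \<or> k = \<real> \<and> S.cnj_sym \<and> K.cnj_sym \<and> a \<in> \<real> \<and> b \<in> \<real>"
  shows "morphism_over k S.EC E' \<phi>"
proof -
  \<comment> \<open>Conjugation permutes the finite set \<open>V\<close>, so the product can be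
    reindexed along it.\<close>
  have symV: "(\<Prod>v\<in>V. (x (cnj z) - v) ^ e v) = cnj (\<Prod>v\<in>V. (x z - v) ^ e v)"
    if s: "S.cnj_sym" "K.cnj_sym" and z: "z \<notin> S.L" and e: "\<And>v. v \<in> V \<Longrightarrow> e (cnj v) = e v" for z and e :: "complex \<Rightarrow> nat"
  proof -
    have "cnj v \<in> V" if v: "v \<in> V" for v
    proof -
      obtain k where "k \<in> K.L" "k \<notin> S.L" "v = x k" using v by (auto simp: V_def)
      then have "cnj k \<in> K.L - S.L" "cnj v = x (cnj k)"
        using s by (auto simp: S.cnj_sym_def K.cnj_sym_def)
      then show ?thesis by (auto simp: V_def)
    qed
    then have "cnj ` V \<subseteq> V" by blast
    then have "cnj ` V = V" by (intro endo_inj_surj[OF finite_V]) (auto simp: inj_on_def)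
    then have "(\<Prod>v\<in>V. (x (cnj z) - v) ^ e v) = (\<Prod>v\<in>cnj ` V. (x (cnj z) - v) ^ e v)" by simp
    also have "\<dots> = (\<Prod>v\<in>V. (x (cnj z) - cnj v) ^ e (cnj v))"
      by (subst prod.reindex) (auto simp: inj_on_def)
    also have "\<dots> = cnj (\<Prod>v\<in>V. (x z - v) ^ e v)"
      using s z e by (simp add: S.cnj_sym_def)
    finally show ?thesis .
  qed
  have kc: "k = UNIV \<or> k = \<real> \<and> S.cnj_sym \<and> K.cnj_sym \<and> a \<in> \<real> \<and> b \<in> \<real> \<and> (\<forall>z. z \<notin> S.L \<longrightarrow> den0 (cnj z) = cnj (den0 z))"
    using k symV[of _ "\<lambda>_. 3"] by (auto simp: den0_def)
  have kc1: "k = UNIV \<or> k = \<real> \<and> S.cnj_sym \<and> K.cnj_sym \<and> a \<in> \<real> \<and> b \<in> \<real> \<and> (\<forall>z. z \<notin> S.L \<longrightarrow> den1 (cnj z) = cnj (den1 z))"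
  proof (cases "k = UNIV")
    case False
    then have s: "S.cnj_sym" "K.cnj_sym" using k by auto
    have "expo (cnj v) = expo v" if v: "v \<in> V" for v
    proof -
      obtain w where w: "w \<in> K.L" "w \<notin> S.L" "v = x w" using v by (auto simp: V_def)
      have w': "cnj w \<notin> S.L" "x (cnj w) = cnj v" "y (cnj w) = cnj (y w)"
        using s(1) w by (auto simp: S.cnj_sym_def)
      have "v ^ 3 + A * v + B = 0 \<longleftrightarrow> y w = 0" unfolding w(3) S.eqn[OF w(2), symmetric] by simp
      moreover have "cnj v ^ 3 + A * cnj v + B = 0 \<longleftrightarrow> y w = 0" 
        unfolding w'(2)[symmetric] S.eqn[OF w'(1), symmetric] w'(3) by simp
      ultimately show ?thesis by (simp add: expo_def)
    qed
    then show ?thesis using k s symV[of _ expo] by (auto simp: den1_def S.cnj_sym_def)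
  qed simp
  have hc: "has_hom_coords (Affine p q) (m * p, m * q, m)" if "m \<noteq> 0" for p q m
    unfolding has_hom_coords_def using that by (auto intro!: exI[of _ "inverse m"])
  have hi: "has_hom_coords Infinity (0, m, 0)" if "m \<noteq> 0" for m
    unfolding has_hom_coords_def using that by (auto intro!: exI[of _ "inverse m"])
  have compat: "has_hom_coords (\<phi> Q) F"
    if f: "\<forall>z. z \<notin> S.L \<longrightarrow> z \<in> K.L \<longrightarrow> S.pol d f z = 0 \<and> S.pol d h z = 0"
      "\<forall>z. z \<notin> K.L \<longrightarrow> S.pol d f z = a * X z * c z \<and> S.pol d g z = b * Y z * c z \<and> S.pol d h z = c z"
      "f 0 d = 0" "h 0 d = 0" and Q: "Q \<in> points S.EC"
     and F: "F = (form_eval d f (hom_coords Q), form_eval d g (hom_coords Q), form_eval d h (hom_coords Q))" "F \<noteq> (0, 0, 0)"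
    for d f g h c Q F
  proof -
    obtain z where z: "S.Phi z = Q" using S.Phi_surj[OF Q] by blast
    consider "z \<in> S.L" | "z \<notin> S.L" "z \<in> K.L" | "z \<notin> K.L" using sub by blast
    then show ?thesis
    proof cases
      case 1
      then have "\<phi> Q = Infinity" using phi'[of z] z sub by auto
      moreover have "F = (0, g 0 d, 0)"
        using F(1) 1 f(3,4) unfolding z[symmetric] by (simp add: S.Phi_def form_eval_infinity)
      ultimately show ?thesis using hi F(2) by auto
    next
      case 2
      then have "\<phi> Q = Infinity" using phi'[of z] z sub by auto
      moreover have "F = (0, S.pol d g z, 0)"
        using F(1) 2 f(1) unfolding z[symmetric] by (simp add: S.Phi_def S.form_eval_pol)
      ultimately show ?thesis using hi F(2) by auto
    next
      case 3
      then have "z \<notin> S.L" using sub by blast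
      have "\<phi> Q = Affine (a * X z) (b * Y z)" using phi'[of z] z 3 by auto
      moreover have "F = (c z * (a * X z), c z * (b * Y z), c z)"
        using F(1) 3 \<open>z \<notin> S.L\<close> f(2) unfolding z[symmetric] by (simp add: S.Phi_def S.form_eval_pol)
      ultimately show ?thesis using hc[of "c z"] F(2) by auto
    qed
  qed
  have c0ell: "S.ell den0" unfolding den0_def by (rule ell_prod_V)
  have c1ell: "S.ell den1" unfolding den1_def by (intro S.ell_mult S.ell_y ell_prod_V)
  have l0: "((\<lambda>z. z ^ (6 * card V) * den0 z) \<longlongrightarrow> 1) (at 0)"
    using prod_lim[of "\<lambda>_. 3"] by (simp add: den0_def mult.commute)
  have l1: "((\<lambda>z. z ^ (3 + (\<Sum>v\<in>V. 2 * expo v)) * den1 z) \<longlongrightarrow> - 1 * 1) (at 0)"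
    using tendsto_mult[OF S.y_lim prod_lim[of expo]] by (simp add: den1_def power_add mult_ac)
  have d1: "3 + (\<Sum>v\<in>V. 2 * expo v) + 3 \<le> 3 * (2 * card V + 2)"
  proof -
    have "(\<Sum>v\<in>V. 2 * expo v) \<le> (\<Sum>v\<in>V. 6)" by (rule sum_mono) (simp add: expo_def)
    then show ?thesis by simp
  qed
  have "\<exists>d f g h. (\<forall>i j. f i j \<in> k \<and> g i j \<in> k \<and> h i j \<in> k) \<and>
        (let F = (\<lambda>Q. (form_eval d f (hom_coords Q), form_eval d g (hom_coords Q),
                       form_eval d h (hom_coords Q)))
         in F P \<noteq> (0, 0, 0) \<and>
            (\<forall>Q\<in>points S.EC. F Q \<noteq> (0, 0, 0) \<longrightarrow> has_hom_coords (\<phi> Q) (F Q)))" if P: "P \<in> points S.EC" for P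
  proof -
    obtain z0 where z0: "S.Phi z0 = P" using S.Phi_surj[OF P] by blast
    show ?thesis
    proof (cases "z0 \<in> K.L \<and> z0 \<notin> S.L")
      case False
      \<comment> \<open>The pole of \<open>den0\<close> at 0 has order \<open>6 * card V\<close> and
        \<open>Y\<close> contributes 3: exactly \<open>3 * ?d\<close>, so the forms do not all
        vanish at infinity.\<close>
      let ?d = "2 * card V + 1"
      obtain f g h where fgh: "\<forall>i j. f i j \<in> k \<and> g i j \<in> k \<and> h i j \<in> k"
        "\<forall>z. z \<notin> S.L \<longrightarrow> z \<in> K.L \<longrightarrow> S.pol ?d f z = 0 \<and> S.pol ?d h z = 0"
        "\<forall>z. z \<notin> K.L \<longrightarrow> S.pol ?d f z = a * X z * den0 z \<and> S.pol ?d g z = b * Y z * den0 z \<and> S.pol ?d h z = den0 z"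
        "f 0 ?d = 0" "h 0 ?d = 0" "g 0 ?d \<noteq> 0"
        using forms_exist[OF c0ell den0_Y l0 _ ab kc, of ?d] by auto
      have "(form_eval ?d f (hom_coords P), form_eval ?d g (hom_coords P), form_eval ?d h (hom_coords P)) \<noteq> (0, 0, 0)"
      proof (cases "z0 \<in> S.L")
        case True
        then show ?thesis using fgh(6) by (simp add: z0[symmetric] S.Phi_def form_eval_infinity)
      next
        case F: False
        then have n: "z0 \<notin> K.L" using False by blast
        then have "den0 z0 \<noteq> 0" using x_notin_V[OF n] finite_V by (auto simp: den0_def)
        then show ?thesis using fgh(3) n F by (simp add: z0[symmetric] S.Phi_def S.form_eval_pol)
      qed
      then show ?thesis
        using fgh(1) compat[OF fgh(2-5) _ refl] unfolding Let_def
        by (intro exI[of _ ?d] exI[of _ f] exI[of _ g] exI[of _ h] conjI ballI impI) simp_all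
    next
      case True
      \<comment> \<open>The factor \<open>y\<close> of \<open>den1\<close> adds 3 to the pole order,
        and exponents below 3 only lower it. Equality with \<open>3 * ?d\<close> may fail, but here
        the point is affine.\<close>
      let ?d = "2 * card V + 2"
      obtain f g h where fgh: "\<forall>i j. f i j \<in> k \<and> g i j \<in> k \<and> h i j \<in> k"
        "\<forall>z. z \<notin> S.L \<longrightarrow> z \<in> K.L \<longrightarrow> S.pol ?d f z = 0 \<and> S.pol ?d h z = 0"
        "\<forall>z. z \<notin> K.L \<longrightarrow> S.pol ?d f z = a * X z * den1 z \<and> S.pol ?d g z = b * Y z * den1 z \<and> S.pol ?d h z = den1 z"
        "f 0 ?d = 0" "h 0 ?d = 0"
        "\<forall>z. z \<notin> S.L \<longrightarrow> z \<in> K.L \<longrightarrow> ((\<lambda>w. den1 w * Y w) \<longlongrightarrow> S.pol ?d g z / b) (at z)"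
        using forms_exist[OF c1ell _ l1 d1 ab kc1] den1_Y by blast
      obtain M where M: "M \<noteq> 0" "((\<lambda>w. den1 w * Y w) \<longlongrightarrow> M) (at z0)" using den1_Y[of z0] True by blast
      have "((\<lambda>w. den1 w * Y w) \<longlongrightarrow> S.pol ?d g z0 / b) (at z0)" using fgh(6) True by blast
      then have "S.pol ?d g z0 / b = M" using M(2) by (rule LIM_unique)
      then have "S.pol ?d g z0 \<noteq> 0" using M(1) by auto
      then have "(form_eval ?d f (hom_coords P), form_eval ?d g (hom_coords P), form_eval ?d h (hom_coords P)) \<noteq> (0, 0, 0)"
        using True by (simp add: z0[symmetric] S.Phi_def S.form_eval_pol)
      then show ?thesis
        using fgh(1) compat[OF fgh(2-5) _ refl] unfolding Let_def
        by (intro exI[of _ ?d] exI[of _ f] exI[of _ g] exI[of _ h] conjI ballI impI) simp_all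
    qed
  qed
  then show ?thesis unfolding morphism_over_def using phi by blast
qed

end

subsection \<open>Morphisms lift to linear maps\<close>

lemma local_inverse:
  assumes h: "h holomorphic_on S" "open S" "w0 \<in> S" and d: "deriv h w0 \<noteq> 0"
  shows "\<exists>O' G. open O' \<and> h w0 \<in> O' \<and> G holomorphic_on O' \<and> G (h w0) = w0 \<and>
     (\<forall>v\<in>O'. G v \<in> S \<and> h (G v) = v)"
proof -
  obtain r where r: "r > 0" "ball w0 r \<subseteq> S" "open (h ` ball w0 r)" "inj_on h (ball w0 r)"
    using has_complex_derivative_locally_invertible[OF h(1,3,2) d] by blast
  have "h holomorphic_on ball w0 r" using h(1) r(2) holomorphic_on_subset by blast
  then obtain G where G: "G holomorphic_on h ` ball w0 r"
    "\<And>z. z \<in> ball w0 r \<Longrightarrow> G (h z) = z"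
    using holomorphic_has_inverse[OF _ _ r(4)] by (metis open_ball)
  then show ?thesis
    using r by (intro exI[of _ "h ` ball w0 r"] exI[of _ G]) auto
qed

text \<open>Follows \<open>f\<close> by the local inverse of \<open>h\<close> at \<open>w0\<close>.
  With \<open>h\<close> a local coordinate on the target curve, this lifts one coordinate of a
  morphism.\<close>

lemma local_section:
  assumes h: "h holomorphic_on S" "open S" "w0 \<in> S" "deriv h w0 \<noteq> 0"
    and f: "f holomorphic_on T" "open T" "z0 \<in> T" "f z0 = h w0"
  obtains O' g where "open O'" "z0 \<in> O'" "O' \<subseteq> T" "g holomorphic_on O'" "isCont g z0" "g z0 = w0"
    "\<And>z. z \<in> O' \<Longrightarrow> g z \<in> S \<and> h (g z) = f z"
proof -
  obtain O2 G where O2: "open O2" "h w0 \<in> O2" "G holomorphic_on O2" "G (h w0) = w0"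
    "\<And>v. v \<in> O2 \<Longrightarrow> G v \<in> S \<and> h (G v) = v"
    using local_inverse[OF h] by auto
  define O' where "O' = T \<inter> f -` O2"
  have O': "open O'" "z0 \<in> O'"
    unfolding O'_def using O2 f holomorphic_on_imp_continuous_on[OF f(1)]
    by (auto intro!: continuous_open_preimage)
  have g: "(\<lambda>z. G (f z)) holomorphic_on O'"
    by (rule holomorphic_on_compose_gen[of f _ G O2, unfolded o_def])
      (use f(1) O2(3) holomorphic_on_subset in \<open>auto simp: O'_def\<close>)
  then have "isCont (\<lambda>z. G (f z)) z0"
    using O' by (meson continuous_on_eq_continuous_at holomorphic_on_imp_continuous_on)
  then show ?thesis
    using that[OF O' _ g] O2 f(4) by (auto simp: O'_def)
qed

lemma nonzero_nhds:
  fixes f :: "complex \<Rightarrow> complex"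
  assumes "isCont f z" "f z \<noteq> 0"
  shows "\<forall>\<^sub>F w in nhds z. f w \<noteq> 0"
  using assms tendsto_imp_eventually_ne[of f "f z" "nhds z" 0] tendsto_at_iff_tendsto_nhds[of f z]
  by (simp add: isCont_def)

text \<open>Near a lattice point the homogeneous coordinates \<open>(x, y, 1)\<close> are multiplied
  by \<open>(z - z0) ^ 3\<close>; this clears the poles and gives \<open>(0, - 1, 0)\<close> at
  \<open>z0\<close>.\<close>

lemma (in wp) hom_lift:
  "\<exists>O' X1 Y1 Z1. open O' \<and> z0 \<in> O' \<and> X1 holomorphic_on O' \<and> Y1 holomorphic_on O' \<and> Z1 holomorphic_on O' \<and>
     (\<forall>z\<in>O'. \<exists>k P Q R. k \<noteq> 0 \<and> hom_coords (Phi z) = (P, Q, R) \<and> X1 z = k * P \<and> Y1 z = k * Q \<and> Z1 z = k * R)"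
proof (cases "z0 \<in> L")
  case False
  have "x holomorphic_on - L" "y holomorphic_on - L" using ell_x ell_y by (auto simp: ell_def)
  then show ?thesis
    using False L_open
    by (intro exI[of _ "- L"] exI[of _ x] exI[of _ y] exI[of _ "\<lambda>_. 1"]) (auto simp: Phi_def intro!: exI[of _ 1])
next
  case True
  obtain e where e: "e > 0" "\<And>z. z \<in> L \<Longrightarrow> norm z < e \<Longrightarrow> z = 0" using L_discrete by blast
  have n: "w \<notin> L" if "w \<in> ball z0 e - {z0}" for w
    using e(2)[of "w - z0"] True that by (auto simp: dist_norm norm_minus_commute)
  have hol: "x holomorphic_on ball z0 e - {z0}" "y holomorphic_on ball z0 e - {z0}"
    using ell_x ell_y n holomorphic_on_subset[of _ "- L" "ball z0 e - {z0}"] by (auto simp: ell_def)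
  have i: "((\<lambda>z. z - z0) \<longlongrightarrow> 0) (at z0)" by (auto intro!: tendsto_eq_intros)
  have "((\<lambda>z. (z - z0) * ((z - z0) ^ 2 * x z)) \<longlongrightarrow> 0 * 1) (at z0)"
    by (intro tendsto_mult i x_lim_at True)
  then have "((\<lambda>z. (z - z0) ^ 3 * x z) \<longlongrightarrow> 0) (at z0)"
    by (simp add: power3_eq_cube power2_eq_square mult_ac)
  then have h1: "(\<lambda>z. if z = z0 then 0 else (z - z0) ^ 3 * x z) holomorphic_on ball z0 e"
    by (intro removable_singularity holomorphic_intros hol) auto
  have h2: "(\<lambda>z. if z = z0 then - 1 else (z - z0) ^ 3 * y z) holomorphic_on ball z0 e"
    using y_lim_at[OF True] by (intro removable_singularity holomorphic_intros hol) auto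
  have h3: "(\<lambda>z. (z - z0) ^ 3) holomorphic_on ball z0 e" by (intro holomorphic_intros)
  show ?thesis
  proof (rule exI[of _ "ball z0 e"], rule exI, rule exI, rule exI, intro conjI ballI)
    fix z assume z: "z \<in> ball z0 e"
    show "\<exists>k P Q R. k \<noteq> 0 \<and> hom_coords (Phi z) = (P, Q, R) \<and>
        (if z = z0 then 0 else (z - z0) ^ 3 * x z) = k * P \<and>
        (if z = z0 then - 1 else (z - z0) ^ 3 * y z) = k * Q \<and> (z - z0) ^ 3 = k * R"
    proof (cases "z = z0")
      case True
      then show ?thesis using \<open>z0 \<in> L\<close> 
        by - (rule exI[of _ "- 1"], rule exI[of _ 0], rule exI[of _ 1], rule exI[of _ 0], simp add: Phi_def)
    next
      case False
      then have "z \<notin> L" using n z by blast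
      then show ?thesis using False 
        by - (rule exI[of _ "(z - z0) ^ 3"], rule exI[of _ "x z"], rule exI[of _ "y z"], rule exI[of _ 1], simp add: Phi_def)
    qed
  qed (use e(1) h1 h2 h3 in auto)
qed

lemma has_hom_coords_scale:
  "k \<noteq> 0 \<Longrightarrow> has_hom_coords P (X, Y, Z) \<Longrightarrow> has_hom_coords P (k * X, k * Y, k * Z)"
  unfolding has_hom_coords_def by (clarsimp, rule_tac x = "c / k" in exI) auto

lemma has_hom_coords_Infinity: "has_hom_coords Infinity (X, Y, Z) \<longleftrightarrow> X = 0 \<and> Y \<noteq> 0 \<and> Z = 0"
  unfolding has_hom_coords_def by (auto intro!: exI[of _ "inverse Y"])

lemma has_hom_coords_Affine: "has_hom_coords (Affine p q) (X, Y, Z) \<longleftrightarrow> Z \<noteq> 0 \<and> p = X / Z \<and> q = Y / Z"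
proof
  assume "has_hom_coords (Affine p q) (X, Y, Z)"
  then obtain c where c: "p = c * X" "q = c * Y" "1 = c * Z"
    unfolding has_hom_coords_def by auto
  then have "Z \<noteq> 0" "c = 1 / Z" by (auto simp: eq_divide_eq)
  then show "Z \<noteq> 0 \<and> p = X / Z \<and> q = Y / Z" using c by simp
next
  assume "Z \<noteq> 0 \<and> p = X / Z \<and> q = Y / Z"
  then show "has_hom_coords (Affine p q) (X, Y, Z)"
    unfolding has_hom_coords_def by (auto intro!: exI[of _ "1 / Z"])
qed

locale wp_pair = S: wp w1 w2 x y A B + T: wp u1 u2 X Y A' B'
  for w1 w2 x y A B u1 u2 X Y A' B' +
  fixes \<phi>
  assumes mor: "morphism_over UNIV S.EC T.EC \<phi>" and inf: "\<phi> Infinity = Infinity"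
begin

definition psi :: "complex \<Rightarrow> complex point" where "psi z = \<phi> (S.Phi z)"

lemma psi_points: "psi z \<in> points T.EC"
  using mor S.Phi_points unfolding morphism_over_def psi_def by blast

lemma psi_per: "l \<in> S.L \<Longrightarrow> psi (z + l) = psi z"
  by (simp add: psi_def S.Phi_per)

text \<open>The forms of a morphism are valid wherever they do not all vanish. One that is nonzero
  at \<open>z0\<close> stays so in a neighbourhood, and holomorphic coordinates of the source make
  all three holomorphic.\<close>

lemma loc_rep:
  "\<exists>O' a b c. open O' \<and> z0 \<in> O' \<and> a holomorphic_on O' \<and> b holomorphic_on O' \<and> c holomorphic_on O' \<and>
     (\<forall>z\<in>O'. has_hom_coords (psi z) (a z, b z, c z))"
proof -
  obtain O1 X1 Y1 Z1 where O1: "open O1" "z0 \<in> O1" "X1 holomorphic_on O1" "Y1 holomorphic_on O1" "Z1 holomorphic_on O1"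
    and k: "\<And>z. z \<in> O1 \<Longrightarrow> \<exists>k P Q R. k \<noteq> 0 \<and> hom_coords (S.Phi z) = (P, Q, R) \<and> X1 z = k * P \<and> Y1 z = k * Q \<and> Z1 z = k * R"
    using S.hom_lift[of z0] by blast
  have "\<exists>d f g h.
        (let F = (\<lambda>Q. (form_eval d f (hom_coords Q), form_eval d g (hom_coords Q),
                       form_eval d h (hom_coords Q)))
         in F (S.Phi z0) \<noteq> (0, 0, 0) \<and>
            (\<forall>Q\<in>points S.EC. F Q \<noteq> (0, 0, 0) \<longrightarrow> has_hom_coords (\<phi> Q) (F Q)))"
    using mor S.Phi_points[of z0] unfolding morphism_over_def by blast
  then obtain d f g h where nz: "(form_eval d f (hom_coords (S.Phi z0)), form_eval d g (hom_coords (S.Phi z0)),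
                       form_eval d h (hom_coords (S.Phi z0))) \<noteq> (0, 0, 0)"
    and hc: "\<And>z. (form_eval d f (hom_coords (S.Phi z)), form_eval d g (hom_coords (S.Phi z)),
                       form_eval d h (hom_coords (S.Phi z))) \<noteq> (0, 0, 0) \<Longrightarrow> has_hom_coords (psi z)
         (form_eval d f (hom_coords (S.Phi z)), form_eval d g (hom_coords (S.Phi z)),
                       form_eval d h (hom_coords (S.Phi z)))"
    unfolding Let_def psi_def using S.Phi_points by blast
  define ev where "ev = (\<lambda>f z. form_eval d f (X1 z, Y1 z, Z1 z))"
  have hol: "ev f holomorphic_on O1" for f
    unfolding ev_def form_eval_def case_prod_conv by (intro holomorphic_intros O1)
  have sc: "\<exists>m. m \<noteq> 0 \<and> (\<forall>f. ev f z = m * form_eval d f (hom_coords (S.Phi z)))" if z: "z \<in> O1" for z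
  proof -
    obtain k P Q R where "k \<noteq> 0" "hom_coords (S.Phi z) = (P, Q, R)" "X1 z = k * P" "Y1 z = k * Q" "Z1 z = k * R"
      using k[OF z] by blast
    then show ?thesis by (intro exI[of _ "k ^ d"]) (simp add: ev_def form_eval_scale)
  qed
  have good: "has_hom_coords (psi z) (ev f z, ev g z, ev h z)" if z: "z \<in> O1" "(ev f z, ev g z, ev h z) \<noteq> (0, 0, 0)" for z
  proof -
    obtain m where m: "m \<noteq> 0" "\<And>f. ev f z = m * form_eval d f (hom_coords (S.Phi z))" using sc[OF z(1)] by blast
    show ?thesis unfolding m(2) by (rule has_hom_coords_scale[OF m(1) hc]) (use z(2) m in auto)
  qed
  have "(ev f z0, ev g z0, ev h z0) \<noteq> (0, 0, 0)" using sc[OF O1(2)] nz by auto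
  then obtain q where q: "q \<in> {f, g, h}" "ev q z0 \<noteq> 0" by auto
  have "isCont (ev q) z0"
    using hol O1(1,2) by (meson continuous_on_eq_continuous_at holomorphic_on_imp_continuous_on)
  then have "\<forall>\<^sub>F w in nhds z0. ev q w \<noteq> 0" using q(2) by (rule nonzero_nhds)
  then obtain O2 where O2: "open O2" "z0 \<in> O2" "\<And>w. w \<in> O2 \<Longrightarrow> ev q w \<noteq> 0"
    unfolding eventually_nhds by blast
  have "has_hom_coords (psi z) (ev f z, ev g z, ev h z)" if "z \<in> O1 \<inter> O2" for z
    using good[of z] O2(3)[of z] that q(1) by auto
  then show ?thesis
    using O1 O2 hol holomorphic_on_subset[OF hol, of "O1 \<inter> O2"]
    by (intro exI[of _ "O1 \<inter> O2"] exI[of _ "ev f"] exI[of _ "ev g"] exI[of _ "ev h"]) auto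
qed

lemma psi_curve:
  assumes "psi z = Affine p q"
  shows "q ^ 2 = p ^ 3 + A' * p + B'"
  using psi_points[of z] unfolding assms by (simp add: points_def)

lemma ball_of_nhds:
  assumes "open O'" "z0 \<in> O'" "Lf holomorphic_on O'" "Lf z0 = w0" "\<forall>\<^sub>F z in nhds z0. T.Phi (Lf z) = psi z"
  shows "\<exists>Lf e. e > 0 \<and> Lf holomorphic_on ball z0 e \<and> Lf z0 = w0 \<and> (\<forall>z\<in>ball z0 e. T.Phi (Lf z) = psi z)"
proof -
  obtain O2 where O2: "open O2" "z0 \<in> O2" "\<And>w. w \<in> O2 \<Longrightarrow> T.Phi (Lf w) = psi w"
    using assms(5) unfolding eventually_nhds by blast
  then obtain e where "e > 0" "ball z0 e \<subseteq> O' \<inter> O2"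
    using assms(1,2) by (meson IntI open_Int open_contains_ball)
  then show ?thesis
    using assms O2 holomorphic_on_subset[of Lf O' "ball z0 e"] by (intro exI[of _ Lf] exI[of _ e]) auto
qed

text \<open>Where \<open>Y w0 \<noteq> 0\<close> the function \<open>X\<close> is a local
  coordinate; otherwise \<open>Y\<close> is, by \<open>y_simple\<close>. Lifting that coordinate,
  the curve equation leaves only one choice for the other near \<open>z0\<close>, because the
  cofactor in \<open>eq\<close> is nonzero there.\<close>

lemma lift_affine:
  assumes O1: "open O1" "z0 \<in> O1" "f holomorphic_on O1" "g holomorphic_on O1"
    and psi: "\<And>z. z \<in> O1 \<Longrightarrow> psi z = Affine (f z) (g z)"
    and w0: "T.Phi w0 = psi z0"
  shows "\<exists>Lf e. e > 0 \<and> Lf holomorphic_on ball z0 e \<and> Lf z0 = w0 \<and> (\<forall>z\<in>ball z0 e. T.Phi (Lf z) = psi z)"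
proof -
  have w: "w0 \<notin> T.L" "X w0 = f z0" "Y w0 = g z0"
    using w0 psi[OF O1(2)] by (auto simp: T.Phi_def split: if_splits)
  have fc: "isCont f z" "isCont g z" if "z \<in> O1" for z
    using O1 that by (meson continuous_on_eq_continuous_at holomorphic_on_imp_continuous_on)+
  have Thol: "X holomorphic_on - T.L" "Y holomorphic_on - T.L"
    using T.ell_x T.ell_y by (auto simp: T.ell_def)
  have eq: "Y (v) ^ 2 - g z ^ 2 = (X v - f z) * (X v ^ 2 + X v * f z + f z ^ 2 + A')" if "v \<notin> T.L" "z \<in> O1" for v z
    using T.eqn[OF that(1)] psi_curve[OF psi[OF that(2)]]
    by (simp add: power2_eq_square power3_eq_cube algebra_simps)
  show ?thesis
  proof (cases "Y w0 = 0")
    case False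
    have d: "deriv X w0 \<noteq> 0" using DERIV_imp_deriv[OF T.dx[OF w(1)]] False by simp
    obtain O3 Lf where O3: "open O3" "z0 \<in> O3" "O3 \<subseteq> O1" and Lf: "Lf holomorphic_on O3" "isCont Lf z0" "Lf z0 = w0"
      and L: "\<And>z. z \<in> O3 \<Longrightarrow> Lf z \<in> - T.L \<and> X (Lf z) = f z"
      by (rule local_section[OF Thol(1) T.L_open _ d O1(3,1,2)]) (use w in auto)
    have "isCont (\<lambda>z. Y (Lf z) + g z) z0"
      using isCont_o2[where f = Lf and a = z0 and g = Y] T.y_isCont[OF w(1)] Lf fc O1(2) by (intro continuous_intros) auto
    then have "\<forall>\<^sub>F z in nhds z0. Y (Lf z) + g z \<noteq> 0"
      by (rule nonzero_nhds) (use Lf w False in simp)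
    then have "\<forall>\<^sub>F z in nhds z0. T.Phi (Lf z) = psi z"
      using eventually_nhds_in_open[OF O3(1,2)]
    proof eventually_elim
      case (elim z)
      have z: "z \<in> O1" "Lf z \<notin> T.L" "X (Lf z) = f z" using elim O3(3) L by auto
      have "(Y (Lf z) - g z) * (Y (Lf z) + g z) = 0"
        using eq[OF z(2,1)] z(3) by (simp add: power2_eq_square algebra_simps)
      then have "Y (Lf z) = g z" using elim by simp
      then show ?case using z psi[OF z(1)] by (simp add: T.Phi_def)
    qed
    then show ?thesis by (rule ball_of_nhds[OF O3(1,2) Lf(1,3)])
  next
    case True
    have d: "deriv Y w0 \<noteq> 0" using DERIV_imp_deriv[OF T.dy[OF w(1)]] T.y_simple[OF w(1) True] by simp
    obtain O3 Lf where O3: "open O3" "z0 \<in> O3" "O3 \<subseteq> O1" and Lf: "Lf holomorphic_on O3" "isCont Lf z0" "Lf z0 = w0"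
      and L: "\<And>z. z \<in> O3 \<Longrightarrow> Lf z \<in> - T.L \<and> Y (Lf z) = g z"
      by (rule local_section[OF Thol(2) T.L_open _ d O1(4,1,2)]) (use w in auto)
    have "isCont (\<lambda>z. X (Lf z)) z0"
      using isCont_o2[where f = Lf and a = z0 and g = X] T.x_isCont[OF w(1)] Lf by simp
    then have "isCont (\<lambda>z. X (Lf z) ^ 2 + X (Lf z) * f z + f z ^ 2 + A') z0"
      using fc O1(2) by (intro continuous_intros) auto
    then have "\<forall>\<^sub>F z in nhds z0. X (Lf z) ^ 2 + X (Lf z) * f z + f z ^ 2 + A' \<noteq> 0"
      by (rule nonzero_nhds) (use Lf w T.y_simple[OF w(1) True] in \<open>simp add: power2_eq_square\<close>)
    then have "\<forall>\<^sub>F z in nhds z0. T.Phi (Lf z) = psi z"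
      using eventually_nhds_in_open[OF O3(1,2)]
    proof eventually_elim
      case (elim z)
      have z: "z \<in> O1" "Lf z \<notin> T.L" "Y (Lf z) = g z" using elim O3(3) L by auto
      have "(X (Lf z) - f z) * (X (Lf z) ^ 2 + X (Lf z) * f z + f z ^ 2 + A') = 0"
        using eq[OF z(2,1)] z(3) by simp
      then have "X (Lf z) = f z" using elim by simp
      then show ?case using z psi[OF z(1)] by (simp add: T.Phi_def)
    qed
    then show ?thesis by (rule ball_of_nhds[OF O3(1,2) Lf(1,3)])
  qed
qed

text \<open>In the chart at infinity the curve reads \<open>v = u^3 + A' u v^2 + B' v^3\<close>. The
  coordinate \<open>u\<close> is a local parameter and is lifted; near the origin of the chart it
  determines \<open>v\<close>.\<close>

lemma lift_infinity:
  assumes O1: "open O1" "z0 \<in> O1" "u holomorphic_on O1" "v holomorphic_on O1"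
    and psi: "\<And>z. z \<in> O1 \<Longrightarrow> has_hom_coords (psi z) (u z, 1, v z)"
    and psi0: "psi z0 = Infinity" and w0: "w0 \<in> T.L"
  shows "\<exists>Lf e. e > 0 \<and> Lf holomorphic_on ball z0 e \<and> Lf z0 = w0 \<and> (\<forall>z\<in>ball z0 e. T.Phi (Lf z) = psi z)"
proof -
  have fc: "isCont u z" "isCont v z" if "z \<in> O1" for z
    using O1 that by (meson continuous_on_eq_continuous_at holomorphic_on_imp_continuous_on)+
  have uv0: "u z0 = 0" "v z0 = 0" using psi[OF O1(2)] psi0 by (simp_all add: has_hom_coords_Infinity)
  have curve: "v z = u z ^ 3 + A' * u z * v z ^ 2 + B' * v z ^ 3" if z: "z \<in> O1" for z
  proof (cases "psi z")
    case Infinity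
    then show ?thesis using psi[OF z] by (simp add: has_hom_coords_Infinity)
  next
    case (Affine p q)
    then have "v z \<noteq> 0" "p = u z / v z" "q = 1 / v z" using psi[OF z] by (simp_all add: has_hom_coords_Affine)
    then have u: "u z = p * v z" and q: "q * v z = 1" by simp_all
    have "v z = (q * v z) ^ 2 * v z" using q by simp
    also have "\<dots> = q ^ 2 * v z ^ 3" by (simp add: power_mult_distrib power2_eq_square power3_eq_cube)
    also have "\<dots> = u z ^ 3 + A' * u z * v z ^ 2 + B' * v z ^ 3"
      unfolding psi_curve[OF Affine] u by (simp add: algebra_simps power2_eq_square power3_eq_cube)
    finally show ?thesis .
  qed
  define U where "U = (\<lambda>w. if w = w0 then 0 else X w / Y w)"
  define W where "W = (\<lambda>w. if w = w0 then 0 else 1 / Y w)"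
  have "\<forall>\<^sub>F w in at w0. w \<notin> T.L \<and> Y w \<noteq> 0"
    using T.L_ev[of w0] T.y_ev_nz[OF w0] by eventually_elim auto
  then obtain O2 where O2: "open O2" "w0 \<in> O2" "\<And>w. w \<in> O2 \<Longrightarrow> w \<noteq> w0 \<Longrightarrow> w \<notin> T.L \<and> Y w \<noteq> 0"
    unfolding eventually_at_topological by auto
  have Thol: "X holomorphic_on O2 - {w0}" "Y holomorphic_on O2 - {w0}"
    using T.ell_x T.ell_y O2(3) holomorphic_on_subset[of _ "- T.L" "O2 - {w0}"] by (auto simp: T.ell_def)
  have Uh: "U holomorphic_on O2"
    unfolding U_def using O2 by (intro removable_singularity holomorphic_intros Thol T.x_div_y_lim w0) auto
  have Wc: "isCont W w0"
    unfolding isCont_def using T.inverse_y_lim[OF w0]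
    by (simp add: W_def) (rule Lim_transform_eventually, assumption, auto simp: eventually_at_filter)
  have "(U has_field_derivative - 1) (at w0)"
    unfolding has_field_derivative_iff
    by (rule Lim_transform_eventually[OF T.x_div_y_quot[OF w0]]) (auto simp: eventually_at_filter U_def)
  then have dU: "deriv U w0 \<noteq> 0" by (simp add: DERIV_imp_deriv)
  obtain O4 Lf where O4: "open O4" "z0 \<in> O4" "O4 \<subseteq> O1" and Lf: "Lf holomorphic_on O4" "isCont Lf z0" and L0: "Lf z0 = w0"
    and L: "\<And>z. z \<in> O4 \<Longrightarrow> Lf z \<in> O2 \<and> U (Lf z) = u z"
    by (rule local_section[OF Uh O2(1,2) dU O1(3,1,2)]) (use uv0 in \<open>auto simp: U_def\<close>)
  have WL: "isCont (\<lambda>z. W (Lf z)) z0"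
    using isCont_o2[where f = Lf and a = z0 and g = W] Wc L0 Lf(2) by simp
  \<comment> \<open>The cofactor of \<open>W (Lf z) - v z\<close> in the difference of the two chart
    equations. It equals 1 at \<open>z0\<close>.\<close>
  define M where "M = (\<lambda>z. 1 - A' * u z * (W (Lf z) + v z) - B' * (W (Lf z) ^ 2 + W (Lf z) * v z + v z ^ 2))"
  have "isCont M z0" unfolding M_def using fc[OF O1(2)] WL by (intro continuous_intros) auto
  then have "\<forall>\<^sub>F z in nhds z0. M z \<noteq> 0"
    by (rule nonzero_nhds) (simp add: M_def uv0 L0 W_def)
  then have "\<forall>\<^sub>F z in nhds z0. T.Phi (Lf z) = psi z"
    using eventually_nhds_in_open[OF O4(1,2)]
  proof eventually_elim
    case (elim z)
    then have z1: "z \<in> O1" "Lf z \<in> O2" "U (Lf z) = u z" using O4(3) L by auto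
    have WU: "W w = U w ^ 3 + A' * U w * W w ^ 2 + B' * W w ^ 3" if "w \<in> O2" for w
    proof (cases "w = w0")
      case False
      then have "w \<notin> T.L" "Y w \<noteq> 0" using O2(3) that by auto
      define i where "i = 1 / Y w"
      have i: "i * Y w = 1" using \<open>Y w \<noteq> 0\<close> by (simp add: i_def)
      have "i = (i * Y w) ^ 2 * i" using i by simp
      also have "\<dots> = Y w ^ 2 * i ^ 3" by (simp add: power_mult_distrib power2_eq_square power3_eq_cube)
      also have "\<dots> = (X w * i) ^ 3 + A' * (X w * i) * i ^ 2 + B' * i ^ 3"
        unfolding T.eqn[OF \<open>w \<notin> T.L\<close>] by (simp add: algebra_simps power2_eq_square power3_eq_cube)
      finally show ?thesis using False by (simp add: U_def W_def i_def)
    qed (simp add: U_def W_def)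
    have "(W (Lf z) - v z) * M z = (W (Lf z) - (u z ^ 3 + A' * u z * W (Lf z) ^ 2 + B' * W (Lf z) ^ 3)) - (v z - (u z ^ 3 + A' * u z * v z ^ 2 + B' * v z ^ 3))"
      by (simp add: M_def power2_eq_square power3_eq_cube algebra_simps)
    also have "\<dots> = 0" using WU[OF z1(2)] z1(3) curve[OF z1(1)] by simp
    finally have Wv: "W (Lf z) = v z" using elim by simp
    show ?case
    proof (cases "Lf z = w0")
      case True
      then have "v z = 0" using Wv by (simp add: W_def)
      then have "psi z = Infinity" using psi[OF z1(1)] by (cases "psi z") (auto simp: has_hom_coords_Affine)
      then show ?thesis using True w0 by (simp add: T.Phi_def)
    next
      case False
      then have t: "Lf z \<notin> T.L" "Y (Lf z) \<noteq> 0" using O2(3) z1(2) by auto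
      have v: "v z = 1 / Y (Lf z)" using Wv False by (simp add: W_def)
      have u: "u z = X (Lf z) / Y (Lf z)" using z1(3) False by (simp add: U_def)
      show ?thesis
        using psi[OF z1(1)] t u v by (cases "psi z") (auto simp: has_hom_coords_Infinity has_hom_coords_Affine T.Phi_def)
    qed
  qed
  then show ?thesis by (rule ball_of_nhds[OF O4(1,2) Lf(1) L0])
qed

lemma loc_lift:
  assumes w0: "T.Phi w0 = psi z0"
  shows "\<exists>Lf e. e > 0 \<and> Lf holomorphic_on ball z0 e \<and> Lf z0 = w0 \<and> (\<forall>z\<in>ball z0 e. T.Phi (Lf z) = psi z)"
proof -
  obtain O1 a b c where O1: "open O1" "z0 \<in> O1" "a holomorphic_on O1" "b holomorphic_on O1" "c holomorphic_on O1"
    and hc: "\<And>z. z \<in> O1 \<Longrightarrow> has_hom_coords (psi z) (a z, b z, c z)"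
    using loc_rep[of z0] by blast
  have op: "open (O1 \<inter> h -` (- {0}))" if "h holomorphic_on O1" for h :: "complex \<Rightarrow> complex"
    using holomorphic_on_imp_continuous_on[OF that] O1(1) by (intro continuous_open_preimage) auto
  have sub: "h holomorphic_on O1 \<inter> T'" if "h \<in> {a, b, c}" for h T'
    using that O1(3-5) by (auto intro: holomorphic_on_subset)
  show ?thesis
  proof (cases "psi z0")
    case Infinity
    then have b0: "b z0 \<noteq> 0" using hc[OF O1(2)] by (simp add: has_hom_coords_Infinity)
    show ?thesis
    proof (rule lift_infinity[OF op[OF O1(4)], of z0 "\<lambda>z. a z / b z" "\<lambda>z. c z / b z"])
      show "(\<lambda>z. a z / b z) holomorphic_on O1 \<inter> b -` (- {0})" "(\<lambda>z. c z / b z) holomorphic_on O1 \<inter> b -` (- {0})"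
        by (intro holomorphic_on_divide sub; auto)+
      show "has_hom_coords (psi z) (a z / b z, 1, c z / b z)" if "z \<in> O1 \<inter> b -` (- {0})" for z
        using has_hom_coords_scale[OF _ hc[of z], of "1 / b z"] that by simp
      show "w0 \<in> T.L" using w0 Infinity T.Phi_Infinity_iff by simp
    qed (use O1 b0 Infinity in auto)
  next
    case (Affine p q)
    then have c0: "c z0 \<noteq> 0" using hc[OF O1(2)] by (simp add: has_hom_coords_Affine)
    show ?thesis
    proof (rule lift_affine[OF op[OF O1(5)], of z0 "\<lambda>z. a z / c z" "\<lambda>z. b z / c z"])
      show "(\<lambda>z. a z / c z) holomorphic_on O1 \<inter> c -` (- {0})" "(\<lambda>z. b z / c z) holomorphic_on O1 \<inter> c -` (- {0})"
        by (intro holomorphic_on_divide sub; auto)+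
      show "psi z = Affine (a z / c z) (b z / c z)" if "z \<in> O1 \<inter> c -` (- {0})" for z
        using hc[of z] that by (cases "psi z") (auto simp: has_hom_coords_Infinity has_hom_coords_Affine)
    qed (use O1 c0 w0 in auto)
  qed
qed

definition is_lift :: "complex \<Rightarrow> (complex \<Rightarrow> complex) \<Rightarrow> real \<Rightarrow> bool" where
  "is_lift z0 Lf e \<longleftrightarrow> e > 0 \<and> Lf holomorphic_on ball z0 e \<and> (\<forall>z\<in>ball z0 e. T.Phi (Lf z) = psi z)"

lemma lift_exists: "\<exists>Lf e. is_lift z0 Lf e"
  using loc_lift T.Phi_surj[OF psi_points, of z0] unfolding is_lift_def by blast

lemma lift_deriv_unique:
  assumes "is_lift z0 L1 e1" "is_lift z0 L2 e2"
  shows "deriv L1 z0 = deriv L2 z0"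
proof -
  define e where "e = min e1 e2"
  have e: "e > 0" "L1 holomorphic_on ball z0 e" "L2 holomorphic_on ball z0 e"
    "\<And>z. z \<in> ball z0 e \<Longrightarrow> L1 z - L2 z \<in> T.L"
    using assms T.Phi_inj holomorphic_on_subset[of _ "ball z0 _" "ball z0 e"]
    by (auto simp: is_lift_def e_def)
  define d where "d = (\<lambda>z. L1 z - L2 z)"
  obtain r where r: "r > 0" "\<And>z. z \<in> T.L \<Longrightarrow> norm z < r \<Longrightarrow> z = 0" using T.L_discrete by blast
  have dh: "d holomorphic_on ball z0 e" unfolding d_def by (intro holomorphic_intros e)
  then have "isCont d z0"
    using e(1) by (meson centre_in_ball continuous_on_eq_continuous_at holomorphic_on_imp_continuous_on open_ball)
  then have "\<forall>\<^sub>F z in nhds z0. dist (d z) (d z0) < r"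
    using r(1) unfolding continuous_at_eps_delta eventually_nhds_metric by blast
  moreover have "\<forall>\<^sub>F z in nhds z0. z \<in> ball z0 e"
    using e(1) by (intro eventually_nhds_in_open) auto
  ultimately have "\<forall>\<^sub>F z in nhds z0. d z = d z0"
  proof eventually_elim
    case (elim z)
    have "d z - d z0 \<in> T.L" using e elim T.L_diff unfolding d_def by simp
    then show ?case using r(2)[of "d z - d z0"] elim by (simp add: dist_norm)
  qed
  then have "deriv d z0 = deriv (\<lambda>_. d z0) z0" by (rule deriv_cong_ev) simp
  moreover have "deriv d z0 = deriv L1 z0 - deriv L2 z0"
    unfolding d_def using e by (intro deriv_diff) (auto simp: holomorphic_on_imp_differentiable_at)
  ultimately show ?thesis by simp
qed

text \<open>Two local lifts differ by a locally constant lattice element, so their derivative is a global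
  function; it is entire and periodic, hence constant.\<close>

definition D :: "complex \<Rightarrow> complex" where
  "D z = deriv (SOME Lf. \<exists>e. is_lift z Lf e) z"

lemma D_eq: "is_lift z Lf e \<Longrightarrow> D z = deriv Lf z"
proof -
  assume l: "is_lift z Lf e"
  then have "\<exists>e. is_lift z (SOME Lf. \<exists>e. is_lift z Lf e) e"
    by (intro someI[of "\<lambda>Lf. \<exists>e. is_lift z Lf e"]) blast
  then show ?thesis unfolding D_def using lift_deriv_unique l by blast
qed

lemma lift_move:
  assumes "is_lift z0 Lf e" "z \<in> ball z0 e"
  shows "is_lift z Lf (e - dist z0 z)"
proof -
  have "ball z (e - dist z0 z) \<subseteq> ball z0 e" 
  proof
    fix y assume "y \<in> ball z (e - dist z0 z)"
    then show "y \<in> ball z0 e" using dist_triangle[of z0 y z] by simp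
  qed
  moreover have "Lf holomorphic_on ball z (e - dist z0 z)"
    by (rule holomorphic_on_subset[OF _ calculation]) (use assms in \<open>simp add: is_lift_def\<close>)
  ultimately show ?thesis using assms unfolding is_lift_def by auto
qed

lemma D_per: "l \<in> S.L \<Longrightarrow> D (z + l) = D z"
proof -
  assume l: "l \<in> S.L"
  obtain Lf e where Lf: "is_lift z Lf e" using lift_exists by blast
  have "is_lift (z + l) (\<lambda>w. Lf (w - l)) e"
    unfolding is_lift_def
  proof (intro conjI ballI)
    show "e > 0" using Lf by (simp add: is_lift_def)
    show "(\<lambda>w. Lf (w - l)) holomorphic_on ball (z + l) e"
      using Lf by (intro holomorphic_on_compose_gen[of "\<lambda>w. w - l" _ Lf "ball z e", unfolded o_def])
        (auto simp: is_lift_def dist_norm algebra_simps intro!: holomorphic_intros)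
    fix w assume "w \<in> ball (z + l) e"
    then have "w - l \<in> ball z e" by (simp add: dist_norm algebra_simps)
    then show "T.Phi (Lf (w - l)) = psi w"
      using Lf psi_per[OF l, of "w - l"] by (simp add: is_lift_def)
  qed
  then have "D (z + l) = deriv (\<lambda>w. Lf (w - l)) (z + l)" by (rule D_eq)
  also have "\<dots> = deriv Lf z"
  proof (rule DERIV_imp_deriv)
    have "(Lf has_field_derivative deriv Lf z) (at z)"
      using Lf holomorphic_derivI[of Lf "ball z e" z] by (simp add: is_lift_def)
    then show "((\<lambda>w. Lf (w - l)) has_field_derivative deriv Lf z) (at (z + l))"
      using DERIV_shift[of Lf "deriv Lf z" "z + l" "- l"] by simp
  qed
  finally show ?thesis using D_eq[OF Lf] by simp
qed

lemma D_deriv: "\<exists>D'. (D has_field_derivative D') (at z)"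
proof -
  obtain Lf e where Lf: "is_lift z Lf e" using lift_exists by blast
  have "deriv Lf holomorphic_on ball z e" using Lf by (auto simp: is_lift_def intro!: holomorphic_deriv)
  then have "D holomorphic_on ball z e"
    by (rule holomorphic_transform) (use D_eq[OF lift_move[OF Lf]] in auto)
  then show ?thesis using Lf by (auto simp: holomorphic_on_open is_lift_def)
qed

lemma D_const: "D z = D 0"
proof -
  have "S.ell D" unfolding S.ell_def using D_deriv D_per by (auto simp: holomorphic_on_open[OF S.L_open])
  moreover have "(D \<longlongrightarrow> D 0) (at 0)" using D_deriv[of 0] DERIV_isCont isCont_def by blast
  ultimately have "z \<notin> S.L \<Longrightarrow> ?thesis" using S.ell_liouville by blast
  moreover have "z \<in> S.L \<Longrightarrow> ?thesis" using D_per[of z 0] by simp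
  ultimately show ?thesis by blast
qed

lemma psi_local:
  assumes "T.Phi w0 = psi z0"
  shows "\<exists>e>0. \<forall>z\<in>ball z0 e. psi z = T.Phi (w0 + D 0 * (z - z0))"
proof -
  obtain Lf e where Lf: "e > 0" "Lf holomorphic_on ball z0 e" "Lf z0 = w0" "\<forall>z\<in>ball z0 e. T.Phi (Lf z) = psi z"
    using loc_lift[OF assms] by blast
  then have il: "is_lift z0 Lf e" by (simp add: is_lift_def)
  have "Lf z - D 0 * z = Lf z0 - D 0 * z0" if "z \<in> ball z0 e" for z
  proof (rule DERIV_zero_connected_const[where S = "ball z0 e" and f = "\<lambda>z. Lf z - D 0 * z"])
    fix w assume w: "w \<in> ball z0 e"
    have "(Lf has_field_derivative D 0) (at w)"
      using holomorphic_derivI[OF Lf(2) open_ball w] D_eq[OF lift_move[OF il w]] D_const[of w] by simp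
    then show "((\<lambda>z. Lf z - D 0 * z) has_field_derivative 0) (at w)"
      by (auto intro!: derivative_eq_intros)
  qed (use that Lf(1) in auto)
  then have "Lf z = w0 + D 0 * (z - z0)" if "z \<in> ball z0 e" for z
    using that Lf(3) by (simp add: algebra_simps)
  then show ?thesis using Lf(1,4) by (intro exI[of _ e]) auto
qed

text \<open>Near any point both sides lift to affine maps with the same slope, so their lifts differ
  by a constant. Membership of this constant in the lattice is locally constant, and connectedness
  extends the agreement at 0 to the whole plane.\<close>

lemma psi_linear: "psi z = T.Phi (D 0 * z)"
proof -
  define U where "U = {z. psi z = T.Phi (D 0 * z)}"
  have "open U"
    unfolding open_contains_ball
  proof
    fix z0 assume "z0 \<in> U"
    then have "T.Phi (D 0 * z0) = psi z0" by (simp add: U_def)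
    from psi_local[OF this] show "\<exists>e>0. ball z0 e \<subseteq> U" by (auto simp: U_def algebra_simps)
  qed
  moreover have "open (- U)"
    unfolding open_contains_ball
  proof
    fix z0 assume z0: "z0 \<in> - U"
    obtain w0 where w0: "T.Phi w0 = psi z0" using T.Phi_surj[OF psi_points] by blast
    then have n: "w0 - D 0 * z0 \<notin> T.L" using z0 T.Phi_eq_iff[of w0 "D 0 * z0"] by (auto simp: U_def)
    obtain e where e: "e > 0" "\<And>z. z \<in> ball z0 e \<Longrightarrow> psi z = T.Phi (w0 + D 0 * (z - z0))"
      using psi_local[OF w0] by blast
    have "z \<notin> U" if "z \<in> ball z0 e" for z
    proof
      assume "z \<in> U"
      then have "T.Phi (w0 + D 0 * (z - z0)) = T.Phi (D 0 * z)" using e(2)[OF that] by (simp add: U_def)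
      then show False using n by (simp add: T.Phi_eq_iff algebra_simps)
    qed
    then show "\<exists>e>0. ball z0 e \<subseteq> - U" using e(1) by blast
  qed
  moreover have "0 \<in> U" by (simp add: U_def psi_def inf)
  ultimately have "U = UNIV"
    using connected_clopen[of "UNIV :: complex set"] by (auto simp: closed_def)
  then show ?thesis by (auto simp: U_def)
qed

lemma morphism_linear: "\<exists>\<alpha>. (\<forall>l\<in>S.L. \<alpha> * l \<in> T.L) \<and> (\<forall>z. \<phi> (S.Phi z) = T.Phi (\<alpha> * z))"
proof (intro exI[of _ "D 0"] conjI ballI allI)
  show lin: "\<phi> (S.Phi z) = T.Phi (D 0 * z)" for z using psi_linear by (simp add: psi_def)
  fix l assume "l \<in> S.L"
  then have "S.Phi l = Infinity" by (simp add: S.Phi_Infinity_iff)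
  then show "D 0 * l \<in> T.L" using lin[of l] inf T.Phi_Infinity_iff by metis
qed

end

subsection \<open>The endomorphism ring and its discriminant\<close>

locale wp2 = S: wp w1 w2 x y A B + T: wp u1 u2 X Y A' B'
  for w1 w2 x y A B u1 u2 X Y A' B'
begin

text \<open>The chosen preimage is immaterial as soon as \<open>\<alpha>\<close> maps the source
  lattice into the target lattice; the restriction makes the map extensional, as
  \<open>morphism_over\<close> demands.\<close>

definition hom_map :: "complex \<Rightarrow> complex point \<Rightarrow> complex point" where
  "hom_map \<alpha> = (\<lambda>P\<in>points S.EC. T.Phi (\<alpha> * (SOME z. S.Phi z = P)))"

lemma hom_map_Phi:
  assumes "\<And>l. l \<in> S.L \<Longrightarrow> \<alpha> * l \<in> T.L"
  shows "hom_map \<alpha> (S.Phi z) = T.Phi (\<alpha> * z)"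
proof -
  define z' where "z' = (SOME z'. S.Phi z' = S.Phi z)"
  have "S.Phi z' = S.Phi z" unfolding z'_def by (rule someI_ex) blast
  then have "\<alpha> * (z' - z) \<in> T.L" using assms S.Phi_eq_iff by blast
  then have "T.Phi (\<alpha> * z') = T.Phi (\<alpha> * z)" by (simp add: T.Phi_eq_iff right_diff_distrib)
  then show ?thesis by (simp add: hom_map_def S.Phi_points z'_def)
qed

lemma hom_map_points: "hom_map \<alpha> \<in> points S.EC \<rightarrow>\<^sub>E points T.EC"
  by (simp add: hom_map_def T.Phi_points)

lemma hom_map_ext:
  assumes "f \<in> extensional (points S.EC)" "\<And>l. l \<in> S.L \<Longrightarrow> \<alpha> * l \<in> T.L" "\<And>z. f (S.Phi z) = T.Phi (\<alpha> * z)"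
  shows "f = hom_map \<alpha>"
proof
  fix P
  show "f P = hom_map \<alpha> P"
  proof (cases "P \<in> points S.EC")
    case True
    then obtain z where "S.Phi z = P" using S.Phi_surj by blast
    then show ?thesis using assms(3)[of z] hom_map_Phi[OF assms(2), of z] by simp
  next
    case False
    then show ?thesis using assms(1) by (simp add: hom_map_def extensional_def)
  qed
qed

lemma hom_map_morphism:
  assumes al: "\<And>l. l \<in> S.L \<Longrightarrow> \<alpha> * l \<in> T.L" and nz: "\<alpha> \<noteq> 0"
    and k: "k = UNIV \<or> k = \<real> \<and> S.cnj_sym \<and> T.cnj_sym \<and> \<alpha> \<in> \<real>"
  shows "morphism_over k S.EC T.EC (hom_map \<alpha>)"
proof -
  define c where "c = 1 / \<alpha>"
  have c: "c \<noteq> 0" using nz by (simp add: c_def)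
  have zc: "z / c = \<alpha> * z" for z by (simp add: c_def)
  interpret K: wp "c * u1" "c * u2" "\<lambda>z. X (z / c) / c ^ 2" "\<lambda>z. Y (z / c) / c ^ 3" "A' / c ^ 4" "B' / c ^ 6"
    by (rule wp_scale[OF T.wp_axioms c])
  have KL: "z \<in> K.L \<longleftrightarrow> \<alpha> * z \<in> T.L" for z using T.scale_L(2)[OF c, of z] by (simp add: zc)
  interpret wp_sub w1 w2 x y A B "c * u1" "c * u2" "\<lambda>z. X (z / c) / c ^ 2" "\<lambda>z. Y (z / c) / c ^ 3" "A' / c ^ 4" "B' / c ^ 6"
    by unfold_locales (use al KL in auto)
  show ?thesis
  proof (rule sub_morphism[OF hom_map_points])
    \<comment> \<open>The factors \<open>c ^ 2\<close> and \<open>c ^ 3\<close> undo the weights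
      that the coordinates acquire from rescaling the target lattice.\<close>
    show "hom_map \<alpha> (S.Phi z) = (if z \<in> K.L then Infinity else Affine (c ^ 2 * (X (z / c) / c ^ 2)) (c ^ 3 * (Y (z / c) / c ^ 3)))" for z
      using c hom_map_Phi[OF al, of z] by (simp add: KL T.Phi_def zc)
    show "c ^ 2 \<noteq> 0" "c ^ 3 \<noteq> 0" using c by auto
    show "k = UNIV \<or> k = \<real> \<and> S.cnj_sym \<and> K.cnj_sym \<and> c ^ 2 \<in> \<real> \<and> c ^ 3 \<in> \<real>"
    proof (cases "k = UNIV")
      case False
      then have r: "k = \<real>" "S.cnj_sym" "T.cnj_sym" "\<alpha> \<in> \<real>" using k by auto
      then have cr: "c \<in> \<real>" by (simp add: c_def)
      have a: "\<alpha> * cnj z = cnj (\<alpha> * z)" for z using r(4) by (simp add: Reals_cnj_iff)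
      have cc: "cnj c = c" using cr by (simp add: Reals_cnj_iff)
      have "\<forall>z. (\<alpha> * z \<in> T.L) = (cnj (\<alpha> * z) \<in> T.L)"
        using r(3) unfolding T.cnj_sym_def by blast
      moreover have "\<forall>z. \<alpha> * z \<notin> T.L \<longrightarrow> X (cnj (\<alpha> * z)) / c ^ 2 = cnj (X (\<alpha> * z) / c ^ 2)
          \<and> Y (cnj (\<alpha> * z)) / c ^ 3 = cnj (Y (\<alpha> * z) / c ^ 3)"
        using r(3) unfolding T.cnj_sym_def by (simp add: cc del: complex_cnj_mult)
      ultimately have "K.cnj_sym"
        unfolding K.cnj_sym_def unfolding KL zc a by blast
      then show ?thesis using r cr by auto
    qed simp
  qed
qed

lemma hom_map_isogeny:
  assumes al: "\<And>l. l \<in> S.L \<Longrightarrow> \<alpha> * l \<in> T.L" and nz: "\<alpha> \<noteq> 0"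
    and k: "S.cnj_sym" "T.cnj_sym" "\<alpha> \<in> \<real>"
  shows "isogeny_over \<real> S.EC T.EC (hom_map \<alpha>)"
proof -
  have "hom_map \<alpha> (S.Phi 0) = T.Phi (\<alpha> * 0)" by (rule hom_map_Phi[OF al])
  moreover have "hom_map \<alpha> (S.Phi (u1 / 2 / \<alpha>)) \<noteq> Infinity"
    using hom_map_Phi[OF al, of "u1 / 2 / \<alpha>"] nz T.half_notin(1) by (simp add: T.Phi_Infinity_iff)
  ultimately show ?thesis
    unfolding isogeny_over_def using hom_map_morphism[OF al nz] k S.Phi_points by auto
qed

end

sublocale wp \<subseteq> wp2 w1 w2 x y A B w1 w2 x y A B
  by unfold_locales

context wp
begin

definition Mult :: "complex set" where "Mult = {\<alpha>. \<forall>l\<in>L. \<alpha> * l \<in> L}"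

lemma Mult_D: "\<alpha> \<in> Mult \<Longrightarrow> l \<in> L \<Longrightarrow> \<alpha> * l \<in> L"
  by (simp add: Mult_def)

lemma const_morphism: "morphism_over UNIV EC EC (\<lambda>P\<in>points EC. Infinity)"
proof -
  have h: "has_hom_coords Infinity (0 :: complex, 1, 0)" by (simp add: has_hom_coords_Infinity)
  have "(let F = (\<lambda>Q. (form_eval 0 (\<lambda>i j. 0) (hom_coords Q), form_eval 0 (\<lambda>i j. 1) (hom_coords Q), form_eval 0 (\<lambda>i j. 0) (hom_coords Q)))
         in F P \<noteq> (0, 0, 0) \<and> (\<forall>Q\<in>points EC. F Q \<noteq> (0, 0, 0) \<longrightarrow> has_hom_coords ((\<lambda>P\<in>points EC. Infinity) Q) (F Q)))" for P
    using h by (simp add: form_eval_def Let_def split_beta)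
  note F = this
  show ?thesis
    unfolding morphism_over_def
  proof (intro conjI ballI)
    show "(\<lambda>P\<in>points EC. Infinity) \<in> points EC \<rightarrow>\<^sub>E points EC" by (auto simp: points_def)
    fix P
    show "\<exists>d f g h. (\<forall>i j. f i j \<in> UNIV \<and> g i j \<in> UNIV \<and> h i j \<in> UNIV) \<and>
        (let F = (\<lambda>Q. (form_eval d f (hom_coords Q), form_eval d g (hom_coords Q), form_eval d h (hom_coords Q)))
         in F P \<noteq> (0, 0, 0) \<and> (\<forall>Q\<in>points EC. F Q \<noteq> (0, 0, 0) \<longrightarrow> has_hom_coords ((\<lambda>P\<in>points EC. Infinity) Q) (F Q)))"
      by (rule exI[of _ 0], rule exI[of _ "\<lambda>i j. 0"], rule exI[of _ "\<lambda>i j. 1"], rule exI[of _ "\<lambda>i j. 0"], rule conjI[OF _ F]) simp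
  qed
qed

lemma hom_map_0: "hom_map 0 = (\<lambda>P\<in>points EC. Infinity)"
  by (simp add: hom_map_def)

lemma hom_map_carrier: "\<alpha> \<in> Mult \<Longrightarrow> hom_map \<alpha> \<in> carrier (End_ring EC)"
proof -
  assume a: "\<alpha> \<in> Mult"
  have "hom_map \<alpha> (Phi 0) = Phi (\<alpha> * 0)" using Mult_D[OF a] by (intro hom_map_Phi) auto
  then have "hom_map \<alpha> Infinity = Infinity" by simp
  moreover have "morphism_over UNIV EC EC (hom_map \<alpha>)"
    using hom_map_morphism[of \<alpha> UNIV] Mult_D[OF a] const_morphism hom_map_0 by (cases "\<alpha> = 0") auto
  ultimately show ?thesis by (simp add: End_ring_def)
qed

lemma carrier_End: "carrier (End_ring EC) = hom_map ` Mult"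
proof
  show "hom_map ` Mult \<subseteq> carrier (End_ring EC)" using hom_map_carrier by blast
  show "carrier (End_ring EC) \<subseteq> hom_map ` Mult"
  proof
    fix \<phi> assume "\<phi> \<in> carrier (End_ring EC)"
    then have p: "morphism_over UNIV EC EC \<phi>" "\<phi> Infinity = Infinity" by (auto simp: End_ring_def)
    interpret P: wp_pair w1 w2 x y A B w1 w2 x y A B \<phi> by unfold_locales (use p in auto)
    obtain \<alpha> where a: "\<forall>l\<in>L. \<alpha> * l \<in> L" "\<forall>z. \<phi> (Phi z) = Phi (\<alpha> * z)" using P.morphism_linear by blast
    have "\<phi> \<in> extensional (points EC)" using p(1) by (auto simp: morphism_over_def PiE_def)
    then have "\<phi> = hom_map \<alpha>" using a by (intro hom_map_ext) auto
    then show "\<phi> \<in> hom_map ` Mult" using a(1) by (auto simp: Mult_def)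
  qed
qed

lemma hom_map_inj: "inj_on hom_map Mult"
proof (rule inj_onI, rule ccontr)
  fix \<alpha> \<beta> assume ab: "\<alpha> \<in> Mult" "\<beta> \<in> Mult" "hom_map \<alpha> = hom_map \<beta>" and ne: "\<alpha> \<noteq> \<beta>"
  obtain e where e: "e > 0" "\<And>z. z \<in> L \<Longrightarrow> norm z < e \<Longrightarrow> z = 0" using L_discrete by blast
  \<comment> \<open>A nonzero number too short to be a period. If
    \<open>\<alpha> \<noteq> \<beta>\<close>, the difference of the two maps reaches it.\<close>
  define r :: complex where "r = of_real (e / 2)"
  define z where "z = r / (\<alpha> - \<beta>)"
  have "Phi (\<alpha> * z) = Phi (\<beta> * z)" using ab hom_map_Phi Mult_D by metis
  then have "(\<alpha> - \<beta>) * z \<in> L" by (simp add: Phi_eq_iff left_diff_distrib)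
  moreover have "(\<alpha> - \<beta>) * z = r" unfolding z_def using ne by (subst nonzero_mult_div_cancel_left[symmetric, of "\<alpha> - \<beta>" r]) auto
  ultimately have "r \<in> L" by simp
  moreover have "norm r = e / 2" using e(1) by (simp add: r_def)
  ultimately show False using e(2)[of r] e(1) by auto
qed

lemma Mult_closed: "0 \<in> Mult" "1 \<in> Mult" "\<alpha> \<in> Mult \<Longrightarrow> \<beta> \<in> Mult \<Longrightarrow> \<alpha> + \<beta> \<in> Mult" "\<alpha> \<in> Mult \<Longrightarrow> - \<alpha> \<in> Mult"
  "\<alpha> \<in> Mult \<Longrightarrow> \<beta> \<in> Mult \<Longrightarrow> \<alpha> * \<beta> \<in> Mult"
  by (auto simp: Mult_def distrib_right L_uminus mult.assoc)

lemma End_ops: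
  "\<zero>\<^bsub>End_ring EC\<^esub> = hom_map 0" "\<one>\<^bsub>End_ring EC\<^esub> = hom_map 1"
  "\<alpha> \<in> Mult \<Longrightarrow> \<beta> \<in> Mult \<Longrightarrow> hom_map \<alpha> \<oplus>\<^bsub>End_ring EC\<^esub> hom_map \<beta> = hom_map (\<alpha> + \<beta>)"
  "\<alpha> \<in> Mult \<Longrightarrow> \<beta> \<in> Mult \<Longrightarrow> hom_map \<alpha> \<otimes>\<^bsub>End_ring EC\<^esub> hom_map \<beta> = hom_map (\<alpha> * \<beta>)"
proof -
  show "\<zero>\<^bsub>End_ring EC\<^esub> = hom_map 0" by (simp add: End_ring_def hom_map_0)
  show "\<one>\<^bsub>End_ring EC\<^esub> = hom_map 1"
    unfolding End_ring_def by (simp, rule hom_map_ext) (auto simp: Phi_points)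
  assume ab: "\<alpha> \<in> Mult" "\<beta> \<in> Mult"
  note s = Mult_closed(3)[OF ab] Mult_closed(5)[OF ab]
  have h: "hom_map \<gamma> (Phi z) = Phi (\<gamma> * z)" if "\<gamma> \<in> Mult" for \<gamma> z
    using that Mult_D by (intro hom_map_Phi) auto
  show "hom_map \<alpha> \<oplus>\<^bsub>End_ring EC\<^esub> hom_map \<beta> = hom_map (\<alpha> + \<beta>)"
    unfolding End_ring_def using s
    by (simp, intro hom_map_ext) (auto simp: Phi_points h ab Phi_add distrib_right Mult_D)
  show "hom_map \<alpha> \<otimes>\<^bsub>End_ring EC\<^esub> hom_map \<beta> = hom_map (\<alpha> * \<beta>)"
    unfolding End_ring_def using s
    by (simp, intro hom_map_ext) (auto simp: Phi_points h ab compose_def Mult_D mult.assoc)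
qed

end

text \<open>\<open>End_ring\<close> is only a record of operations on maps. Its ring laws are
  inherited from the complex numbers through \<open>h\<close>, and all computations with
  \<open>discr\<close> are carried out there.\<close>

locale subring_iso =
  fixes R :: "('a, 'm) ring_scheme" and M :: "complex set" and h :: "complex \<Rightarrow> 'a"
  assumes car: "carrier R = h ` M" and inj: "inj_on h M"
    and M0: "0 \<in> M" and M1: "1 \<in> M" and Madd: "a \<in> M \<Longrightarrow> b \<in> M \<Longrightarrow> a + b \<in> M"
    and Mneg: "a \<in> M \<Longrightarrow> - a \<in> M" and Mmult: "a \<in> M \<Longrightarrow> b \<in> M \<Longrightarrow> a * b \<in> M"
    and h0: "\<zero>\<^bsub>R\<^esub> = h 0" and h1: "\<one>\<^bsub>R\<^esub> = h 1"
    and hadd: "a \<in> M \<Longrightarrow> b \<in> M \<Longrightarrow> h a \<oplus>\<^bsub>R\<^esub> h b = h (a + b)"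
    and hmult: "a \<in> M \<Longrightarrow> b \<in> M \<Longrightarrow> h a \<otimes>\<^bsub>R\<^esub> h b = h (a * b)"
begin

lemma h_eq: "a \<in> M \<Longrightarrow> b \<in> M \<Longrightarrow> h a = h b \<longleftrightarrow> a = b"
  using inj by (auto simp: inj_on_def)

lemma grp: "group (add_monoid R)"
proof (rule groupI)
  fix a assume "a \<in> carrier (add_monoid R)"
  then obtain x where "x \<in> M" "a = h x" by (auto simp: car)
  then show "\<exists>b\<in>carrier (add_monoid R). b \<otimes>\<^bsub>add_monoid R\<^esub> a = \<one>\<^bsub>add_monoid R\<^esub>"
    using Mneg by (intro bexI[of _ "h (- x)"]) (auto simp: car h0 hadd)
qed (auto simp: car h0 hadd M0 Madd add.assoc)

lemma M_of_nat: "a \<in> M \<Longrightarrow> of_nat n * a \<in> M"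
  by (induction n) (auto simp: M0 Madd distrib_right)

lemma M_of_int: "a \<in> M \<Longrightarrow> of_int n * a \<in> M"
  using M_of_nat[of a "nat n"] Mneg[OF M_of_nat[of a "nat (- n)"]] by (cases "n \<ge> 0") auto

lemma add_pow_nat: "a \<in> M \<Longrightarrow> h a [^]\<^bsub>add_monoid R\<^esub> (n::nat) = h (of_nat n * a)"
proof (induction n)
  case 0
  then show ?case by (simp add: nat_pow_def h0)
next
  case (Suc n)
  then have "h a [^]\<^bsub>add_monoid R\<^esub> n = h (of_nat n * a)" by simp
  moreover have "h a [^]\<^bsub>add_monoid R\<^esub> Suc n = (h a [^]\<^bsub>add_monoid R\<^esub> n) \<oplus>\<^bsub>R\<^esub> h a"
    by (simp add: nat_pow_def)
  ultimately show ?case using hadd[OF M_of_nat[OF Suc.prems, of n] Suc.prems]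
    by (simp add: distrib_right add.commute)
qed

lemma add_pow_int: "a \<in> M \<Longrightarrow> [(n::int)] \<cdot>\<^bsub>R\<^esub> h a = h (of_int n * a)"
proof -
  assume a: "a \<in> M"
  have inv: "inv\<^bsub>add_monoid R\<^esub> (h b) = h (- b)" if "b \<in> M" for b
    using that Mneg by (intro group.inv_equality[OF grp]) (auto simp: car h0 hadd)
  have e: "[(n::int)] \<cdot>\<^bsub>R\<^esub> h a = (if n < 0 then inv\<^bsub>add_monoid R\<^esub> (h (of_nat (nat (- n)) * a)) else h (of_nat (nat n) * a))"
    unfolding add_pow_def int_pow_def2 add_pow_nat[OF a] ..
  show ?thesis
  proof (cases "n < 0")
    case True
    then show ?thesis unfolding e inv[OF M_of_nat[OF a]] by simp
  next
    case False
    then show ?thesis unfolding e by simp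
  qed
qed

lemma comb: "a \<in> M \<Longrightarrow> b \<in> M \<Longrightarrow> [(m::int)] \<cdot>\<^bsub>R\<^esub> h a \<oplus>\<^bsub>R\<^esub> [(n::int)] \<cdot>\<^bsub>R\<^esub> h b = h (of_int m * a + of_int n * b)"
  by (simp add: add_pow_int hadd M_of_int)

definition Zbasis :: "complex \<Rightarrow> complex \<Rightarrow> bool" where
  "Zbasis a b \<longleftrightarrow> a \<in> M \<and> b \<in> M \<and> (\<forall>x\<in>M. \<exists>!mn :: int \<times> int. x = of_int (fst mn) * a + of_int (snd mn) * b)"

lemma comb_M: "a \<in> M \<Longrightarrow> b \<in> M \<Longrightarrow> of_int m * a + of_int n * b \<in> M"
  by (intro Madd M_of_int)

lemma int_basis_iff: "a \<in> M \<Longrightarrow> b \<in> M \<Longrightarrow> int_basis R (h a) (h b) \<longleftrightarrow> Zbasis a b"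
  unfolding int_basis_def Zbasis_def by (auto simp: car comb h_eq comb_M)

lemma coords_eq:
  assumes "Zbasis a b" "x \<in> M" "x = of_int m * a + of_int n * b"
  shows "int_coords R (h a) (h b) (h x) = (m, n)"
proof -
  have ab: "a \<in> M" "b \<in> M" using assms by (auto simp: Zbasis_def)
  have "\<exists>!mn :: int \<times> int. x = of_int (fst mn) * a + of_int (snd mn) * b"
    using assms unfolding Zbasis_def by blast
  then have u: "mn = (m, n)" if "x = of_int (fst mn) * a + of_int (snd mn) * b" for mn :: "int \<times> int"
    using that assms(3) by (metis fst_conv snd_conv)
  have iff: "h x = [fst mn] \<cdot>\<^bsub>R\<^esub> h a \<oplus>\<^bsub>R\<^esub> [snd mn] \<cdot>\<^bsub>R\<^esub> h b \<longleftrightarrow> x = of_int (fst mn) * a + of_int (snd mn) * b" for mn :: "int \<times> int"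
    using ab assms(2) by (simp add: comb h_eq comb_M)
  show ?thesis
    unfolding int_coords_def iff using u assms(3) by (intro the_equality) auto
qed

lemma coords_exist:
  assumes "Zbasis a b" "x \<in> M"
  obtains m n where "x = of_int m * a + of_int n * b" "int_coords R (h a) (h b) (h x) = (m, n)"
proof -
  obtain mn :: "int \<times> int" where "x = of_int (fst mn) * a + of_int (snd mn) * b"
    using assms by (auto simp: Zbasis_def)
  then show ?thesis using coords_eq[OF assms] that by blast
qed

text \<open>The two equations for multiplication by \<open>x\<close>, together with their
  conjugates, give the trace of its matrix by Cramer's rule; \<open>d\<close> is the
  determinant.\<close>

lemma trace_eq:
  assumes b: "Zbasis a b" and x: "x \<in> M" and d: "a * cnj b - cnj a * b \<noteq> 0"
  shows "of_int (field_trace R (h a) (h b) (h x)) = x + cnj x"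
proof -
  have ab: "a \<in> M" "b \<in> M" using assms by (auto simp: Zbasis_def)
  obtain m n where 1: "x * a = of_int m * a + of_int n * b" "int_coords R (h a) (h b) (h (x * a)) = (m, n)"
    using coords_exist[OF b Mmult[OF x ab(1)]] by blast
  obtain m' n' where 2: "x * b = of_int m' * a + of_int n' * b" "int_coords R (h a) (h b) (h (x * b)) = (m', n')"
    using coords_exist[OF b Mmult[OF x ab(2)]] by blast
  have c1: "cnj x * cnj a = of_int m * cnj a + of_int n * cnj b"
    using arg_cong[OF 1(1), of cnj] by simp
  have c2: "cnj x * cnj b = of_int m' * cnj a + of_int n' * cnj b"
    using arg_cong[OF 2(1), of cnj] by simp
  have "(x + cnj x) * (a * cnj b - cnj a * b) = (x * a) * cnj b + a * (cnj x * cnj b) - (x * b) * cnj a - (cnj x * cnj a) * b"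
    by (simp add: algebra_simps)
  also have "\<dots> = (of_int m + of_int n') * (a * cnj b - cnj a * b)"
    unfolding 1 2 c1 c2 by (simp add: algebra_simps)
  finally have "x + cnj x = of_int m + of_int n'" using d by simp
  then show ?thesis
    using x ab 1 2 by (simp add: field_trace_def hmult)
qed

text \<open>The Gram determinant is the square of \<open>\<delta> = a * cnj b - cnj a * b\<close>,
  and a change of basis multiplies \<open>\<delta>\<close> by 1 or -1. So \<open>discr\<close> is
  well defined, and the basis formed by 1 and \<open>w\<close> yields the discriminant of the
  minimal polynomial of \<open>w\<close>.\<close>

lemma discr_eq:
  assumes w: "M = {of_int m + of_int n * w | m n. True}" and sp: "w ^ 2 = of_int s * w - of_int p" and im: "Im w \<noteq> 0"
  shows "discr R = s ^ 2 - 4 * p"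
proof -
  have wM: "w \<in> M" unfolding w using of_int_0 of_int_1 by (intro CollectI exI[of _ 0] exI[of _ 1]) simp
  have ind: "of_int m + of_int n * w = of_int m' + of_int n' * w \<longleftrightarrow> m = m' \<and> n = n'" for m n m' n'
    using im by (auto simp: complex_eq_iff)
  have basis: "Zbasis 1 w"
    unfolding Zbasis_def
  proof (intro conjI ballI M1 wM)
    fix x assume "x \<in> M"
    then obtain m n where x: "x = of_int m + of_int n * w" using w by auto
    show "\<exists>!mn :: int \<times> int. x = of_int (fst mn) * 1 + of_int (snd mn) * w"
      by (rule ex1I[of _ "(m, n)"]) (auto simp: x ind)
  qed
  have wc: "w + cnj w = of_int s" "w * cnj w = of_int p"
  proof -
    have r: "Re w ^ 2 - Im w ^ 2 = s * Re w - p" "2 * Re w * Im w = s * Im w"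
      using arg_cong[OF sp, of Re] arg_cong[OF sp, of Im] by (simp_all add: power2_eq_square)
    then have s: "2 * Re w = s" using im by simp
    then show "w + cnj w = of_int s" by (simp add: complex_eq_iff)
    have "Re w ^ 2 + Im w ^ 2 = p" using r(1) unfolding s[symmetric] by (simp add: power2_eq_square)
    then show "w * cnj w = of_int p" by (simp add: complex_mult_cnj complex_eq_iff)
  qed
  have wd: "(w - cnj w) ^ 2 = of_int (s ^ 2 - 4 * p)"
  proof -
    have "(w - cnj w) ^ 2 = (w + cnj w) ^ 2 - 4 * (w * cnj w)" by (simp add: power2_eq_square algebra_simps)
    then show ?thesis unfolding wc by simp
  qed
  have main: "field_trace R (h a) (h b) (h a \<otimes>\<^bsub>R\<^esub> h a) * field_trace R (h a) (h b) (h b \<otimes>\<^bsub>R\<^esub> h b)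
       - field_trace R (h a) (h b) (h a \<otimes>\<^bsub>R\<^esub> h b) * field_trace R (h a) (h b) (h b \<otimes>\<^bsub>R\<^esub> h a) = s ^ 2 - 4 * p"
    if ab: "Zbasis a b" for a b
  proof -
    have abM: "a \<in> M" "b \<in> M" using ab by (auto simp: Zbasis_def)
    obtain a1 a2 b1 b2 where e: "a = of_int a1 + of_int a2 * w" "b = of_int b1 + of_int b2 * w"
      using abM w by auto
    define \<delta> where "\<delta> = a * cnj b - cnj a * b"
    have d: "\<delta> = of_int (a1 * b2 - a2 * b1) * (cnj w - w)"
      unfolding \<delta>_def e by (simp add: algebra_simps)
    \<comment> \<open>Expanding 1 and \<open>w\<close> in the basis \<open>a\<close>,
      \<open>b\<close> inverts the change of basis; the two integer determinants have product 1, so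
      \<open>\<delta>\<close> agrees with \<open>w - cnj w\<close> up to sign.\<close>
    obtain m n where 1: "1 = of_int m * a + of_int n * b" using coords_exist[OF ab M1] by blast
    obtain m' n' where 2: "w = of_int m' * a + of_int n' * b" using coords_exist[OF ab wM] by blast
    have c1: "1 = of_int m * cnj a + of_int n * cnj b" using arg_cong[OF 1, of cnj] by simp
    have c2: "cnj w = of_int m' * cnj a + of_int n' * cnj b" using arg_cong[OF 2, of cnj] by simp
    have "cnj w - w = 1 * cnj w - 1 * w" by simp
    also have "\<dots> = (of_int m * a + of_int n * b) * (of_int m' * cnj a + of_int n' * cnj b) - (of_int m * cnj a + of_int n * cnj b) * (of_int m' * a + of_int n' * b)"
      using 1 2 c1 c2 by metis
    also have "\<dots> = of_int (m * n' - n * m') * \<delta>" unfolding \<delta>_def by (simp add: algebra_simps)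
    finally have "cnj w - w = of_int (m * n' - n * m') * (of_int (a1 * b2 - a2 * b1) * (cnj w - w))" unfolding d .
    then have "of_int ((m * n' - n * m') * (a1 * b2 - a2 * b1)) * (cnj w - w) = 1 * (cnj w - w)" by (simp add: mult.assoc)
    moreover have cw: "cnj w - w \<noteq> 0" using im by (simp add: complex_eq_iff)
    ultimately have "(of_int ((m * n' - n * m') * (a1 * b2 - a2 * b1)) :: complex) = of_int 1"
      by (simp only: mult_cancel_right of_int_1) simp
    then have un: "(m * n' - n * m') * (a1 * b2 - a2 * b1) = 1" by (simp only: of_int_eq_iff)
    then have "(a1 * b2 - a2 * b1) ^ 2 = 1" by (auto simp: zmult_eq_1_iff power2_eq_square)
    then have d2: "\<delta> ^ 2 = (w - cnj w) ^ 2"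
      unfolding d power_mult_distrib of_int_power[symmetric] by (simp add: power2_commute)
    have nz: "\<delta> \<noteq> 0" using d2 cw by auto
    note tr = trace_eq[OF ab _ nz[unfolded \<delta>_def]]
    have "(of_int (field_trace R (h a) (h b) (h a \<otimes>\<^bsub>R\<^esub> h a) * field_trace R (h a) (h b) (h b \<otimes>\<^bsub>R\<^esub> h b)
       - field_trace R (h a) (h b) (h a \<otimes>\<^bsub>R\<^esub> h b) * field_trace R (h a) (h b) (h b \<otimes>\<^bsub>R\<^esub> h a)) :: complex)
       = (a * a + cnj (a * a)) * (b * b + cnj (b * b)) - (a * b + cnj (a * b)) * (b * a + cnj (b * a))"
      by (simp add: hmult abM tr Mmult del: complex_cnj_mult)
    also have "\<dots> = \<delta> ^ 2" unfolding \<delta>_def by (simp add: power2_eq_square algebra_simps)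
    finally show ?thesis unfolding d2 wd by (simp only: of_int_eq_iff)
  qed
  show ?thesis
    unfolding discr_def
  proof (rule the_equality)
    show "\<exists>a b. int_basis R a b \<and>
     s ^ 2 - 4 * p = field_trace R a b (a \<otimes>\<^bsub>R\<^esub> a) * field_trace R a b (b \<otimes>\<^bsub>R\<^esub> b)
       - field_trace R a b (a \<otimes>\<^bsub>R\<^esub> b) * field_trace R a b (b \<otimes>\<^bsub>R\<^esub> a)"
      using int_basis_iff[OF M1 wM] basis main[OF basis] by (intro exI[of _ "h 1"] exI[of _ "h w"]) simp
  next
    fix D assume "\<exists>a b. int_basis R a b \<and>
     D = field_trace R a b (a \<otimes>\<^bsub>R\<^esub> a) * field_trace R a b (b \<otimes>\<^bsub>R\<^esub> b)
       - field_trace R a b (a \<otimes>\<^bsub>R\<^esub> b) * field_trace R a b (b \<otimes>\<^bsub>R\<^esub> a)"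
    then obtain a' b' where D: "int_basis R a' b'" 
     "D = field_trace R a' b' (a' \<otimes>\<^bsub>R\<^esub> a') * field_trace R a' b' (b' \<otimes>\<^bsub>R\<^esub> b')
       - field_trace R a' b' (a' \<otimes>\<^bsub>R\<^esub> b') * field_trace R a' b' (b' \<otimes>\<^bsub>R\<^esub> a')" by blast
    then obtain a b where ab: "a \<in> M" "b \<in> M" "a' = h a" "b' = h b"
      using car by (auto simp: int_basis_def)
    then have "Zbasis a b" using D int_basis_iff by simp
    then show "D = s ^ 2 - 4 * p" using D(2) main ab by simp
  qed
qed

end

section \<open>Complex multiplication of lattices with a quadratic ratio\<close>

context wp
begin

lemma End_iso: "subring_iso (End_ring EC) Mult hom_map"
  by unfold_locales (use carrier_End hom_map_inj Mult_closed End_ops in auto)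

lemma has_cm_iff: "has_cm EC \<longleftrightarrow> (\<exists>\<alpha>\<in>Mult. \<forall>n::int. \<alpha> \<noteq> of_int n)"
proof -
  interpret I: subring_iso "End_ring EC" Mult hom_map by (rule End_iso)
  have "[n] \<cdot>\<^bsub>End_ring EC\<^esub> \<one>\<^bsub>End_ring EC\<^esub> = hom_map (of_int n)" "of_int n \<in> Mult" for n :: int
    using I.add_pow_int[OF I.M1, of n] I.M_of_int[OF I.M1, of n] by (simp_all add: I.h1)
  then show ?thesis unfolding has_cm_def I.car using I.h_eq by auto
qed

lemma Mult_iff: "\<alpha> \<in> Mult \<longleftrightarrow> \<alpha> * w1 \<in> L \<and> \<alpha> * w2 \<in> L"
proof
  assume "\<alpha> * w1 \<in> L \<and> \<alpha> * w2 \<in> L"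
  then have "of_int m * (\<alpha> * w1) + of_int n * (\<alpha> * w2) \<in> L" for m n
    using L_of_int L_add by blast
  moreover have "\<alpha> * (of_int m * w1 + of_int n * w2) = of_int m * (\<alpha> * w1) + of_int n * (\<alpha> * w2)" for m n
    by (simp add: algebra_simps)
  ultimately have "\<alpha> * (of_int m * w1 + of_int n * w2) \<in> L" for m n by simp
  moreover have "\<exists>m n. l = of_int m * w1 + of_int n * w2" if "l \<in> L" for l using that by (auto simp: L_def)
  ultimately show "\<alpha> \<in> Mult" unfolding Mult_def by blast
qed (simp add: Mult_def)

end

lemma Mult_quadratic:
  assumes "wp c (c * t) x y A B" and t: "t ^ 2 = of_int b * t - of_real N"
  shows "wp.Mult c (c * t) = {of_int m + of_int n * t | m n. of_int n * N \<in> \<int>}"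
proof -
  interpret wp c "c * t" x y A B by fact
  have c: "c \<noteq> 0" using w1_nz .
  have im: "Im t \<noteq> 0" using indep c by simp
  have L: "c * z \<in> L \<longleftrightarrow> (\<exists>m n. z = of_int m + of_int n * t)" for z
  proof -
    have "c * z = of_int m * c + of_int n * (c * t) \<longleftrightarrow> z = of_int m + of_int n * t" for m n
    proof -
      have "of_int m * c + of_int n * (c * t) = c * (of_int m + of_int n * t)" by (simp add: algebra_simps)
      then show ?thesis using c by (simp only: mult_cancel_left) simp
    qed
    then show ?thesis by (auto simp: L_def)
  qed
  have "\<alpha> \<in> Mult \<longleftrightarrow> \<alpha> \<in> {of_int m + of_int n * t | m n. of_int n * N \<in> \<int>}" for \<alpha>
  proof -
    have e: "\<alpha> * c = c * \<alpha>" "\<alpha> * (c * t) = c * (\<alpha> * t)" by simp_all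
    have mt: "(\<exists>m' n'. (of_int m + of_int n * t) * t = of_int m' + of_int n' * t) \<longleftrightarrow> of_int n * N \<in> \<int>" for m n
    proof -
      \<comment> \<open>The coefficient of \<open>t\<close> in the product is always an integer, so
        the constant term is the only obstruction.\<close>
      have eq: "(of_int m + of_int n * t) * t = of_real (- (of_int n * N)) + of_int (m + n * b) * t"
      proof -
        have "(of_int m + of_int n * t) * t = of_int m * t + of_int n * t ^ 2"
          by (simp add: power2_eq_square algebra_simps)
        then show ?thesis unfolding t by (simp add: algebra_simps)
      qed
      show ?thesis
      proof
        assume "\<exists>m' n'. (of_int m + of_int n * t) * t = of_int m' + of_int n' * t"
        then obtain m' n' where *: "of_real (- (of_int n * N)) + of_int (m + n * b) * t = of_int m' + of_int n' * t"
          unfolding eq by blast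
        from arg_cong[OF this, of Im] im have "m + n * b = n'"
          by (simp, metis of_int_add of_int_eq_iff of_int_mult)
        with arg_cong[OF *, of Re] have "- (of_int n * N) = of_int m'" by auto
        then show "of_int n * N \<in> \<int>" by (metis Ints_minus Ints_of_int add.inverse_inverse)
      next
        assume "of_int n * N \<in> \<int>"
        then obtain k where "of_int n * N = of_int k" by (auto elim: Ints_cases)
        then show "\<exists>m' n'. (of_int m + of_int n * t) * t = of_int m' + of_int n' * t"
          unfolding eq by (intro exI[of _ "- k"] exI[of _ "m + n * b"]) simp
      qed
    qed
    show ?thesis unfolding Mult_iff e L mem_Collect_eq using mt by metis
  qed
  then show ?thesis by blast
qed

lemma cm_rational:
  assumes "wp c (c * t) x y A B" "t ^ 2 = of_int b * t - of_real N" "has_cm (Weierstrass A B)"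
  shows "N \<in> \<rat>"
proof -
  interpret wp c "c * t" x y A B by fact
  obtain m n where "of_int m + of_int n * t \<noteq> of_int m" "of_int n * N \<in> \<int>"
    using assms(3) unfolding has_cm_iff Mult_quadratic[OF assms(1,2)] by blast
  then obtain k where k: "n \<noteq> 0" "of_int n * N = of_int k" by (auto elim: Ints_cases)
  then have "N = of_int k / of_int n" by (simp add: field_simps)
  then show ?thesis by simp
qed

lemma cm_parity:
  assumes "wp c (c * t) x y A B" "t ^ 2 = of_int b * t - of_real N" "N = of_int p / of_int q" "q > 0" "coprime p q"
  shows "has_cm (Weierstrass A B)" "odd (discr (End_ring (Weierstrass A B))) \<longleftrightarrow> odd (q * b)"
proof -
  interpret wp c "c * t" x y A B by fact
  interpret I: subring_iso "End_ring EC" Mult hom_map by (rule End_iso)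
  have im: "Im t \<noteq> 0" using indep w1_nz by simp
  have int: "of_int n * N \<in> \<int> \<longleftrightarrow> q dvd n" for n
  proof -
    have e: "of_int n * N = of_int (n * p) / of_int q" using assms(3) by simp
    have "of_int n * N \<in> \<int> \<longleftrightarrow> q dvd n * p"
      unfolding e of_int_div_of_int_in_Ints_iff using assms(4) by simp
    also have "\<dots> \<longleftrightarrow> q dvd n" using assms(5) by (simp add: coprime_commute coprime_dvd_mult_left_iff)
    finally show ?thesis .
  qed
  have M: "Mult = {of_int m + of_int n * (of_int q * t) | m n. True}"
    unfolding Mult_quadratic[OF assms(1,2)] int
    by (auto simp: dvd_def) (metis mult.assoc mult.commute of_int_mult)+
  have "(of_int q * t) ^ 2 = of_int q ^ 2 * (of_int b * t - of_real N)"
    unfolding power_mult_distrib assms(2) ..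
  also have "\<dots> = of_int (q * b) * (of_int q * t) - of_int (p * q)"
    using assms(3,4) by (simp add: power2_eq_square algebra_simps)
  finally have d: "discr (End_ring EC) = (q * b) ^ 2 - 4 * (p * q)"
    using im assms(4) by (intro I.discr_eq[OF M]) auto
  then show "odd (discr (End_ring EC)) \<longleftrightarrow> odd (q * b)" by simp
  have "of_int 0 + of_int 1 * (of_int q * t) \<in> Mult" unfolding M by blast
  moreover have "of_int 0 + of_int 1 * (of_int q * t) \<noteq> of_int n" for n
    using im assms(4) by (auto simp: complex_eq_iff)
  ultimately show "has_cm EC" unfolding has_cm_iff by blast
qed

subsection \<open>Weierstrass equations from even functions\<close>

context lattice2
begin

lemma ell_deriv: "ell f \<Longrightarrow> ell (deriv f)"
  unfolding ell_def
proof (intro conjI allI impI)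
  assume f: "f holomorphic_on - L \<and> (\<forall>z l. z \<notin> L \<longrightarrow> l \<in> L \<longrightarrow> f (z + l) = f z)"
  then show "deriv f holomorphic_on - L" by (intro holomorphic_deriv L_open) auto
  fix z l assume z: "z \<notin> L" "l \<in> L"
  have "z + l \<in> - L" using z L_add_iff by simp
  then have "(f has_field_derivative deriv f (z + l)) (at (z + l))"
    using f holomorphic_derivI L_open by blast
  then have "((\<lambda>w. f (w + l)) has_field_derivative deriv f (z + l)) (at z)"
    using DERIV_shift by blast
  then have "(f has_field_derivative deriv f (z + l)) (at z)"
    by (rule has_field_derivative_transform_within_open[OF _ L_open]) (use f z in auto)
  then show "deriv f (z + l) = deriv f z" by (simp add: DERIV_imp_deriv)
qed

lemma deriv_reflect:
  assumes f: "ell f" and r: "\<And>z. z \<notin> L \<Longrightarrow> f (- z) = k * f z" and z: "z \<notin> L"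
  shows "deriv f (- z) = - k * deriv f z"
proof -
  have d: "(f has_field_derivative deriv f w) (at w)" if "w \<notin> L" for w
    using f that L_open holomorphic_derivI unfolding ell_def by blast
  have "((\<lambda>w. f (- w)) has_field_derivative deriv f (- z) * - 1) (at z)"
    by (rule DERIV_chain2[OF d]) (use z L_uminus in \<open>auto intro!: derivative_eq_intros\<close>)
  then have "((\<lambda>w. k * f w) has_field_derivative deriv f (- z) * - 1) (at z)"
    by (rule has_field_derivative_transform_within_open[OF _ L_open]) (use r z in auto)
  moreover have "((\<lambda>w. k * f w) has_field_derivative k * deriv f z) (at z)"
    by (intro DERIV_cmult d z)
  ultimately have "deriv f (- z) * - 1 = k * deriv f z" by (rule DERIV_unique)
  then show ?thesis by (metis minus_equation_iff mult_minus_left mult_minus_right mult.right_neutral)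
qed

text \<open>For \<open>g z = z ^ n * f z\<close>, extended over 0, the product rule gives
  \<open>z ^ Suc n * deriv f z = z * deriv g z - n * g z\<close>.\<close>

lemma ell_deriv_lim:
  assumes f: "ell f" and lim: "((\<lambda>z. z ^ n * f z) \<longlongrightarrow> c) (at 0)"
  shows "((\<lambda>z. z ^ Suc n * deriv f z) \<longlongrightarrow> - of_nat n * c) (at 0)"
proof -
  obtain S where S: "open S" "0 \<in> S" "f holomorphic_on S - {0}" using ell_hol0[OF f] by blast
  define g where "g = (\<lambda>z. if z = 0 then c else z ^ n * f z)"
  have g: "g holomorphic_on S"
    unfolding g_def using S lim by (intro removable_singularity holomorphic_intros) auto
  have "isCont g 0" "isCont (deriv g) 0"
    using g holomorphic_deriv[OF g S(1)] S by (meson continuous_on_eq_continuous_at holomorphic_on_imp_continuous_on)+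
  then have "((\<lambda>z. z * deriv g z - of_nat n * g z) \<longlongrightarrow> 0 * deriv g 0 - of_nat n * g 0) (at 0)"
    by (intro tendsto_intros) (auto simp: isCont_def)
  then have "((\<lambda>z. z * deriv g z - of_nat n * g z) \<longlongrightarrow> - of_nat n * c) (at 0)" by (simp add: g_def)
  then show ?thesis
  proof (rule Lim_transform_eventually)
    have "\<forall>\<^sub>F z in at 0. z \<in> S - {0}" using S eventually_at_in_open by blast
    then show "\<forall>\<^sub>F z in at 0. z * deriv g z - of_nat n * g z = z ^ Suc n * deriv f z"
    proof eventually_elim
      case (elim z)
      have op: "open (S - {0})" using S by (simp add: open_delete)
      have "((\<lambda>z. z ^ n * f z) has_field_derivative (of_nat n * z ^ (n - 1)) * f z + deriv f z * z ^ n) (at z)"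
        using holomorphic_derivI[OF S(3) op elim] by (intro DERIV_mult) (auto intro!: derivative_eq_intros)
      then have "(g has_field_derivative (of_nat n * z ^ (n - 1)) * f z + deriv f z * z ^ n) (at z)"
        by (rule has_field_derivative_transform_within_open[OF _ op elim]) (auto simp: g_def)
      then have "deriv g z = (of_nat n * z ^ (n - 1)) * f z + deriv f z * z ^ n" by (rule DERIV_imp_deriv)
      then show ?case
        using elim by (cases n) (simp_all add: g_def algebra_simps)
    qed
  qed
qed

text \<open>Liouville turns \<open>f'' - 6 f\<^sup>2\<close> into a combination of \<open>f\<close> and a constant.\<close>

lemma wp_of_even:
  assumes f: "ell f" and ev: "\<And>z. z \<notin> L \<Longrightarrow> f (- z) = f z" and lim: "((\<lambda>z. z ^ 2 * f z) \<longlongrightarrow> 1) (at 0)"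
  shows "\<exists>s A B. wp w1 w2 (\<lambda>z. f z - s) (\<lambda>z. deriv f z / 2) A B"
proof -
  define f' where "f' = deriv f"
  define f'' where "f'' = deriv f'"
  have e: "ell f'" "ell f''" unfolding f'_def f''_def by (intro ell_deriv f)+
  have od: "f' (- z) = - f' z" if "z \<notin> L" for z
    using deriv_reflect[OF f, of 1 z] ev that by (simp add: f'_def)
  have ev'': "f'' (- z) = f'' z" if "z \<notin> L" for z
    using deriv_reflect[OF e(1), of "- 1" z] od that by (simp add: f''_def)
  have l3: "((\<lambda>z. z ^ 3 * f' z) \<longlongrightarrow> - 2) (at 0)"
    using ell_deriv_lim[OF f lim] by (simp add: f'_def eval_nat_numeral)
  have l4: "((\<lambda>z. z ^ 4 * f'' z) \<longlongrightarrow> 6) (at 0)"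
    using ell_deriv_lim[OF e(1) l3] by (simp add: f''_def eval_nat_numeral)
  \<comment> \<open>The leading coefficient of \<open>f''\<close> is 6, so the pole of order four
    cancels; order three vanishes by parity. The coefficient \<open>m\<close> of order two is then
    removed by \<open>m * f\<close>.\<close>
  define D1 where "D1 = (\<lambda>z. f'' z - 6 * f z ^ 2)"
  have D1: "ell D1" unfolding D1_def by (intro ell_diff ell_mult ell_const ell_power f e)
  have D1ev: "D1 (- z) = D1 z" if "z \<notin> L" for z using that ev ev'' by (simp add: D1_def)
  have "((\<lambda>z. z ^ 4 * f'' z - 6 * (z ^ 2 * f z) ^ 2) \<longlongrightarrow> 6 - 6 * 1 ^ 2) (at 0)"
    by (intro tendsto_intros l4 lim)
  moreover have "z ^ 4 * f'' z - 6 * (z ^ 2 * f z) ^ 2 = z ^ Suc 3 * D1 z" for z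
    by (simp add: D1_def power_mult_distrib power_mult[symmetric] algebra_simps)
  ultimately have "((\<lambda>z. z ^ Suc 3 * D1 z) \<longlongrightarrow> 0) (at 0)" by simp
  then obtain M where M: "((\<lambda>z. z ^ 3 * D1 z) \<longlongrightarrow> M) (at 0)" using ell_drop[OF D1] by blast
  have "M = 0"
  proof (rule limit_odd_even)
    show "((\<lambda>z. z * (z ^ 2 * D1 z)) \<longlongrightarrow> M) (at 0)" using M by (simp add: power3_eq_cube power2_eq_square mult_ac)
    show "\<forall>\<^sub>F z in at 0. (- z)\<^sup>2 * D1 (- z) = z\<^sup>2 * D1 z"
      using L_ev[of 0] by eventually_elim (simp add: D1ev)
  qed
  then have "((\<lambda>z. z ^ Suc 2 * D1 z) \<longlongrightarrow> 0) (at 0)" using M by (simp add: eval_nat_numeral)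
  then obtain m where m: "((\<lambda>z. z ^ 2 * D1 z) \<longlongrightarrow> m) (at 0)" using ell_drop[OF D1] by blast
  define D2 where "D2 = (\<lambda>z. D1 z - m * f z)"
  have "ell D2" unfolding D2_def by (intro ell_diff ell_mult ell_const D1 f)
  moreover have "D2 (- z) = D2 z" if "z \<notin> L" for z using that D1ev ev by (simp add: D2_def)
  moreover have "((\<lambda>z. z ^ 2 * D2 z) \<longlongrightarrow> 0) (at 0)"
  proof -
    have "((\<lambda>z. z ^ 2 * D1 z - m * (z ^ 2 * f z)) \<longlongrightarrow> m - m * 1) (at 0)"
      by (intro tendsto_intros m lim)
    then show ?thesis by (simp add: D2_def algebra_simps)
  qed
  ultimately obtain k where k: "\<And>z. z \<notin> L \<Longrightarrow> D2 z = k" using ell_even_const by blast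
  \<comment> \<open>Substituting \<open>f = x + s\<close> into \<open>f'' = 6 f^2 + m f + k\<close>,
    this is the shift that removes the linear term.\<close>
  define s where "s = - m / 12"
  define A where "A = (6 * s ^ 2 + m * s + k) / 2"
  define x where "x = (\<lambda>z. f z - s)"
  define y where "y = (\<lambda>z. f' z / 2)"
  have holD: "(g has_field_derivative deriv g z) (at z)" if "ell g" "z \<notin> L" for g z
    using that L_open holomorphic_derivI unfolding ell_def by blast
  have dx: "(x has_field_derivative 2 * y z) (at z)" if "z \<notin> L" for z
    unfolding x_def y_def using holD[OF f that] by (auto intro!: derivative_eq_intros simp: f'_def)
  have dy: "(y has_field_derivative 3 * x z ^ 2 + A) (at z)" if z: "z \<notin> L" for z
  proof -
    have "f'' z = 6 * f z ^ 2 + m * f z + k" using k[OF z] by (simp add: D2_def D1_def algebra_simps)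
    moreover have "m = - 12 * s" by (simp add: s_def)
    ultimately have "f'' z / 2 = 3 * x z ^ 2 + A"
      unfolding x_def A_def by (simp add: power2_eq_square field_simps)
    moreover have "(y has_field_derivative f'' z / 2) (at z)"
      unfolding y_def f''_def by (intro DERIV_cdivide holD e z)
    ultimately show ?thesis by (simp add: add_divide_distrib)
  qed
  define B where "B = y (w1 / 2) ^ 2 - x (w1 / 2) ^ 3 - A * x (w1 / 2)"
  have B: "y z ^ 2 - x z ^ 3 - A * x z = B" if z: "z \<notin> L" for z
    unfolding B_def
  proof (rule DERIV_zero_connected_const[OF L_open L_connected, where f = "\<lambda>z. y z ^ 2 - x z ^ 3 - A * x z"])
    fix w assume "w \<in> - L"
    then have w: "w \<notin> L" by simp
    show "((\<lambda>z. y z ^ 2 - x z ^ 3 - A * x z) has_field_derivative 0) (at w)"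
      by (auto intro!: derivative_eq_intros dx[OF w] dy[OF w] simp: algebra_simps power2_eq_square)
  qed (use z half_notin in auto)
  have "wp w1 w2 x y A B"
  proof
    show "((\<lambda>z. z ^ 2 * x z) \<longlongrightarrow> 1) (at 0)"
    proof -
      have "((\<lambda>z. z ^ 2 * f z - z ^ 2 * s) \<longlongrightarrow> 1 - 0 ^ 2 * s) (at 0)" by (intro tendsto_intros lim)
      then show ?thesis by (simp add: x_def algebra_simps)
    qed
    show "((\<lambda>z. z ^ 3 * y z) \<longlongrightarrow> - 1) (at 0)"
      using tendsto_divide[OF l3 tendsto_const[of 2]] by (simp add: y_def)
    fix z assume z: "z \<notin> L"
    show "y z ^ 2 = x z ^ 3 + A * x z + B" using B[OF z] by (simp add: algebra_simps)
    show "x (- z) = x z" "y (- z) = - y z" using ev[OF z] od[OF z] by (simp_all add: x_def y_def)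
    fix l assume "l \<in> L"
    then show "x (z + l) = x z" "y (z + l) = y z" using f e z by (auto simp: x_def y_def ell_def)
  qed (use dx dy in auto)
  then show ?thesis unfolding x_def y_def f'_def by blast
qed

end

context wp
begin

text \<open>At half periods \<open>y\<close> vanishes, so these are the three distinct roots of the
  cubic, and the formulas are those of Vieta. They express \<open>A\<close> and \<open>B\<close> by
  values of a function that need only be known up to a constant.\<close>

lemma half_values:
  defines "e1 \<equiv> x (w1 / 2)" and "e2 \<equiv> x (w2 / 2)" and "e3 \<equiv> x ((w1 + w2) / 2)"
  shows "e1 \<noteq> e2" "e1 \<noteq> e3" "e2 \<noteq> e3" "e1 + e2 + e3 = 0" "A = e1 * e2 + e2 * e3 + e3 * e1" "B = - (e1 * e2 * e3)"
proof -
  have m: "w1 / 2 - (w1 + w2) / 2 = - (w2 / 2)" "w1 / 2 + (w1 + w2) / 2 = w1 + w2 / 2"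
    "w2 / 2 - (w1 + w2) / 2 = - (w1 / 2)" "w2 / 2 + (w1 + w2) / 2 = w1 / 2 + w2" "w1 / 2 + w2 / 2 = (w1 + w2) / 2"
    by (simp_all add: field_simps)
  have "- (w2 / 2) \<notin> L" "w1 + w2 / 2 \<notin> L" "- (w1 / 2) \<notin> L" "w1 / 2 + w2 \<notin> L"
    using half_notin L_uminus L_add_iff w1_L w2_L by blast+
  then show ne: "e1 \<noteq> e2" "e1 \<noteq> e3" "e2 \<noteq> e3"
    unfolding e1_def e2_def e3_def using x_eq_iff half_notin m by metis+
  have root: "x a ^ 3 + A * x a + B = 0" if "a \<notin> L" "a + a \<in> L" for a
    using eqn[OF that(1)] y_zero_iff[OF that(1)] that(2) by (simp flip: mult_2)
  have r: "e1 ^ 3 + A * e1 + B = 0" "e2 ^ 3 + A * e2 + B = 0" "e3 ^ 3 + A * e3 + B = 0"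
    unfolding e1_def e2_def e3_def using half_notin L_add[OF w1_L w2_L] by (intro root; simp)+
  have q: "a ^ 2 + a * b + b ^ 2 + A = 0" if "a ^ 3 + A * a + B = 0" "b ^ 3 + A * b + B = 0" "a \<noteq> b" for a b
  proof -
    have "(a - b) * (a ^ 2 + a * b + b ^ 2 + A) = (a ^ 3 + A * a + B) - (b ^ 3 + A * b + B)"
      by (simp add: power2_eq_square power3_eq_cube algebra_simps)
    then show ?thesis using that by simp
  qed
  have "(e2 - e3) * (e1 + e2 + e3) = (e1 ^ 2 + e1 * e2 + e2 ^ 2 + A) - (e1 ^ 2 + e1 * e3 + e3 ^ 2 + A)"
    by (simp add: power2_eq_square algebra_simps)
  then show s: "e1 + e2 + e3 = 0" using q[OF r(1,2) ne(1)] q[OF r(1,3) ne(2)] ne by simp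
  then have e3: "e3 = - e1 - e2" by (simp add: algebra_simps eq_neg_iff_add_eq_0)
  have "A = - (e1 ^ 2 + e1 * e2 + e2 ^ 2)" using q[OF r(1,2) ne(1)] by (simp add: eq_neg_iff_add_eq_0 algebra_simps)
  then show A: "A = e1 * e2 + e2 * e3 + e3 * e1" unfolding e3 by (simp add: power2_eq_square algebra_simps)
  have "B = - (e1 ^ 3 + A * e1)" using r(1) by (simp add: eq_neg_iff_add_eq_0 algebra_simps)
  then show "B = - (e1 * e2 * e3)" unfolding A e3 by (simp add: power2_eq_square power3_eq_cube algebra_simps)
qed

text \<open>Conjugating the equation at \<open>cnj z\<close> gives a second one at \<open>z\<close>;
  the difference is linear in \<open>x z\<close>, which takes all values.\<close>

lemma real_coeffs:
  assumes "cnj_sym"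
  shows "A \<in> \<real>" "B \<in> \<real>"
proof -
  have c: "(A - cnj A) * x z + (B - cnj B) = 0" if z: "z \<notin> L" for z
  proof -
    have z': "cnj z \<notin> L" "x (cnj z) = cnj (x z)" "y (cnj z) = cnj (y z)"
      using assms z unfolding cnj_sym_def by blast+
    have "cnj (y (cnj z) ^ 2) = cnj (x (cnj z) ^ 3 + A * x (cnj z) + B)" using eqn[OF z'(1)] by simp
    then have "y z ^ 2 = x z ^ 3 + cnj A * x z + cnj B" using z' by simp
    then show ?thesis using eqn[OF z] by (simp add: algebra_simps)
  qed
  obtain a b where ab: "a \<notin> L" "x a = 0" "b \<notin> L" "x b = 1" using x_surj by meson
  have "B = cnj B" using c[OF ab(1)] ab by simp
  moreover have "A = cnj A" using c[OF ab(3)] ab \<open>B = cnj B\<close> by simp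
  ultimately show "A \<in> \<real>" "B \<in> \<real>" by (metis Reals_cnj_iff)+
qed

end

subsection \<open>Construction by nome series\<close>

text \<open>The Koebe function enters through \<open>- 4 koebe (exp (2 \<pi> i z)) = 1 / sin\<^sup>2 (\<pi> z)\<close>.\<close>

definition koebe :: "complex \<Rightarrow> complex" where "koebe w = w / (1 - w) ^ 2"

definition koebe_exp :: "complex \<Rightarrow> complex" where "koebe_exp z = koebe (exp (2 * of_real pi * \<i> * z))"

lemma koebe_inverse: "koebe (1 / w) = koebe w"
proof (cases "w = 0 \<or> w = 1")
  case False
  then have w: "w \<noteq> 0" "1 - w \<noteq> 0" by auto
  have "(1 - 1 / w) ^ 2 * w ^ 2 = (1 - w) ^ 2"
    unfolding power_mult_distrib[symmetric] using w by (simp add: algebra_simps power2_commute)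
  then have "koebe (1 / w) = (1 / w) / ((1 - w) ^ 2 / w ^ 2)" using w by (simp add: koebe_def field_simps)
  then show ?thesis using w by (simp add: koebe_def power2_eq_square)
qed (auto simp: koebe_def)

lemma norm_koebe: "norm w < 1 \<Longrightarrow> norm (koebe w) \<le> norm w / (1 - norm w) ^ 2"
proof -
  assume w: "norm w < 1"
  have "1 - norm w \<le> norm (1 - w)" by (metis norm_one norm_triangle_ineq2)
  then have "(1 - norm w) ^ 2 \<le> norm (1 - w) ^ 2" using w by (intro power_mono) auto
  then show ?thesis unfolding koebe_def norm_divide norm_power using w
    by (intro divide_left_mono mult_pos_pos zero_less_power) (auto intro!: mult_pos_pos)
qed

lemma koebe_exp_1: "koebe_exp (z + 1) = koebe_exp z"
  by (simp add: koebe_exp_def ring_distribs exp_add)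

lemma koebe_exp_uminus: "koebe_exp (- z) = koebe_exp z"
  using koebe_inverse[of "exp (2 * of_real pi * \<i> * z)"] by (simp add: koebe_exp_def exp_minus inverse_eq_divide)

lemma koebe_exp_cnj: "cnj (koebe_exp z) = koebe_exp (cnj z)"
proof -
  have "cnj (koebe_exp z) = koebe_exp (- cnj z)" by (simp add: koebe_exp_def koebe_def exp_cnj)
  then show ?thesis by (simp add: koebe_exp_uminus)
qed

lemma koebe_exp_of_int: "koebe_exp (z + of_int n) = koebe_exp z"
proof -
  have "exp (2 * of_real pi * \<i> * of_int n) = 1"
    using exp_integer_2pi[of "of_int n"] by (simp add: mult_ac)
  then show ?thesis by (simp add: koebe_exp_def distrib_left exp_add)
qed

lemma exp_eq_1_int: "exp (2 * of_real pi * \<i> * z) = 1 \<Longrightarrow> z \<in> \<int>"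
proof -
  assume "exp (2 * of_real pi * \<i> * z) = 1"
  then obtain n :: int where "Re (2 * of_real pi * \<i> * z) = 0" "Im (2 * of_real pi * \<i> * z) = of_int (2 * n) * pi"
    using exp_eq_1 by blast
  then have "z = of_int n" by (simp add: complex_eq_iff)
  then show ?thesis by simp
qed

lemma koebe_exp_lim: "((\<lambda>z. z ^ 2 * koebe_exp z) \<longlongrightarrow> - 1 / (4 * of_real pi ^ 2)) (at 0)"
proof -
  let ?e = "\<lambda>z. exp (2 * of_real pi * \<i> * z)"
  have "(?e has_field_derivative 2 * of_real pi * \<i>) (at 0)"
    by (auto intro!: derivative_eq_intros)
  then have d: "((\<lambda>z. (?e z - 1) / z) \<longlongrightarrow> 2 * of_real pi * \<i>) (at 0)"
    by (simp add: has_field_derivative_iff)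
  have c: "(?e \<longlongrightarrow> 1) (at 0)"
    by (rule tendsto_eq_rhs[OF tendsto_exp[OF tendsto_mult[OF tendsto_const tendsto_ident_at]]]) simp
  have "((\<lambda>z. ?e z / ((?e z - 1) / z) ^ 2) \<longlongrightarrow> 1 / (2 * of_real pi * \<i>) ^ 2) (at 0)"
    by (intro tendsto_intros c d) auto
  then have "((\<lambda>z. ?e z / ((?e z - 1) / z) ^ 2) \<longlongrightarrow> - 1 / (4 * of_real pi ^ 2)) (at 0)"
    by (simp add: power_mult_distrib)
  then show ?thesis
    by (rule Lim_transform_eventually)
       (auto simp: eventually_at_filter koebe_exp_def koebe_def power_divide power2_commute)
qed

section \<open>The elliptic function of the lattice spanned by 1 and \<open>t\<close>\<close>

locale half_plane =
  fixes t :: complex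
  assumes im: "Im t > 0"
begin

sublocale lattice2 1 t by unfold_locales (use im in simp)

definition r :: real where "r = exp (- 2 * pi * Im t)"

lemma r01: "0 < r" "r < 1" using im by (auto simp: r_def)

text \<open>A geometric majorant, uniform on half planes. It starts at an index from which the
  exponentials have norm below 1/2; the finitely many earlier terms may be near a pole.\<close>

lemma term_bound: "\<exists>N. \<forall>n\<ge>N. \<forall>z. Im z \<ge> - M \<longrightarrow> norm (koebe_exp (z + of_nat n * t)) \<le> 4 * exp (2 * pi * M) * r ^ n"
proof -
  have "(\<lambda>n. exp (2 * pi * M) * r ^ n) \<longlonglongrightarrow> exp (2 * pi * M) * 0"
    using r01 by (intro tendsto_intros LIMSEQ_power_zero) auto
  then have "\<forall>\<^sub>F n in sequentially. exp (2 * pi * M) * r ^ n < 1 / 2"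
    by (rule order_tendstoD) simp
  then obtain N where N: "\<And>n. n \<ge> N \<Longrightarrow> exp (2 * pi * M) * r ^ n < 1 / 2"
    by (auto simp: eventually_sequentially)
  have "norm (koebe_exp (z + of_nat n * t)) \<le> 4 * exp (2 * pi * M) * r ^ n" if n: "n \<ge> N" and z: "Im z \<ge> - M" for n z
  proof -
    define w where "w = exp (2 * of_real pi * \<i> * (z + of_nat n * t))"
    have "norm w = exp (- 2 * pi * (Im z + n * Im t))"
      by (simp add: w_def norm_exp_eq_Re)
    also have "\<dots> \<le> exp (2 * pi * M + n * (- 2 * pi * Im t))"
      using mult_left_mono[OF z, of pi] by (auto simp: algebra_simps)
    also have "\<dots> = exp (2 * pi * M) * r ^ n"
      unfolding exp_add r_def exp_of_nat_mult[symmetric] ..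
    finally have w: "norm w \<le> exp (2 * pi * M) * r ^ n" .
    have w2: "norm w < 1 / 2" using w N[OF n] by simp
    have "norm (koebe_exp (z + of_nat n * t)) \<le> norm w / (1 - norm w) ^ 2"
      unfolding koebe_exp_def w_def[symmetric] using w2 by (intro norm_koebe) simp
    also have "\<dots> \<le> norm w / (1 / 2) ^ 2"
      using w2 by (intro divide_left_mono power_mono) auto
    also have "\<dots> \<le> 4 * exp (2 * pi * M) * r ^ n" using w by (simp add: power2_eq_square)
    finally show ?thesis .
  qed
  then show ?thesis by blast
qed

definition P :: "complex \<Rightarrow> complex" where "P z = (\<Sum>n. koebe_exp (z + of_nat n * t))"

lemma summable_r: "summable (\<lambda>n. c * r ^ n)"
  using r01 by (intro summable_mult summable_geometric) auto

lemma summable_P: "summable (\<lambda>n. koebe_exp (z + of_nat n * t))"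
proof -
  obtain N where "\<And>n. n \<ge> N \<Longrightarrow> norm (koebe_exp (z + of_nat n * t)) \<le> 4 * exp (2 * pi * (- Im z)) * r ^ n"
    using term_bound[of "- Im z"] by auto
  then show ?thesis
    by (intro summable_comparison_test_ev[OF _ summable_r]) (auto simp: eventually_sequentially)
qed

lemma P_hol:
  assumes S: "open S" and ne: "\<And>z n. z \<in> S \<Longrightarrow> exp (2 * of_real pi * \<i> * (z + of_nat n * t)) \<noteq> 1"
  shows "P holomorphic_on S"
proof (rule holomorphic_uniform_sequence[OF S])
  have ne': "(1 - exp (2 * of_real pi * \<i> * (z + of_nat n * t))) ^ 2 \<noteq> 0" if "z \<in> S" for z n
    using ne[OF that, of n] by simp
  show "(\<lambda>z. \<Sum>i<n. koebe_exp (z + of_nat i * t)) holomorphic_on S" for n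
    unfolding koebe_exp_def koebe_def by (intro holomorphic_intros ne')
  fix x assume "x \<in> S"
  then obtain d where d: "d > 0" "cball x d \<subseteq> S" using S open_contains_cball by blast
  have im: "Im z \<ge> - (\<bar>Im x\<bar> + d)" if "z \<in> cball x d" for z
    using that abs_Im_le_cmod[of "x - z"] by (auto simp: dist_norm)
  obtain N where "\<And>n z. n \<ge> N \<Longrightarrow> Im z \<ge> - (\<bar>Im x\<bar> + d) \<Longrightarrow> norm (koebe_exp (z + of_nat n * t)) \<le> 4 * exp (2 * pi * (\<bar>Im x\<bar> + d)) * r ^ n"
    using term_bound[of "\<bar>Im x\<bar> + d"] by blast
  then have "\<forall>\<^sub>F n in sequentially. \<forall>z\<in>cball x d. norm (koebe_exp (z + of_nat n * t)) \<le> 4 * exp (2 * pi * (\<bar>Im x\<bar> + d)) * r ^ n"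
    unfolding eventually_sequentially using im by blast
  then have "uniform_limit (cball x d) (\<lambda>n z. \<Sum>i<n. koebe_exp (z + of_nat i * t)) P sequentially"
    unfolding P_def by (intro Weierstrass_m_test_ev[OF _ summable_r])
  then show "\<exists>d>0. cball x d \<subseteq> S \<and> uniform_limit (cball x d) (\<lambda>n z. \<Sum>i<n. koebe_exp (z + of_nat i * t)) P sequentially"
    using d by blast
qed

lemma P_shift: "P z = koebe_exp z + P (z + t)"
  using suminf_split_head[OF summable_P[of z]] by (simp add: P_def algebra_simps)

lemma P_1: "P (z + 1) = P z"
proof -
  have "koebe_exp (z + 1 + of_nat n * t) = koebe_exp (z + of_nat n * t)" for n
    using koebe_exp_1[of "z + of_nat n * t"] by (simp add: algebra_simps)
  then show ?thesis by (simp add: P_def)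
qed

text \<open>The sum of \<open>pi^2 / sin^2 (pi (z + n t))\<close> over all integers
  \<open>n\<close>, which is the Weierstrass function up to a constant. The term
  \<open>n = 0\<close> belongs to both halves \<open>P z\<close> and \<open>P (- z)\<close> and is
  subtracted once.\<close>

definition F :: "complex \<Rightarrow> complex" where "F z = - 4 * of_real pi ^ 2 * (P z + P (- z) - koebe_exp z)"

lemma F_even: "F (- z) = F z" by (simp add: F_def koebe_exp_uminus)

lemma F_1: "F (z + 1) = F z"
proof -
  have "P (- z) = P (- (z + 1))" using P_1[of "- (z + 1)"] by simp
  then show ?thesis unfolding F_def P_1 koebe_exp_1 by simp
qed

lemma F_t: "F (z + t) = F z"
proof -
  have "P (- (z + t)) = koebe_exp (z + t) + P (- z)"
    using P_shift[of "- (z + t)"] koebe_exp_uminus[of "z + t"] by (simp add: algebra_simps)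
  then show ?thesis unfolding F_def P_shift[of z] by simp
qed

lemma F_L: "l \<in> L \<Longrightarrow> F (z + l) = F z"
proof -
  assume "l \<in> L"
  then obtain m n where l: "l = of_int m * 1 + of_int n * t" unfolding L_def by blast
  have per: "F (z + of_int m * w) = F z" if "\<And>z. F (z + w) = F z" for z w and m :: int
  proof -
    have nat: "F (z + of_nat k * w) = F z" for k z
      by (induction k arbitrary: z) (use that in \<open>auto simp: distrib_right add.assoc[symmetric]\<close>)
    show ?thesis
    proof (cases "m \<ge> 0")
      case True
      then show ?thesis using nat[of z "nat m"] by simp
    next
      case False
      then show ?thesis using nat[of "z + of_int m * w" "nat (- m)"] by (simp add: algebra_simps)
    qed
  qed
  show ?thesis
    unfolding l using per[OF F_t, of "z + of_int m" n] per[OF F_1, of z m] by (simp add: add.assoc)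
qed

lemma P_hol_L: "P holomorphic_on - L"
proof (rule P_hol[OF L_open])
  fix z n assume "z \<in> - L"
  show "exp (2 * of_real pi * \<i> * (z + of_nat n * t)) \<noteq> 1"
  proof
    assume "exp (2 * of_real pi * \<i> * (z + of_nat n * t)) = 1"
    then obtain m where "z + of_nat n * t = of_int m" using exp_eq_1_int by (auto elim: Ints_cases)
    then have "z = of_int m * 1 + of_int (- int n) * t" by (simp add: algebra_simps)
    then show False using \<open>z \<in> - L\<close> L_I[of m "- int n"] by simp
  qed
qed

lemma P_hol_upper: "P holomorphic_on {z. Im z > 0}"
proof (rule P_hol)
  show "open {z. Im z > 0}" by (rule open_halfspace_Im_gt)
  fix z n assume "z \<in> {z. Im z > 0}"
  then have "Im (z + of_nat n * t) > 0" using im by (simp add: add_pos_nonneg)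
  then show "exp (2 * of_real pi * \<i> * (z + of_nat n * t)) \<noteq> 1"
    using exp_eq_1_int by (metis Ints_cases complex_Im_of_int less_irrefl)
qed

lemma koebe_exp_hol: "koebe_exp holomorphic_on - L"
proof -
  have "(1 - exp (2 * of_real pi * \<i> * z)) ^ 2 \<noteq> 0" if z: "z \<in> - L" for z
  proof
    assume "(1 - exp (2 * of_real pi * \<i> * z)) ^ 2 = 0"
    then have "exp (2 * of_real pi * \<i> * z) = 1" by simp
    then have "z \<in> \<int>" by (rule exp_eq_1_int)
    then obtain m where "z = of_int m" by (auto elim: Ints_cases)
    then show False using z L_I[of m 0] by simp
  qed
  then show ?thesis unfolding koebe_exp_def koebe_def by (intro holomorphic_intros)
qed

lemma F_ell: "ell F"
proof -
  have "(\<lambda>z. P (- z)) holomorphic_on - L"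
    by (rule holomorphic_on_compose_gen[of uminus _ P "- L", unfolded o_def])
      (auto intro!: holomorphic_intros P_hol_L simp: L_uminus)
  then have "F holomorphic_on - L" unfolding F_def by (intro holomorphic_intros P_hol_L koebe_exp_hol)
  then show ?thesis using F_L by (simp add: ell_def)
qed

lemma F_lim: "((\<lambda>z. z ^ 2 * F z) \<longlongrightarrow> 1) (at 0)"
proof -
  \<comment> \<open>Separates the only term that is singular at 0; the others are sums at arguments
    in the upper half plane.\<close>
  have F: "F z = - 4 * of_real pi ^ 2 * (koebe_exp z + (P (z + t) + P (t - z)))" for z
    using P_shift[of "- z"] P_shift[of z] by (simp add: F_def koebe_exp_uminus algebra_simps)
  have "isCont P t"
    using P_hol_upper im open_halfspace_Im_gt[of 0]
    by (metis continuous_on_eq_continuous_at holomorphic_on_imp_continuous_on mem_Collect_eq)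
  moreover have "((\<lambda>z. z + t) \<longlongrightarrow> t) (at 0)" "((\<lambda>z. t - z) \<longlongrightarrow> t) (at 0)"
    by (auto intro!: tendsto_eq_intros)
  ultimately have c: "((\<lambda>z. P (z + t)) \<longlongrightarrow> P t) (at 0)" "((\<lambda>z. P (t - z)) \<longlongrightarrow> P t) (at 0)"
    using isCont_tendsto_compose by blast+
  have "((\<lambda>z. - 4 * of_real pi ^ 2 * (z ^ 2 * koebe_exp z + z ^ 2 * (P (z + t) + P (t - z)))) \<longlongrightarrow>
     - 4 * of_real pi ^ 2 * (- 1 / (4 * of_real pi ^ 2) + 0 ^ 2 * (P t + P t))) (at 0)"
    by (intro tendsto_intros c koebe_exp_lim)
  then show ?thesis by (simp add: F algebra_simps)
qed

end

definition koebe_series :: "complex \<Rightarrow> complex \<Rightarrow> complex" where "koebe_series u p = (\<Sum>n. koebe (u * p ^ (2 * n)))"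

text \<open>The values of \<open>F\<close> at the half periods, as functions of the nome \<open>p = exp (\<pi> i t)\<close>; they extend
  continuously to \<open>p = 0\<close>, the cusp.\<close>

definition E1 :: "complex \<Rightarrow> complex" where "E1 p = - 4 * of_real pi ^ 2 * (2 * koebe_series (- 1) p - koebe (- 1))"
definition E2 :: "complex \<Rightarrow> complex" where "E2 p = - 4 * of_real pi ^ 2 * (2 * koebe_series p p)"
definition E3 :: "complex \<Rightarrow> complex" where "E3 p = - 4 * of_real pi ^ 2 * (2 * koebe_series (- p) p)"
text \<open>The constant by which \<open>F\<close> exceeds \<open>x\<close>: the roots of the cubic
  sum to 0, so it is the mean of the three values at half periods.\<close>

definition E_mean :: "complex \<Rightarrow> complex" where "E_mean p = (E1 p + E2 p + E3 p) / 3"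
definition nome_A :: "complex \<Rightarrow> complex" where
  "nome_A p = (E1 p - E_mean p) * (E2 p - E_mean p) + (E2 p - E_mean p) * (E3 p - E_mean p) + (E3 p - E_mean p) * (E1 p - E_mean p)"
definition nome_B :: "complex \<Rightarrow> complex" where
  "nome_B p = - ((E1 p - E_mean p) * (E2 p - E_mean p) * (E3 p - E_mean p))"

context half_plane
begin

definition p :: complex where "p = exp (\<i> * of_real pi * t)"

lemma P_koebe_series: "P z = koebe_series (exp (2 * of_real pi * \<i> * z)) p"
proof -
  have "exp (2 * of_real pi * \<i> * (z + of_nat n * t)) = exp (2 * of_real pi * \<i> * z) * p ^ (2 * n)" for n
    by (simp add: p_def exp_of_nat_mult[symmetric] exp_add[symmetric] algebra_simps)
  then show ?thesis by (simp add: P_def koebe_series_def koebe_exp_def)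
qed

lemma F_half: "F (1 / 2) = E1 p" "F (t / 2) = E2 p" "F ((1 + t) / 2) = E3 p"
proof -
  have e1: "exp (2 * of_real pi * \<i> * (1 / 2)) = - 1" by (simp add: mult_ac)
  have e2: "exp (2 * of_real pi * \<i> * (t / 2)) = p" by (simp add: p_def mult_ac)
  have e3: "exp (2 * of_real pi * \<i> * ((1 + t) / 2)) = - p"
  proof -
    have "2 * of_real pi * \<i> * ((1 + t) / 2) = 2 * of_real pi * \<i> * (1 / 2) + 2 * of_real pi * \<i> * (t / 2)"
      by (simp add: field_simps)
    then show ?thesis by (simp only: exp_add e1 e2) simp
  qed
  \<comment> \<open>Here the two arguments differ by the period 1 of \<open>P\<close>, so the
    doubled term remains in \<open>E1\<close>. At the other two half periods the shift by
    \<open>t\<close> produces exactly the term that \<open>F\<close> subtracts.\<close>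
  have h1: "P (- (1 / 2)) = P (1 / 2)" using P_1[of "- (1 / 2)"] by simp
  have h2: "koebe_exp (1 / 2) = koebe (- 1)" unfolding koebe_exp_def e1 ..
  have h3: "P (1 / 2) = koebe_series (- 1) p" unfolding P_koebe_series e1 ..
  show "F (1 / 2) = E1 p" unfolding F_def E1_def h1 h2 h3 by simp
  have h: "t / 2 + t / 2 = t" by simp
  have "P (- (t / 2)) = koebe_exp (t / 2) + P (t / 2)"
    using P_shift[of "- (t / 2)"] koebe_exp_uminus[of "t / 2"] by simp
  then have "F (t / 2) = - 4 * of_real pi ^ 2 * (2 * P (t / 2))" by (simp add: F_def)
  then show "F (t / 2) = E2 p" unfolding P_koebe_series e2 E2_def .
  have h4: "- ((1 + t) / 2) + t + 1 = (1 + t) / 2" by (simp add: field_simps)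
  have "P (- ((1 + t) / 2)) = koebe_exp ((1 + t) / 2) + P ((1 + t) / 2)"
    using P_shift[of "- ((1 + t) / 2)"] P_1[of "- ((1 + t) / 2) + t"] unfolding koebe_exp_uminus h4 by (simp only:)
  then have "F ((1 + t) / 2) = - 4 * of_real pi ^ 2 * (2 * P ((1 + t) / 2))" by (simp add: F_def)
  then show "F ((1 + t) / 2) = E3 p" unfolding P_koebe_series e3 E3_def .
qed

text \<open>The existence lemma \<open>wp_of_even\<close> leaves the shift and the coefficients
  unspecified; the values at half periods pin them down.\<close>

lemma wp_q: "wp 1 t (\<lambda>z. F z - E_mean p) (\<lambda>z. deriv F z / 2) (nome_A p) (nome_B p)"
proof -
  obtain s A B where w: "wp 1 t (\<lambda>z. F z - s) (\<lambda>z. deriv F z / 2) A B"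
    using wp_of_even[OF F_ell F_even F_lim] by blast
  then interpret W: wp 1 t "\<lambda>z. F z - s" "\<lambda>z. deriv F z / 2" A B .
  have "(E1 p - s) + (E2 p - s) + (E3 p - s) = 0" using W.half_values(4) by (simp add: F_half)
  then have s: "s = E_mean p" by (simp add: E_mean_def field_simps)
  have "A = nome_A p" "B = nome_B p" using W.half_values(5,6) by (simp_all add: F_half s nome_A_def nome_B_def)
  then show ?thesis using w s by simp
qed

text \<open>Here \<open>cnj t = b - t\<close>, so conjugation reverses the \<open>t\<close>-part up
  to integers. As \<open>koebe_exp\<close> is even with period 1, the series \<open>P\<close> at
  \<open>z\<close> becomes the one at \<open>- cnj z\<close>.\<close>

lemma wp_q_sym:
  assumes b: "2 * Re t = of_int b" "b = 0 \<or> b = 1"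
  shows "wp.cnj_sym 1 t (\<lambda>z. F z - E_mean p) (\<lambda>z. deriv F z / 2)"
proof -
  interpret W: wp 1 t "\<lambda>z. F z - E_mean p" "\<lambda>z. deriv F z / 2" "nome_A p" "nome_B p" by (rule wp_q)
  have ct: "cnj t = of_int b - t" using b by (simp add: complex_eq_iff)
  have Pc: "cnj (P z) = P (- cnj z)" for z
  proof -
    have "cnj (koebe_exp (z + of_nat n * t)) = koebe_exp (- cnj z + of_nat n * t)" for n
    proof -
      have "cnj (koebe_exp (z + of_nat n * t)) = koebe_exp (- (- cnj z + of_nat n * t) + of_int (int n * b))"
        unfolding koebe_exp_cnj by (simp add: ct algebra_simps)
      then show ?thesis unfolding koebe_exp_of_int koebe_exp_uminus .
    qed
    then have "(\<lambda>n. cnj (koebe_exp (z + of_nat n * t))) sums P (- cnj z)"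
      using summable_sums[OF summable_P[of "- cnj z"]] by (simp add: P_def)
    moreover have "(\<lambda>n. cnj (koebe_exp (z + of_nat n * t))) sums cnj (P z)"
      unfolding sums_cnj P_def by (intro summable_sums summable_P)
    ultimately show ?thesis using sums_unique2 by blast
  qed
  have Fc: "F (cnj z) = cnj (F z)" for z
    by (simp add: F_def Pc koebe_exp_cnj)
  \<comment> \<open>Conjugation fixes both values if \<open>b = 0\<close> and exchanges them if
    \<open>b = 1\<close>; only their sum enters \<open>E_mean\<close>.\<close>
  have "cnj (F ((1 + t) / 2)) + cnj (F (t / 2)) = F ((1 + t) / 2) + F (t / 2)"
  proof -
    have a: "cnj (F z) = F w" if "cnj z + w \<in> L" for z w
      using F_L[OF that, of "- w"] F_even[of w] by (simp add: Fc)
    have m: "of_int i + of_int j * t \<in> L" for i j using L_I[of i j] by simp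
    show ?thesis
    proof (cases "b = 0")
      case True
      have "cnj (F (t / 2)) = F (t / 2)" by (rule a) (simp add: ct True)
      moreover have "cnj ((1 + t) / 2) + (1 + t) / 2 = of_int 1 + of_int 0 * t" by (simp add: ct True field_simps)
      then have "cnj (F ((1 + t) / 2)) = F ((1 + t) / 2)" using a m by metis
      ultimately show ?thesis by simp
    next
      case False
      then have b: "b = 1" using assms by simp
      have "cnj (t / 2) + (1 + t) / 2 = of_int 1 + of_int 0 * t" by (simp add: ct b field_simps)
      then have "cnj (F (t / 2)) = F ((1 + t) / 2)" using a m by metis
      moreover have "cnj ((1 + t) / 2) + t / 2 = of_int 1 + of_int 0 * t" by (simp add: ct b field_simps)
      then have "cnj (F ((1 + t) / 2)) = F (t / 2)" using a m by metis
      ultimately show ?thesis by simp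
    qed
  qed
  moreover have "cnj (F (1 / 2)) = F (1 / 2)" using Fc[of "1 / 2"] by simp
  ultimately have "cnj (E_mean p) = E_mean p" unfolding E_mean_def F_half[symmetric] by (simp add: algebra_simps)
  then have xs: "F (cnj z) - E_mean p = cnj (F z - E_mean p)" for z by (simp add: Fc)
  have Lc: "z \<in> L \<longleftrightarrow> cnj z \<in> L" for z
  proof -
    have "cnj z \<in> L" if zL: "z \<in> L" for z
    proof -
      obtain m n where "z = of_int m * 1 + of_int n * t" using zL unfolding L_def by blast
      then have "cnj z = of_int (m + n * b) * 1 + of_int (- n) * t" by (simp add: ct algebra_simps)
      then show ?thesis using L_I by metis
    qed
    from this[of z] this[of "cnj z"] show ?thesis by auto
  qed
  have ds: "deriv F (cnj z) = cnj (deriv F z)" if z: "z \<notin> L" for z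
  proof -
    have "(F has_field_derivative deriv F z) (at z)"
      using F_ell z L_open holomorphic_derivI unfolding ell_def by blast
    then have "((cnj \<circ> F \<circ> cnj) has_field_derivative cnj (deriv F z)) (at (cnj z))"
      using has_field_derivative_cnj_cnj[of F "deriv F z" "cnj z"] by simp
    moreover have "cnj \<circ> F \<circ> cnj = F" by (auto simp: Fc)
    ultimately show ?thesis by (simp add: DERIV_imp_deriv)
  qed
  show ?thesis unfolding W.cnj_sym_def using Lc xs ds by simp
qed

end

text \<open>Locally uniform convergence by the Weierstrass test. The term \<open>n = 0\<close> is
  exempt from the bound, because for the constant \<open>u p = - 1\<close> it stays on the unit
  circle; the last premise keeps every term away from the pole of \<open>koebe\<close>.\<close>

lemma koebe_series_cont:
  assumes "continuous_on (ball 0 1) u" "\<And>p n. norm p < 1 \<Longrightarrow> n \<ge> 1 \<Longrightarrow> norm (u p * p ^ (2 * n)) \<le> norm p ^ (2 * n)"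
    "\<And>p n. norm p < 1 \<Longrightarrow> u p * p ^ (2 * n) \<noteq> 1"
  shows "continuous_on (ball 0 1) (\<lambda>p. koebe_series (u p) p)"
proof -
  have "isCont (\<lambda>p. koebe_series (u p) p) p0" if p0: "p0 \<in> ball 0 1" for p0
  proof -
    obtain \<rho> where \<rho>: "norm p0 < \<rho>" "\<rho> < 1" using p0 dense by auto
    have \<rho>0: "0 < \<rho>" using \<rho> norm_ge_zero[of p0] by linarith
    have "uniform_limit (ball 0 \<rho>) (\<lambda>n p. \<Sum>i<n. koebe (u p * p ^ (2 * i))) (\<lambda>p. \<Sum>i. koebe (u p * p ^ (2 * i))) sequentially"
    proof (rule Weierstrass_m_test_ev[where M = "\<lambda>n. (1 / (1 - \<rho>) ^ 2) * \<rho> ^ n"])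
      show "summable (\<lambda>n. (1 / (1 - \<rho>) ^ 2) * \<rho> ^ n)" using \<rho> \<rho>0 by (intro summable_mult summable_geometric) auto
      have "norm (koebe (u p * p ^ (2 * n))) \<le> (1 / (1 - \<rho>) ^ 2) * \<rho> ^ n" if n: "n \<ge> 1" and p: "p \<in> ball 0 \<rho>" for n p
      proof -
        have np: "norm p < \<rho>" using p by simp
        have "norm (u p * p ^ (2 * n)) \<le> norm p ^ (2 * n)" using assms(2)[OF _ n, of p] np \<rho> by simp
        also have "\<dots> \<le> \<rho> ^ (2 * n)" using np by (intro power_mono) auto
        also have "\<dots> \<le> \<rho> ^ n" using \<rho> \<rho>0 by (intro power_decreasing) auto
        finally have 1: "norm (u p * p ^ (2 * n)) \<le> \<rho> ^ n" .
        also have 2: "\<rho> ^ n \<le> \<rho>" using power_decreasing[of 1 n \<rho>] \<rho> \<rho>0 n by simp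
        finally have 3: "norm (u p * p ^ (2 * n)) \<le> \<rho>" .
        have "norm (koebe (u p * p ^ (2 * n))) \<le> norm (u p * p ^ (2 * n)) / (1 - norm (u p * p ^ (2 * n))) ^ 2"
          using 3 \<rho> by (intro norm_koebe) linarith
        also have "\<dots> \<le> \<rho> ^ n / (1 - \<rho>) ^ 2"
          using 1 3 \<rho> \<rho>0 by (intro frac_le power_mono) auto
        finally show ?thesis by simp
      qed
      then show "\<forall>\<^sub>F n in sequentially. \<forall>p\<in>ball 0 \<rho>. norm (koebe (u p * p ^ (2 * n))) \<le> (1 / (1 - \<rho>) ^ 2) * \<rho> ^ n"
        unfolding eventually_sequentially by blast
    qed
    moreover have "continuous_on (ball 0 \<rho>) (\<lambda>p. \<Sum>i<n. koebe (u p * p ^ (2 * i)))" for n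
    proof -
      have "(1 - u p * p ^ (2 * i)) ^ 2 \<noteq> 0" if "p \<in> ball 0 \<rho>" for p i
        using assms(3)[of p i] that \<rho> by simp
      moreover have "continuous_on (ball 0 \<rho>) u"
        by (rule continuous_on_subset[OF assms(1)]) (use \<rho> in auto)
      ultimately show ?thesis unfolding koebe_def by (intro continuous_intros) auto
    qed
    ultimately have "continuous_on (ball 0 \<rho>) (\<lambda>p. koebe_series (u p) p)"
      unfolding koebe_series_def by (intro uniform_limit_theorem[of _ _ sequentially]) auto
    then show ?thesis using \<rho> by (simp add: continuous_on_eq_continuous_at)
  qed
  then show ?thesis by (simp add: continuous_on_eq_continuous_at)
qed

lemma nome_AB_continuous: "continuous_on (ball 0 1) nome_A" "continuous_on (ball 0 1) nome_B"
proof -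
  have lt: "norm p ^ Suc n < 1" if "norm p < 1" for p :: complex and n
    using mult_left_le[of "norm p ^ n" "norm p"] power_le_one[of "norm p" n] that by simp
  have 1: "continuous_on (ball 0 1) (\<lambda>p. koebe_series (- 1) p)"
  proof (rule koebe_series_cont)
    fix p :: complex and n :: nat assume p: "norm p < 1"
    show "- 1 * p ^ (2 * n) \<noteq> 1"
    proof
      assume "- 1 * p ^ (2 * n) = 1"
      then have a: "p ^ (2 * n) = - 1" by (simp add: minus_equation_iff)
      have "n \<noteq> 0"
      proof
        assume "n = 0"
        then show False using a by simp
      qed
      then obtain k where "2 * n = Suc k" by (cases n) auto
      then show False using lt[OF p, of k] arg_cong[OF a, of norm] by (simp add: norm_power norm_mult)
    qed
  qed (auto simp: norm_power)
  have gen: "continuous_on (ball 0 1) (\<lambda>p. koebe_series (c * p) p)" if c: "norm c = 1" for c :: complex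
  proof (rule koebe_series_cont)
    fix p :: complex and n :: nat assume p: "norm p < 1"
    have "norm (c * p * p ^ (2 * n)) = norm p ^ Suc (2 * n)" by (simp add: norm_mult norm_power c)
    then show "c * p * p ^ (2 * n) \<noteq> 1" using lt[OF p, of "2 * n"] by (metis less_irrefl norm_one)
    show "norm (c * p * p ^ (2 * n)) \<le> norm p ^ (2 * n)"
      using p by (simp add: norm_mult norm_power c mult_left_le_one_le)
  qed (auto intro!: continuous_intros)
  have 2: "continuous_on (ball 0 1) (\<lambda>p. koebe_series p p)" using gen[of 1] by simp
  have 3: "continuous_on (ball 0 1) (\<lambda>p. koebe_series (- p) p)" using gen[of "- 1"] by simp
  have E: "continuous_on (ball 0 1) E1" "continuous_on (ball 0 1) E2" "continuous_on (ball 0 1) E3"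
    unfolding E1_def E2_def E3_def by (intro continuous_intros 1 2 3)+
  then have E_mean: "continuous_on (ball 0 1) E_mean" unfolding E_mean_def by (intro continuous_intros) auto
  show "continuous_on (ball 0 1) nome_A" "continuous_on (ball 0 1) nome_B"
    unfolding nome_A_def nome_B_def by (intro continuous_intros E E_mean)+
qed

text \<open>Only the terms \<open>n = 0\<close> survive. Two of the three roots coincide, so the
  cusp is a nodal cubic, with zero discriminant and negative \<open>B\<close>.\<close>

lemma nome_AB_0: "nome_A 0 = - (of_real pi ^ 4 / 3)" "nome_B 0 = - (2 * of_real pi ^ 6 / 27)"
proof -
  have koebe: "koebe 0 = 0" "koebe (- 1) = - (1 / 4)" by (simp_all add: koebe_def)
  have "(\<lambda>n. koebe (u * 0 ^ (2 * n))) = (\<lambda>n. if n = 0 then koebe u else 0)" for u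
    by (auto simp: fun_eq_iff koebe power_0_left)
  then have koebe_series: "koebe_series u 0 = koebe u" for u
    using sums_unique[OF sums_single[of 0 "\<lambda>_. koebe u"]] by (simp add: koebe_series_def)
  have E: "E1 0 = of_real pi ^ 2" "E2 0 = 0" "E3 0 = 0" by (simp_all add: E1_def E2_def E3_def koebe_series koebe)
  show "nome_A 0 = - (of_real pi ^ 4 / 3)" "nome_B 0 = - (2 * of_real pi ^ 6 / 27)"
    unfolding nome_A_def nome_B_def E_mean_def E by (simp_all add: field_simps eval_nat_numeral)
qed

subsection \<open>Uniformization of real curves\<close>

text \<open>For imaginary \<open>c\<close> the sign from \<open>cnj c = - c\<close> is absorbed by
  parity: \<open>x\<close> is even of weight 2, and \<open>y\<close> is odd of weight 3.\<close>

lemma wp_scale_sym: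
  assumes w: "wp w1 w2 x y A B" and s: "wp.cnj_sym w1 w2 x y" and c: "c \<noteq> 0" "cnj c = c \<or> cnj c = - c"
  shows "wp.cnj_sym (c * w1) (c * w2) (\<lambda>z. x (z / c) / c ^ 2) (\<lambda>z. y (z / c) / c ^ 3)"
proof -
  interpret wp w1 w2 x y A B by fact
  interpret S: wp "c * w1" "c * w2" "\<lambda>z. x (z / c) / c ^ 2" "\<lambda>z. y (z / c) / c ^ 3" "A / c ^ 4" "B / c ^ 6"
    by (rule wp_scale[OF w c(1)])
  have SL: "z \<in> S.L \<longleftrightarrow> z / c \<in> L" for z by (rule scale_L(2)[OF c(1)])
  have L: "cnj z \<in> L \<longleftrightarrow> z \<in> L" "- z \<in> L \<longleftrightarrow> z \<in> L" for z
    using s L_uminus unfolding cnj_sym_def by blast+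
  have xy: "x (cnj z) = cnj (x z)" "y (cnj z) = cnj (y z)" if "z \<notin> L" for z
    using s that unfolding cnj_sym_def by blast+
  from c(2) show ?thesis
  proof
    assume r: "cnj c = c"
    have e: "cnj z / c = cnj (z / c)" for z by (simp add: r)
    show ?thesis unfolding S.cnj_sym_def SL e using L xy by (simp add: r del: complex_cnj_divide) (simp add: r)
  next
    assume r: "cnj c = - c"
    have e: "cnj z / c = - cnj (z / c)" for z by (simp add: r)
    have "x (- cnj w) = cnj (x w)" "y (- cnj w) = - cnj (y w)" if "w \<notin> L" for w
      using x_even[of "cnj w"] y_odd[of "cnj w"] L xy that by simp_all
    then show ?thesis unfolding S.cnj_sym_def SL e using L by (simp add: r power3_eq_cube del: complex_cnj_divide) (simp add: r power3_eq_cube)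
  qed
qed

definition tau :: "int \<Rightarrow> real \<Rightarrow> complex" where "tau b s = of_int b / 2 + \<i> * of_real s"

definition nome :: "int \<Rightarrow> real \<Rightarrow> complex" where "nome b s = exp (\<i> * of_real pi * tau b s)"

definition tau_A :: "int \<Rightarrow> real \<Rightarrow> real" where "tau_A b s = Re (nome_A (nome b s))"
definition tau_B :: "int \<Rightarrow> real \<Rightarrow> real" where "tau_B b s = Re (nome_B (nome b s))"
definition tau_disc :: "int \<Rightarrow> real \<Rightarrow> real" where "tau_disc b s = 4 * tau_A b s ^ 3 + 27 * tau_B b s ^ 2"

lemma wp_tau:
  assumes b: "b = 0 \<or> b = 1" and s: "s > 0"
  shows "\<exists>x y. wp 1 (tau b s) x y (of_real (tau_A b s)) (of_real (tau_B b s)) \<and> wp.cnj_sym 1 (tau b s) x y"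
proof -
  interpret half_plane "tau b s" by unfold_locales (use s in \<open>simp add: tau_def\<close>)
  have p: "p = nome b s" by (simp add: p_def nome_def)
  interpret W: wp 1 "tau b s" "\<lambda>z. F z - E_mean p" "\<lambda>z. deriv F z / 2" "nome_A p" "nome_B p" by (rule wp_q)
  have sym: "W.cnj_sym" by (rule wp_q_sym[of b]) (use b in \<open>auto simp: tau_def\<close>)
  have "of_real (tau_A b s) = nome_A p" "of_real (tau_B b s) = nome_B p"
    using W.real_coeffs[OF sym] by (simp_all add: tau_A_def tau_B_def p[symmetric])
  then show ?thesis using W.wp_axioms sym by auto
qed

text \<open>The quantity is minus the square of the product \<open>d\<close> of the root
  differences. Conjugation fixes the three roots if \<open>b = 0\<close>, so \<open>d\<close> is
  real; it exchanges two of them if \<open>b = 1\<close>, so \<open>d\<close> is imaginary.\<close>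

lemma tau_disc_sign: 
  assumes b: "b = 0 \<or> b = 1" and s: "s > 0"
  shows "b = 0 \<Longrightarrow> tau_disc b s < 0" "b = 1 \<Longrightarrow> tau_disc b s > 0"
proof -
  define t where "t = tau b s"
  obtain x y where w: "wp 1 t x y (of_real (tau_A b s)) (of_real (tau_B b s))" and sym: "wp.cnj_sym 1 t x y"
    using wp_tau[OF b s] unfolding t_def by blast
  interpret wp 1 t x y "of_real (tau_A b s)" "of_real (tau_B b s)" by (rule w)
  have ct: "cnj t = of_int b - t" by (simp add: t_def tau_def complex_eq_iff)
  define e1 e2 e3 where "e1 = x (1 / 2)" and "e2 = x (t / 2)" and "e3 = x ((1 + t) / 2)"
  note hv = half_values[folded e1_def e2_def e3_def]
  note hn = half_notin
  have xc: "x (cnj z) = cnj (x z)" if "z \<notin> L" for z using sym that unfolding cnj_sym_def by blast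
  have per: "cnj (x z) = x w" if "z \<notin> L" "w \<notin> L" "cnj z + w \<in> L" for z w
  proof -
    have "cnj z \<notin> L" using sym that(1) unfolding cnj_sym_def by blast
    then have "x (cnj z) = x w" using x_eq_iff that by blast
    then show ?thesis using xc[OF that(1)] by simp
  qed
  have m: "of_int i + of_int j * t \<in> L" for i j using L_I[of i j] by simp
  have r1: "cnj e1 = e1" unfolding e1_def using xc[OF hn(1)] by simp
  define d where "d = (e1 - e2) * (e1 - e3) * (e2 - e3)"
  have e3: "e3 = - e1 - e2" using hv(4) by (simp add: algebra_simps eq_neg_iff_add_eq_0)
  have D: "of_real (tau_disc b s) = - (d ^ 2)"
    unfolding tau_disc_def d_def by (simp add: hv(5,6)) (simp add: e3 power2_eq_square power3_eq_cube algebra_simps)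
  have d0: "d \<noteq> 0" using hv(1-3) by (simp add: d_def)
  show "tau_disc b s < 0" if b: "b = 0"
  proof -
    have "cnj (t / 2) + t / 2 = of_int 0 + of_int 0 * t" by (simp add: ct b field_simps)
    then have "cnj e2 = e2" unfolding e2_def using per m hn by metis
    moreover have "cnj ((1 + t) / 2) + (1 + t) / 2 = of_int 1 + of_int 0 * t" by (simp add: ct b field_simps)
    then have "cnj e3 = e3" unfolding e3_def using per m hn by metis
    ultimately have "cnj d = d" unfolding d_def using r1 by simp
    then have i0: "Im d = 0" by (simp add: complex_eq_iff)
    then have "d ^ 2 = of_real (Re d ^ 2)" by (simp add: complex_eq_iff power2_eq_square)
    then have "of_real (tau_disc b s) = (of_real (- (Re d ^ 2)) :: complex)" using D by simp
    moreover have "Re d \<noteq> 0" using i0 d0 by (simp add: complex_eq_iff)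
    ultimately have "of_real (tau_disc b s) = (of_real (- (Re d ^ 2)) :: complex)" "Re d \<noteq> 0" by blast+
    then show ?thesis unfolding of_real_eq_iff by simp
  qed
  show "tau_disc b s > 0" if b: "b = 1"
  proof -
    have "cnj (t / 2) + (1 + t) / 2 = of_int 1 + of_int 0 * t" by (simp add: ct b field_simps)
    then have c: "cnj e2 = e3" unfolding e2_def e3_def using per m hn by metis
    then have c': "cnj e3 = e2" by auto
    have "cnj d = - d" unfolding d_def using r1 c c' by (simp add: algebra_simps)
    then have di: "Re d = 0" by (simp add: complex_eq_iff)
    then have "d ^ 2 = of_real (- (Im d ^ 2))" by (simp add: complex_eq_iff power2_eq_square)
    then have "of_real (tau_disc b s) = (of_real (Im d ^ 2) :: complex)" using D by simp
    moreover have "Im d \<noteq> 0" using di d0 by (simp add: complex_eq_iff)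
    ultimately have "of_real (tau_disc b s) = (of_real (Im d ^ 2) :: complex)" "Im d \<noteq> 0" by blast+
    then show ?thesis unfolding of_real_eq_iff by simp
  qed
qed

lemma norm_nome: "norm (nome b s) = exp (- pi * s)"
  by (simp add: nome_def norm_exp_eq_Re tau_def)

lemma tau_AB_isCont:
  assumes "s > 0"
  shows "isCont (tau_A b) s" "isCont (tau_B b) s"
proof -
  have n: "nome b s \<in> ball 0 1" using assms by (simp add: norm_nome)
  have c: "isCont (nome b) s" unfolding nome_def tau_def by (intro continuous_intros)
  have "isCont nome_A (nome b s)" "isCont nome_B (nome b s)"
    using nome_AB_continuous n by (auto simp: continuous_on_eq_continuous_at)
  then show "isCont (tau_A b) s" "isCont (tau_B b) s"
    unfolding tau_A_def tau_B_def using c isCont_o2[of s "nome b" nome_A] isCont_o2[of s "nome b" nome_B]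
    by (auto intro!: continuous_intros)
qed

lemma tau_AB_lim: "(tau_A b \<longlongrightarrow> - (pi ^ 4 / 3)) at_top" "(tau_B b \<longlongrightarrow> - (2 * pi ^ 6 / 27)) at_top"
proof -
  have "((\<lambda>s. exp (- pi * s)) \<longlongrightarrow> 0) at_top" by real_asymp
  then have n: "(nome b \<longlongrightarrow> 0) at_top"
    by (subst tendsto_norm_zero_iff[symmetric]) (simp add: norm_nome)
  have "isCont nome_A 0" "isCont nome_B 0" using nome_AB_continuous by (auto simp: continuous_on_eq_continuous_at)
  then have a: "((\<lambda>s. nome_A (nome b s)) \<longlongrightarrow> nome_A 0) at_top" "((\<lambda>s. nome_B (nome b s)) \<longlongrightarrow> nome_B 0) at_top"
    using isCont_tendsto_compose n by blast+
  have "Re (nome_A 0) = - (pi ^ 4 / 3)" "Re (nome_B 0) = - (2 * pi ^ 6 / 27)"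
    unfolding nome_AB_0 of_real_power[symmetric] by (simp_all del: of_real_power)
  then show "(tau_A b \<longlongrightarrow> - (pi ^ 4 / 3)) at_top" "(tau_B b \<longlongrightarrow> - (2 * pi ^ 6 / 27)) at_top"
    unfolding tau_A_def tau_B_def using tendsto_Re[OF a(1)] tendsto_Re[OF a(2)] by simp_all
qed

text \<open>Both lattices are stable under multiplication by \<open>\<i>\<close>. Scaling by it
  keeps the lattice and replaces \<open>B\<close> by \<open>B / \<i> ^ 6 = - B\<close>, and the
  lattice determines the curve.\<close>

lemma tau_B_zero: "tau_B 0 1 = 0" "tau_B 1 (1 / 2) = 0"
proof -
  have main: "B = 0" if w: "wp 1 t x y A B" and L: "lattice2.L 1 t = lattice2.L (\<i> * 1) (\<i> * t)" for t x y A B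
  proof -
    have "B = B / \<i> ^ 6" using wp_unique[OF w wp_scale[OF w, of \<i>] L] by simp
    then show ?thesis by (simp add: eval_nat_numeral)
  qed
  have gen: "lattice2.L 1 t = lattice2.L (\<i> * 1) (\<i> * t)"
    if t: "lattice2 1 t" and e: "\<i> \<in> lattice2.L 1 t" "\<i> * t \<in> lattice2.L 1 t" for t
  proof -
    interpret lattice2 1 t by fact
    have i: "\<i> * l \<in> L" if l: "l \<in> L" for l
    proof -
      obtain m n where "l = of_int m * 1 + of_int n * t" using l unfolding L_def by blast
      then have "\<i> * l = of_int m * \<i> + of_int n * (\<i> * t)" by (simp add: algebra_simps)
      then show ?thesis using e L_of_int L_add by simp
    qed
    have "z \<in> L \<longleftrightarrow> z / \<i> \<in> L" for z
      using i[of z] i[of "z / \<i>"] L_uminus[of "z / \<i>"] by (auto simp: divide_inverse mult_ac)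
    moreover have "z \<in> lattice2.L (\<i> * 1) (\<i> * t) \<longleftrightarrow> z / \<i> \<in> L" for z by (rule scale_L(2)) simp
    ultimately show ?thesis by blast
  qed
  show "tau_B 0 1 = 0"
  proof -
    obtain x y where w: "wp 1 (tau 0 1) x y (of_real (tau_A 0 1)) (of_real (tau_B 0 1))" using wp_tau[of 0 1] by auto
    interpret wp 1 "tau 0 1" x y "of_real (tau_A 0 1)" "of_real (tau_B 0 1)" by (rule w)
    have "\<i> \<in> L" "\<i> * tau 0 1 \<in> L" using L_I[of 0 1] L_I[of "- 1" 0] by (simp_all add: tau_def)
    then show ?thesis using main[OF w gen] lattice2_axioms by simp
  qed
  show "tau_B 1 (1 / 2) = 0"
  proof -
    obtain x y where w: "wp 1 (tau 1 (1 / 2)) x y (of_real (tau_A 1 (1 / 2))) (of_real (tau_B 1 (1 / 2)))" using wp_tau[of 1 "1 / 2"] by auto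
    interpret wp 1 "tau 1 (1 / 2)" x y "of_real (tau_A 1 (1 / 2))" "of_real (tau_B 1 (1 / 2))" by (rule w)
    have "of_int (- 1) * 1 + of_int 2 * tau 1 (1 / 2) = \<i>" "of_int (- 1) * 1 + of_int 1 * tau 1 (1 / 2) = \<i> * tau 1 (1 / 2)"
      by (simp_all add: tau_def complex_eq_iff)
    then have "\<i> \<in> L" "\<i> * tau 1 (1 / 2) \<in> L" using L_I by metis+
    then show ?thesis using main[OF w gen] lattice2_axioms by simp
  qed
qed

text \<open>For a given sign of \<open>4 A\<^sup>3 + 27 B\<^sup>2\<close>, this number determines a real curve up to real scaling;
  scaling by \<open>\<i>\<close> changes its sign. It vanishes at the square lattices and tends to \<open>- \<infinity>\<close> at the cusp.\<close>

definition tau_beta :: "int \<Rightarrow> real \<Rightarrow> real" where "tau_beta b s = tau_B b s / sqrt \<bar>tau_disc b s\<bar>"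

lemma tau_beta_surj:
  assumes b: "b = 0 \<or> b = 1" and v: "v \<le> 0"
  shows "\<exists>s>0. tau_beta b s = v"
proof -
  \<comment> \<open>The parameters of \<open>\<i>\<close> and \<open>(1 + \<i>) / 2\<close>, one
    square lattice in each family.\<close>
  define s0 :: real where "s0 = (if b = 0 then 1 else 1 / 2)"
  have s0: "s0 > 0" "tau_beta b s0 = 0" using b tau_B_zero by (auto simp: s0_def tau_beta_def)
  have dnz: "tau_disc b s \<noteq> 0" if "s > 0" for s using tau_disc_sign[OF b that] b by auto
  have c: "isCont (tau_beta b) s" if "s > 0" for s
    unfolding tau_beta_def tau_disc_def using dnz[OF that] tau_AB_isCont[OF that]
    by (intro continuous_intros) (auto simp: tau_disc_def)
  have "((\<lambda>s. 4 * tau_A b s ^ 3 + 27 * tau_B b s ^ 2) \<longlongrightarrow> 4 * (- (pi ^ 4 / 3)) ^ 3 + 27 * (- (2 * pi ^ 6 / 27)) ^ 2) at_top"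
    by (intro tendsto_intros tau_AB_lim)
  moreover have "4 * (- (pi ^ 4 / 3)) ^ 3 + 27 * (- (2 * pi ^ 6 / 27)) ^ 2 = 0"
    by (simp add: power_divide power_mult_distrib power_mult[symmetric])
  ultimately have "(tau_disc b \<longlongrightarrow> 0) at_top" unfolding tau_disc_def by simp
  then have "((\<lambda>s. sqrt \<bar>tau_disc b s\<bar>) \<longlongrightarrow> sqrt \<bar>0\<bar>) at_top" by (intro tendsto_intros)
  then have "((\<lambda>s. sqrt \<bar>tau_disc b s\<bar>) \<longlongrightarrow> 0) at_top" by simp
  moreover have "\<forall>\<^sub>F s in at_top. sqrt \<bar>tau_disc b s\<bar> > 0"
    using eventually_gt_at_top[of 0] by eventually_elim (use dnz in simp)
  ultimately have "filterlim (\<lambda>s. sqrt \<bar>tau_disc b s\<bar>) (at_right 0) at_top"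
    by (auto simp: filterlim_at elim: eventually_mono)
  then have "filterlim (\<lambda>s. inverse (sqrt \<bar>tau_disc b s\<bar>)) at_top at_top"
    by (rule filterlim_compose[OF filterlim_inverse_at_top_right])
  then have "filterlim (\<lambda>s. tau_B b s * inverse (sqrt \<bar>tau_disc b s\<bar>)) at_bot at_top"
    by (intro filterlim_tendsto_neg_mult_at_bot[OF tau_AB_lim(2)]) auto
  then have "filterlim (tau_beta b) at_bot at_top" by (simp add: tau_beta_def[abs_def] divide_inverse)
  then have "\<forall>\<^sub>F s in at_top. tau_beta b s < v" by (simp add: filterlim_at_bot_dense)
  then have "\<forall>\<^sub>F s in at_top. tau_beta b s < v \<and> s > s0" using eventually_gt_at_top[of s0] by eventually_elim auto
  then obtain s1 where s1: "tau_beta b s1 < v" "s1 > s0" using eventually_happens by force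
  have "\<exists>s. s0 \<le> s \<and> s \<le> s1 \<and> tau_beta b s = v"
    by (rule IVT2) (use s1 s0 v c in auto)
  then obtain s where "s0 \<le> s" "tau_beta b s = v" by blast
  then show ?thesis using s0(1) by (intro exI[of _ s]) auto
qed

text \<open>\<open>tau_beta\<close> selects \<open>s\<close>, the discriminants select
  \<open>c\<close>, and then \<open>B\<close> matches by the choice of \<open>s\<close>. This fixes
  the cube of \<open>A\<close>, hence \<open>A\<close>, since real cube roots are unique.\<close>

lemma uniformization_neg:
  fixes A B :: real
  assumes D: "4 * A ^ 3 + 27 * B ^ 2 \<noteq> 0" and B: "B \<le> 0"
  defines "b \<equiv> (if 4 * A ^ 3 + 27 * B ^ 2 < 0 then 0 else 1 :: int)"
  shows "\<exists>s c. s > 0 \<and> c > 0 \<and> A = tau_A b s / c ^ 4 \<and> B = tau_B b s / c ^ 6"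
proof -
  define D where "D = 4 * A ^ 3 + 27 * B ^ 2"
  have b: "b = 0 \<or> b = 1" by (simp add: b_def)
  have "B / sqrt \<bar>D\<bar> \<le> 0" using B by (simp add: divide_nonpos_nonneg)
  then obtain s where s: "s > 0" "tau_beta b s = B / sqrt \<bar>D\<bar>" using tau_beta_surj[OF b] by blast
  have q: "tau_disc b s / D > 0"
    using tau_disc_sign[OF b s(1)] assms(1) by (auto simp: b_def D_def zero_less_divide_iff)
  \<comment> \<open>The discriminant has weight 12.\<close>
  define c where "c = root 12 (tau_disc b s / D)"
  have c: "c > 0" "c ^ 12 = tau_disc b s / D" using q by (simp_all add: c_def)
  have D0: "D \<noteq> 0" using assms(1) by (simp add: D_def)
  have tau_disc: "tau_disc b s = c ^ 12 * D" using c D0 by simp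
  have sq: "sqrt \<bar>tau_disc b s\<bar> = c ^ 6 * sqrt \<bar>D\<bar>"
  proof -
    have "sqrt (c ^ 12) = c ^ 6" using c(1) by (intro real_sqrt_unique) (auto simp: power_mult[symmetric])
    then show ?thesis using c(1) by (simp add: tau_disc abs_mult real_sqrt_mult)
  qed
  have Bc: "B = tau_B b s / c ^ 6" using s(2) D0 c(1) by (simp add: tau_beta_def sq field_simps)
  have "4 * A ^ 3 = D - 27 * B ^ 2" by (simp add: D_def)
  also have "\<dots> = tau_disc b s / c ^ 12 - 27 * (tau_B b s / c ^ 6) ^ 2" using Bc tau_disc c(1) by simp
  also have "\<dots> = 4 * (tau_A b s / c ^ 4) ^ 3"
    by (simp add: tau_disc_def power_divide power_mult[symmetric] add_divide_distrib)
  finally have "A ^ 3 = (tau_A b s / c ^ 4) ^ 3" by simp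
  then have "A = tau_A b s / c ^ 4" by (metis odd_real_root_power_cancel odd_numeral)
  then show ?thesis using s(1) c(1) Bc by blast
qed

lemma uniformization:
  fixes A B :: real
  assumes D: "4 * A ^ 3 + 27 * B ^ 2 \<noteq> 0"
  defines "b \<equiv> (if 4 * A ^ 3 + 27 * B ^ 2 < 0 then 0 else 1 :: int)"
  shows "\<exists>s c. s > 0 \<and> c \<noteq> 0 \<and> (cnj c = c \<or> cnj c = - c) \<and>
    of_real A = of_real (tau_A b s) / c ^ 4 \<and> of_real B = of_real (tau_B b s) / c ^ 6"
proof (cases "B \<le> 0")
  case True
  obtain s c where "s > 0" "c > 0" "A = tau_A b s / c ^ 4" "B = tau_B b s / c ^ 6"
    using uniformization_neg[OF D True] unfolding b_def by blast
  then show ?thesis by (intro exI[of _ s] exI[of _ "of_real c"]) auto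
next
  case False
  obtain s c where sc: "s > 0" "c > 0" "A = tau_A b s / c ^ 4" "- B = tau_B b s / c ^ 6"
    using uniformization_neg[of A "- B"] D False unfolding b_def by auto
  have i46: "\<i> ^ 4 = 1" "\<i> ^ 6 = - 1" by (simp_all add: eval_nat_numeral)
  have "B = - (tau_B b s / c ^ 6)" using sc(4) by simp
  then show ?thesis using sc(1-3)
    by (intro exI[of _ s] exI[of _ "\<i> * of_real c"]) (auto simp: power_mult_distrib i46)
qed

lemma wp_tau_scaled:
  assumes b: "b = 0 \<or> b = 1" and s: "s > 0" and c: "c \<noteq> 0" "cnj c = c \<or> cnj c = - c"
    and AB: "of_real A = of_real (tau_A b s) / c ^ 4" "of_real B = of_real (tau_B b s) / c ^ 6"
  shows "\<exists>x y. wp c (c * tau b s) x y (of_real A) (of_real B) \<and> wp.cnj_sym c (c * tau b s) x y"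
proof -
  obtain x y where w: "wp 1 (tau b s) x y (of_real (tau_A b s)) (of_real (tau_B b s))" "wp.cnj_sym 1 (tau b s) x y"
    using wp_tau[OF b s] by blast
  show ?thesis
    using wp_scale[OF w(1) c(1)] wp_scale_sym[OF w c] unfolding AB by auto
qed

subsection \<open>Density\<close>

definition tau_j :: "int \<Rightarrow> real \<Rightarrow> real" where "tau_j b s = 1728 * (4 * tau_A b s ^ 3) / tau_disc b s"

text \<open>The square of the absolute value of \<open>tau b s\<close>, since
  \<open>(b / 2)^2 = b / 4\<close> for \<open>b\<close> equal to 0 or 1.\<close>

definition tau_norm :: "int \<Rightarrow> real \<Rightarrow> real" where "tau_norm b s = of_int b / 4 + s ^ 2"

lemma tau_quadratic: "b = 0 \<or> b = 1 \<Longrightarrow> tau b s ^ 2 = of_int b * tau b s - of_real (tau_norm b s)"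
  by (auto simp: tau_def tau_norm_def power2_eq_square algebra_simps complex_eq_iff)

lemma complexification_Weierstrass: "complexification (Weierstrass A B) = Weierstrass (of_real A) (of_real B)"
  by (simp add: complexification_def)

lemma tau_j_eq:
  fixes c :: complex
  assumes b: "b = 0 \<or> b = 1" and s: "s > 0" and c: "c \<noteq> 0"
    and AB: "of_real A = of_real (tau_A b s) / c ^ 4" "of_real B = of_real (tau_B b s) / c ^ 6"
  shows "4 * A ^ 3 + 27 * B ^ 2 \<noteq> 0" "tau_j b s = 1728 * (4 * A ^ 3) / (4 * A ^ 3 + 27 * B ^ 2)"
proof -
  have dnz: "tau_disc b s \<noteq> 0" using tau_disc_sign[OF b s] b by auto
  have A3: "of_real (A ^ 3) = of_real (tau_A b s ^ 3) / c ^ 12"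
    by (simp add: AB power_divide power_mult[symmetric])
  have B2: "of_real (B ^ 2) = of_real (tau_B b s ^ 2) / c ^ 12"
    by (simp add: AB power_divide power_mult[symmetric])
  have D: "of_real (4 * A ^ 3 + 27 * B ^ 2) = of_real (tau_disc b s) / c ^ 12"
    using A3 B2 by (simp add: tau_disc_def add_divide_distrib)
  then have "(of_real (4 * A ^ 3 + 27 * B ^ 2) :: complex) \<noteq> 0" using dnz c by simp
  then show "4 * A ^ 3 + 27 * B ^ 2 \<noteq> 0" by (metis of_real_0)
  have "(of_real (1728 * (4 * A ^ 3) / (4 * A ^ 3 + 27 * B ^ 2)) :: complex)
     = 1728 * (4 * of_real (A ^ 3)) / of_real (4 * A ^ 3 + 27 * B ^ 2)"
    by simp
  also have "\<dots> = of_real (tau_j b s)"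
    unfolding A3 D using c dnz by (simp add: tau_j_def)
  finally show "tau_j b s = 1728 * (4 * A ^ 3) / (4 * A ^ 3 + 27 * B ^ 2)" by (simp only: of_real_eq_iff)
qed

text \<open>An explicit real curve with invariant \<open>j\<close> is uniformized; the sign of its
  discriminant, hence its family, depends only on whether \<open>j < 1728\<close>.\<close>

lemma tau_j_surj:
  assumes j: "j \<noteq> 1728"
  shows "\<exists>s>0. tau_j (if j < 1728 then 1 else 0) s = j"
proof -
  have ex: "\<exists>A B. 4 * A ^ 3 + 27 * B ^ 2 \<noteq> 0 \<and> (4 * A ^ 3 + 27 * B ^ 2 < 0 \<longleftrightarrow> \<not> j < 1728) \<and>
      1728 * (4 * A ^ 3) / (4 * A ^ 3 + 27 * B ^ 2) = j"
  proof (cases "j = 0")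
    case True
    then show ?thesis by (intro exI[of _ 0] exI[of _ 1]) simp
  next
    case False
    \<comment> \<open>The curve with \<open>A = - 3 k\<close> and \<open>B = 2 k\<close> has
      invariant \<open>1728 k / (k - 1)\<close>, and this \<open>k\<close> solves for
      \<open>j\<close>.\<close>
    define k where "k = j / (j - 1728)"
    have k1: "k - 1 = 1728 / (j - 1728)" using j by (simp add: k_def field_simps)
    have k: "k \<noteq> 0" "k \<noteq> 1" using j False k1 by (auto simp: k_def)
    have D: "4 * (- 3 * k) ^ 3 + 27 * (2 * k) ^ 2 = - (108 * k ^ 2 * (k - 1))"
      by (simp add: power2_eq_square power3_eq_cube algebra_simps)
    have nz: "4 * (- 3 * k) ^ 3 + 27 * (2 * k) ^ 2 \<noteq> 0" unfolding D using k by simp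
    have neg: "4 * (- 3 * k) ^ 3 + 27 * (2 * k) ^ 2 < 0 \<longleftrightarrow> \<not> j < 1728"
      unfolding D using k j by (auto simp: k1 zero_less_mult_iff zero_less_divide_iff)
    have "1728 * (4 * (- 3 * k) ^ 3) / (4 * (- 3 * k) ^ 3 + 27 * (2 * k) ^ 2) = 1728 * k / (k - 1)"
      unfolding D using k by (simp add: power_mult_distrib power2_eq_square power3_eq_cube divide_simps)
    also have "\<dots> = j" unfolding k1 using j by (simp add: k_def)
    finally show ?thesis using nz neg by blast
  qed
  then obtain A B where AB: "4 * A ^ 3 + 27 * B ^ 2 \<noteq> 0" "4 * A ^ 3 + 27 * B ^ 2 < 0 \<longleftrightarrow> \<not> j < 1728"
      "1728 * (4 * A ^ 3) / (4 * A ^ 3 + 27 * B ^ 2) = j" by blast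
  define b :: int where "b = (if j < 1728 then 1 else 0)"
  have b: "b = (if 4 * A ^ 3 + 27 * B ^ 2 < 0 then 0 else 1)" unfolding AB(2) b_def by simp
  obtain s and c :: complex where s: "s > 0" "c \<noteq> 0" "of_real A = of_real (tau_A b s) / c ^ 4" "of_real B = of_real (tau_B b s) / c ^ 6"
    using uniformization[OF AB(1), folded b] by blast
  have "tau_j b s = j"
    unfolding AB(3)[symmetric] by (rule tau_j_eq(2)[OF _ s]) (simp add: b_def)
  then show ?thesis using s(1) unfolding b_def by blast
qed

lemma tau_j_isCont: "b = 0 \<or> b = 1 \<Longrightarrow> s > 0 \<Longrightarrow> isCont (tau_j b) s"
  unfolding tau_j_def tau_disc_def using tau_disc_sign[of b s] tau_AB_isCont[of s b]
  by (intro continuous_intros) (auto simp: tau_disc_def)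

lemma closure_tau_j:
  assumes b: "b = 0 \<or> b = 1" and s: "s > 0" "s0 > 0"
    and dense: "\<And>e. e > 0 \<Longrightarrow> \<exists>u v :: int. \<bar>of_int u / of_int v - s / s0\<bar> < e \<and> tau_j b (of_int u / of_int v * s0) \<in> J"
  shows "tau_j b s \<in> closure J"
  unfolding closure_approachable
proof (intro allI impI)
  fix e :: real assume "e > 0"
  then obtain d where d: "d > 0" "\<And>s'. dist s' s < d \<Longrightarrow> dist (tau_j b s') (tau_j b s) < e"
    using tau_j_isCont[OF b s(1)] unfolding continuous_at_eps_delta by blast
  obtain u v :: int where uv: "\<bar>of_int u / of_int v - s / s0\<bar> < d / s0" "tau_j b (of_int u / of_int v * s0) \<in> J"
    using dense[of "d / s0"] d(1) s(2) by auto
  have "dist (of_int u / of_int v * s0) s = \<bar>of_int u / of_int v - s / s0\<bar> * s0"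
    using s(2) by (simp add: dist_real_def abs_mult_pos left_diff_distrib)
  also have "\<dots> < d" using uv(1) s(2) by (simp add: field_simps)
  finally show "\<exists>y\<in>J. dist y (tau_j b s) < e" using d(2) uv(2) by blast
qed

text \<open>Odd integers have spacing 2, so one of them lies within distance 1 of
  \<open>v * x\<close>.\<close>

lemma odd_approx:
  fixes x :: real and v :: int
  assumes "x > 0" "v > 0"
  shows "\<exists>u>0. odd u \<and> \<bar>of_int u / of_int v - x\<bar> \<le> 1 / of_int v"
proof -
  define X where "X = of_int v * x / 2"
  have X: "X > 0" using assms by (simp add: X_def)
  define u where "u = 2 * \<lfloor>X\<rfloor> + 1"
  have "\<lfloor>X\<rfloor> \<ge> 0" using X by simp
  then have "u > 0" by (simp add: u_def)
  have "\<bar>of_int u - 2 * X\<bar> \<le> 1" unfolding u_def by linarith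
  then have "\<bar>of_int u - of_int v * x\<bar> / of_int v \<le> 1 / of_int v"
    using assms by (intro divide_right_mono) (auto simp: X_def)
  moreover have "\<bar>of_int u - of_int v * x\<bar> / of_int v = \<bar>of_int u / of_int v - x\<bar>"
  proof -
    have "of_int u / of_int v - x = (of_int u - of_int v * x) / of_int v" using assms by (simp add: field_simps)
    then show ?thesis using assms by (simp add: abs_divide)
  qed
  ultimately show ?thesis using \<open>u > 0\<close> by (intro exI[of _ u]) (simp add: u_def)
qed

text \<open>The new curve is scaled by the same \<open>c\<close> as the given one, possibly
  imaginary, so that a positive integer maps its lattice into the given one. This also covers curves
  from different families.\<close>

lemma J0_I:
  assumes E: "of_real A = of_real (tau_A b0 s0) / c ^ 4" "of_real B = of_real (tau_B b0 s0) / c ^ 6"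
    and c: "c \<noteq> 0" "cnj c = c \<or> cnj c = - c"
    and b0: "b0 = 0 \<or> b0 = 1" "s0 > 0" and b: "b = 0 \<or> b = 1"
    and N0: "tau_norm b0 s0 = of_int p0 / of_int q0" "q0 > 0" "coprime p0 q0"
    and uv: "u > 0" "v > 0" and s: "s = of_int u / of_int v * s0"
    and N: "tau_norm b s = of_int p / of_int q" "q > 0" "coprime p q"
    and parity: "odd (q * b) \<longleftrightarrow> odd (q0 * b0)"
  shows "tau_j b s \<in> J0 (Weierstrass A B)"
proof -
  have s_pos: "s > 0" using s uv b0 by simp
  have cr: "cnj (c ^ 4) = c ^ 4" "cnj (c ^ 6) = c ^ 6" using c(2) by auto
  define A' where "A' = Re (of_real (tau_A b s) / c ^ 4)"
  define B' where "B' = Re (of_real (tau_B b s) / c ^ 6)"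
  have "of_real (tau_A b s) / c ^ 4 \<in> \<real>" "of_real (tau_B b s) / c ^ 6 \<in> \<real>"
    using cr by (simp_all add: Reals_cnj_iff)
  then have AB': "of_real A' = of_real (tau_A b s) / c ^ 4" "of_real B' = of_real (tau_B b s) / c ^ 6"
    by (simp_all add: A'_def B'_def)
  obtain x y where T: "wp c (c * tau b0 s0) x y (of_real A) (of_real B)" "wp.cnj_sym c (c * tau b0 s0) x y"
    using wp_tau_scaled[OF b0 c E] by blast
  obtain x' y' where S: "wp c (c * tau b s) x' y' (of_real A') (of_real B')" "wp.cnj_sym c (c * tau b s) x' y'"
    using wp_tau_scaled[OF b s_pos c AB'] by blast
  interpret wp2 c "c * tau b s" x' y' "of_real A'" "of_real B'" c "c * tau b0 s0" x y "of_real A" "of_real B"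
    using S(1) T(1) by (simp add: wp2_def)
  have "of_int (4 * v) * l \<in> T.L" if l: "l \<in> S.L" for l
  proof -
    obtain m n where l: "l = of_int m * c + of_int n * (c * tau b s)" using l unfolding S.L_def by blast
    \<comment> \<open>The factor \<open>v\<close> clears the ratio of the imaginary parts, the
      factor 4 the real parts \<open>b / 2\<close> and \<open>b0 / 2\<close>.\<close>
    have "of_int (4 * v) * tau b s = of_int (2 * v * b - 2 * u * b0) + of_int (4 * u) * tau b0 s0"
      using uv by (simp add: s tau_def complex_eq_iff)
    note t = this
    have "of_int (4 * v) * l = of_int (4 * v * m) * c + of_int n * (c * (of_int (4 * v) * tau b s))"
      unfolding l by (simp add: algebra_simps)
    also have "\<dots> = of_int (4 * v * m) * c + of_int n * (c * (of_int (2 * v * b - 2 * u * b0) + of_int (4 * u) * tau b0 s0))"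
      unfolding t ..
    also have "\<dots> = of_int (4 * v * m + n * (2 * v * b - 2 * u * b0)) * c + of_int (n * (4 * u)) * (c * tau b0 s0)"
      by (simp add: algebra_simps)
    finally show ?thesis using T.L_I by metis
  qed
  then have "isogeny_over \<real> (Weierstrass (of_real A') (of_real B')) (Weierstrass (of_real A) (of_real B)) (hom_map (of_int (4 * v)))"
    using uv S(2) T(2) by (intro hom_map_isogeny) auto
  then have iso: "isogenous_over_reals (Weierstrass A' B') (Weierstrass A B)"
    unfolding isogenous_over_reals_def complexification_Weierstrass by blast
  note cmS = cm_parity[OF S(1) tau_quadratic[OF b] N] and cmT = cm_parity[OF T(1) tau_quadratic[OF b0(1)] N0]
  have par: "same_parity (complexification (Weierstrass A' B')) (complexification (Weierstrass A B))"
    unfolding same_parity_def odd_cm_curve_def even_cm_curve_def complexification_Weierstrass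
    using cmS cmT parity by blast
  have ell: "elliptic_curve (Weierstrass A' B')" and j: "tau_j b s = j_invariant (Weierstrass A' B')"
    using tau_j_eq[OF b s_pos c(1) AB'] by (simp_all add: elliptic_curve_def j_invariant_def)
  show ?thesis unfolding J0_def using ell iso par j by blast
qed

lemma cm_data:
  assumes "elliptic_curve (Weierstrass A B)" "has_cm (complexification (Weierstrass A B))"
  obtains b s c p q where "b = (if 4 * A ^ 3 + 27 * B ^ 2 < 0 then 0 else 1)" "s > 0" "c \<noteq> 0" "cnj c = c \<or> cnj c = - c"
    "of_real A = of_real (tau_A b s) / c ^ 4" "of_real B = of_real (tau_B b s) / c ^ 6"
    "tau_norm b s = of_int p / of_int q" "q > 0" "coprime p q"
    "odd (discr (End_ring (complexification (Weierstrass A B)))) \<longleftrightarrow> odd (q * b)"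
proof -
  define b :: int where "b = (if 4 * A ^ 3 + 27 * B ^ 2 < 0 then 0 else 1)"
  have b01: "b = 0 \<or> b = 1" by (simp add: b_def)
  obtain s c where sc: "s > 0" "c \<noteq> 0" "cnj c = c \<or> cnj c = - c"
    "of_real A = of_real (tau_A b s) / c ^ 4" "of_real B = of_real (tau_B b s) / c ^ 6"
    using uniformization[of A B, folded b_def] assms(1) by (auto simp: elliptic_curve_def)
  obtain x y where w: "wp c (c * tau b s) x y (of_real A) (of_real B)"
    using wp_tau_scaled[OF b01 sc] by blast
  have "tau_norm b s \<in> \<rat>"
    using cm_rational[OF w tau_quadratic[OF b01]] assms(2) unfolding complexification_Weierstrass by blast
  then obtain p q where pq: "q > 0" "coprime p q" "tau_norm b s = of_int p / of_int q"
    by (rule Rats_cases')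
  show ?thesis
    using that[OF b_def sc pq(3,1,2)] cm_parity(2)[OF w tau_quadratic[OF b01] pq(3,1,2)]
    unfolding complexification_Weierstrass by blast
qed

section \<open>Parity as a 2-adic condition on the ratio of parameters\<close>

lemma rational_tau_norm:
  assumes "tau_norm b0 s0 = of_int p0 / of_int q0" "q0 > 0"
  shows "tau_norm b (of_int u / of_int v * s0) \<in> \<rat>"
proof -
  have "s0 ^ 2 = of_int p0 / of_int q0 - of_int b0 / 4" using assms by (simp add: tau_norm_def)
  then have "s0 ^ 2 \<in> \<rat>" by simp
  moreover have "(of_int u / of_int v :: real) ^ 2 \<in> \<rat>" by (intro Rats_power Rats_divide Rats_of_int)
  ultimately show ?thesis
    unfolding tau_norm_def power_mult_distrib by (intro Rats_add Rats_mult Rats_divide Rats_of_int Rats_number_of)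
qed

text \<open>Squares of odd numbers agree modulo 4, so the two contributions of 1/4 combine to an
  integer over the common denominator. The reduced denominator \<open>q\<close> then divides the odd
  number \<open>q0 * v ^ 2\<close>.\<close>

lemma ratio_identity_odd:
  assumes N0: "tau_norm 1 s0 = of_int p0 / of_int q0" "q0 > 0" "odd q0" and v: "odd v" "v > 0" and u: "odd u"
    and N: "tau_norm 1 (of_int u / of_int v * s0) = of_int p / of_int q" "q > 0" "coprime p q"
  shows "odd q"
proof -
  have "4 dvd v ^ 2 - u ^ 2"
  proof -
    have "v ^ 2 - u ^ 2 = (v - u) * (v + u)" by (simp add: power2_eq_square algebra_simps)
    then show ?thesis using u v mult_dvd_mono[of 2 "v - u" 2 "v + u"] by simp
  qed
  then obtain w where w: "v ^ 2 - u ^ 2 = 4 * w" by (auto simp: dvd_def)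
  have "of_int p / of_int q = 1 / 4 + (of_int u / of_int v) ^ 2 * (of_int p0 / of_int q0 - 1 / 4 :: real)"
  proof -
    have "s0 ^ 2 = of_int p0 / of_int q0 - 1 / 4" using N0(1) by (simp add: tau_norm_def)
    then show ?thesis using N(1) by (simp add: tau_norm_def power_mult_distrib power_divide)
  qed
  also have "\<dots> = (of_int (q0 * (v ^ 2 - u ^ 2)) + 4 * of_int (u ^ 2 * p0)) / (4 * of_int (q0 * v ^ 2))"
    using N0(2) v(2) by (simp add: field_simps power2_eq_square)
  also have "\<dots> = of_int (q0 * w + u ^ 2 * p0) / of_int (q0 * v ^ 2)"
    unfolding w using N0(2) v(2) by (simp add: field_simps)
  finally have "of_int (p * (q0 * v ^ 2)) = (of_int ((q0 * w + u ^ 2 * p0) * q) :: real)"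
    using N(2) N0(2) v(2) by (simp add: field_simps)
  then have "p * (q0 * v ^ 2) = (q0 * w + u ^ 2 * p0) * q" by (simp only: of_int_eq_iff)
  then have "q dvd p * (q0 * v ^ 2)" by simp
  then have "q dvd q0 * v ^ 2" using N(3) by (simp add: coprime_commute coprime_dvd_mult_right_iff)
  then show ?thesis using N0(3) v(1) by (metis dvd_trans even_mult_iff even_power)
qed

text \<open>If \<open>q\<close> were odd, clearing denominators would show that \<open>4 ^ k\<close>
  divides \<open>u ^ 2 * a * q\<close>, hence \<open>a\<close>; but \<open>a\<close> is positive and
  smaller.\<close>

lemma ratio_identity_even:
  assumes s0: "s0 ^ 2 = of_int a / of_int d" "a > 0" "d > 0" "a < 4 ^ k" and u: "odd u"
    and N: "tau_norm 1 (of_int u / of_int (2 ^ Suc k) * s0) = of_int p / of_int q" "q > 0"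
  shows "even q"
proof (rule ccontr)
  assume q: "odd q"
  have "of_int p / of_int q = 1 / 4 + of_int (u ^ 2 * a) / (4 * of_int (4 ^ k * d) :: real)"
  proof -
    have "(2 :: real) ^ k * 2 ^ k = 4 ^ k" by (simp flip: power_mult_distrib)
    then have "(2 ^ Suc k :: real) ^ 2 = 4 * 4 ^ k" by (simp add: power2_eq_square)
    then show ?thesis
      using N(1) s0(1) by (simp add: tau_norm_def power_mult_distrib power_divide mult_ac del: power_Suc)
  qed
  then have "of_int (4 * p * (4 ^ k * d)) = (of_int (q * (4 ^ k * d) + u ^ 2 * a * q) :: real)"
    using N(2) s0(3) by (simp add: field_simps)
  then have "4 * p * (4 ^ k * d) = q * (4 ^ k * d) + u ^ 2 * a * q" by (simp only: of_int_eq_iff)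
  then have "u ^ 2 * a * q = 4 ^ k * (d * (4 * p - q))" by (simp add: algebra_simps)
  then have "4 ^ k dvd (u ^ 2 * q) * a" by (metis dvd_triv_left mult.assoc mult.commute)
  moreover have "coprime (4 ^ k) (u ^ 2 * q)"
  proof -
    have "coprime 2 (u ^ 2 * q)" using u q by simp
    then have "coprime (2 ^ (2 * k)) (u ^ 2 * q)" by simp
    then show ?thesis by (simp add: power_mult)
  qed
  ultimately have "4 ^ k dvd a" by (simp add: coprime_dvd_mult_right_iff)
  then have "4 ^ k \<le> a" using s0(2) by (rule zdvd_imp_le)
  then show False using s0(4) by simp
qed

theorem theorem2p6:
  fixes E :: "real weierstrass"
  assumes "elliptic_curve E"
    and "has_cm (complexification E)"
  shows "(odd_cm_curve (complexification E) \<longrightarrow> closure (J0 E) = {..1728}) \<and>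
         (even_cm_curve (complexification E) \<longrightarrow> closure (J0 E) = UNIV)"
proof -
  obtain A B where E: "E = Weierstrass A B" by (cases E)
  obtain b0 s0 c p0 q0 where b0: "b0 = (if 4 * A ^ 3 + 27 * B ^ 2 < 0 then 0 else 1 :: int)" and s0: "s0 > 0"
    and c: "c \<noteq> 0" "cnj c = c \<or> cnj c = - c"
    and AB: "of_real A = of_real (tau_A b0 s0) / c ^ 4" "of_real B = of_real (tau_B b0 s0) / c ^ 6"
    and N0: "tau_norm b0 s0 = of_int p0 / of_int q0" "q0 > 0" "coprime p0 q0"
    and par: "odd (discr (End_ring (complexification E))) \<longleftrightarrow> odd (q0 * b0)"
    using cm_data[of A B, folded E, OF assms] by blast
  have b01: "b0 = 0 \<or> b0 = 1" by (simp add: b0)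
  \<comment> \<open>The reduced denominator is known only through divisibility, so the parity
    premise ranges over every reduced representation.\<close>
  have mem: "tau_j b (of_int u / of_int v * s0) \<in> J0 E"
    if "b = 0 \<or> b = 1" "u > 0" "v > 0"
      and par: "\<And>p q. tau_norm b (of_int u / of_int v * s0) = of_int p / of_int q \<Longrightarrow> q > 0 \<Longrightarrow> coprime p q \<Longrightarrow> odd (q * b) \<longleftrightarrow> odd (q0 * b0)"
    for b u v
  proof -
    obtain p q where pq: "q > 0" "coprime p q" "tau_norm b (of_int u / of_int v * s0) = of_int p / of_int q"
      using rational_tau_norm[OF N0(1,2)] by (rule Rats_cases')
    show ?thesis
      unfolding E using par[OF pq(3,1,2)] that(1-3)
      by (intro J0_I[OF AB c b01 s0 _ N0 _ _ refl pq(3,1,2)])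
  qed
  \<comment> \<open>The value 1728 belongs to both families and is left out of
    \<open>tau_j_surj\<close>; it is recovered as the endpoint of the open ray. The same applies to
    \<open>above\<close>.\<close>
  have below: "{..1728} \<subseteq> closure (J0 E)" if *: "\<And>s. s > 0 \<Longrightarrow> tau_j 1 s \<in> closure (J0 E)"
  proof -
    have "j \<in> closure (J0 E)" if "j \<in> {..<1728}" for j :: real
    proof -
      have "j \<noteq> 1728" "j < 1728" using that by auto
      then obtain s where "s > 0" "tau_j 1 s = j" using tau_j_surj[of j] by auto
      then show ?thesis using *[of s] by simp
    qed
    then have "closure {..<1728} \<subseteq> closure (J0 E)" by (intro closure_minimal) auto
    then show ?thesis by simp
  qed
  have above: "{1728..} \<subseteq> closure (J0 E)" if *: "\<And>s. s > 0 \<Longrightarrow> tau_j 0 s \<in> closure (J0 E)"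
  proof -
    have "j \<in> closure (J0 E)" if "j \<in> {1728<..}" for j :: real
    proof -
      have "j \<noteq> 1728" "\<not> j < 1728" using that by auto
      then obtain s where "s > 0" "tau_j 0 s = j" using tau_j_surj[of j] by auto
      then show ?thesis using *[of s] by simp
    qed
    then have "closure {1728<..} \<subseteq> closure (J0 E)" by (intro closure_minimal) auto
    then show ?thesis by simp
  qed
  have "closure (J0 E) = {..1728}" if odd: "odd_cm_curve (complexification E)"
  proof -
    have o: "b0 = 1" "odd q0" using odd par b01 by (auto simp: odd_cm_curve_def)
    have "tau_j 1 s \<in> closure (J0 E)" if s: "s > 0" for s
    proof (rule closure_tau_j[OF _ s s0])
      fix e :: real assume e: "e > 0"
      obtain n :: nat where n: "1 / real (Suc n) < e" using e nat_approx_posE by metis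
      \<comment> \<open>An odd denominator, combined with an odd numerator, preserves
        oddness.\<close>
      define v :: int where "v = 2 * int n + 1"
      have v: "v > 0" "odd v" by (simp_all add: v_def)
      have "1 / of_int v \<le> 1 / real (Suc n)" unfolding v_def by (intro divide_left_mono) auto
      then have ve: "1 / of_int v < e" using n by linarith
      obtain u where u: "u > 0" "odd u" "\<bar>of_int u / of_int v - s / s0\<bar> \<le> 1 / of_int v"
        using odd_approx[of "s / s0" v] s s0 v by auto
      have "tau_j 1 (of_int u / of_int v * s0) \<in> J0 E"
        using u v ratio_identity_odd[OF N0(1)[unfolded o] N0(2) o(2) v(2,1) u(2)] o by (intro mem) auto
      then show "\<exists>u v :: int. \<bar>of_int u / of_int v - s / s0\<bar> < e \<and> tau_j 1 (of_int u / of_int v * s0) \<in> J0 E"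
        using u(3) ve by (intro exI[of _ u] exI[of _ v]) auto
    qed simp
    then have "{..1728} \<subseteq> closure (J0 E)" by (rule below)
    moreover have "J0 E \<subseteq> {..1728}"
    proof
      fix j assume "j \<in> J0 E"
      then obtain E' where E': "j = j_invariant E'" "elliptic_curve E'" "same_parity (complexification E') (complexification E)"
        unfolding J0_def by blast
      have odd': "odd_cm_curve (complexification E')"
        using E'(3) odd by (auto simp: same_parity_def odd_cm_curve_def even_cm_curve_def)
      obtain A' B' where AB': "E' = Weierstrass A' B'" by (cases E')
      have "has_cm (complexification E')" using odd' by (simp add: odd_cm_curve_def)
      then obtain b q :: int where "b = (if 4 * A' ^ 3 + 27 * B' ^ 2 < 0 then 0 else 1)"
        "odd (discr (End_ring (complexification E'))) \<longleftrightarrow> odd (q * b)"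
        using cm_data[of A' B', folded AB', OF E'(2)] by blast
      \<comment> \<open>Odd \<open>q * b\<close> excludes \<open>b = 0\<close>. So the discriminant
        is positive, and \<open>27 * B' ^ 2\<close> being nonnegative bounds the invariant by
        1728.\<close>
      then have "\<not> 4 * A' ^ 3 + 27 * B' ^ 2 < 0" using odd' by (auto simp: odd_cm_curve_def)
      then have D: "4 * A' ^ 3 + 27 * B' ^ 2 > 0" using E'(2) by (simp add: AB' elliptic_curve_def)
      have "4 * A' ^ 3 \<le> 4 * A' ^ 3 + 27 * B' ^ 2" by simp
      then have "j \<le> 1728 * 1"
        unfolding E'(1) AB' j_invariant_def using D by (simp add: divide_le_eq)
      then show "j \<in> {..1728}" by simp
    qed
    then have "closure (J0 E) \<subseteq> {..1728}" by (intro closure_minimal) auto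
    ultimately show ?thesis by blast
  qed
  moreover have "closure (J0 E) = UNIV" if even: "even_cm_curve (complexification E)"
  proof -
    have ev: "even (q0 * b0)" using even par by (auto simp: even_cm_curve_def)
    have s2: "s0 ^ 2 = of_int p0 / of_int q0 - of_int b0 / 4" using N0(1) by (simp add: tau_norm_def)
    \<comment> \<open>Numerator and denominator of \<open>s0 ^ 2\<close>, obtained by subtracting
      \<open>b0 / 4\<close> from the norm.\<close>
    define a where "a = 4 * p0 - b0 * q0"
    define d where "d = 4 * q0"
    have ad: "s0 ^ 2 = of_int a / of_int d" using N0(2) unfolding s2 a_def d_def by (simp add: field_simps)
    have d: "d > 0" using N0(2) by (simp add: d_def)
    have a: "a > 0"
    proof -
      have "of_int a / of_int d > (0 :: real)" using s0 ad[symmetric] by simp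
      then show ?thesis using d by (simp add: zero_less_divide_iff)
    qed
    have approx: "\<exists>k u. u > 0 \<and> odd u \<and> a < 4 ^ k \<and> \<bar>of_int u / of_int (2 ^ Suc k) - x\<bar> < e" if xe: "x > 0" "e > 0" for x e :: real
    proof -
      obtain n :: nat where n: "1 / real (Suc n) < e" using xe(2) nat_approx_posE by metis
      \<comment> \<open>The summand \<open>n\<close> makes the spacing finer than \<open>e\<close>,
        the summand \<open>nat a\<close> ensures \<open>a < 4 ^ k\<close>.\<close>
      define k where "k = nat a + n"
      have "real (Suc n) \<le> 2 ^ Suc k"
      proof -
        have "n < 2 ^ n" by (rule less_exp)
        also have "(2::nat) ^ n \<le> 2 ^ Suc k" by (intro power_increasing) (auto simp: k_def)
        finally have "Suc n \<le> 2 ^ Suc k" by simp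
        then show ?thesis by (metis of_nat_le_iff of_nat_numeral of_nat_power)
      qed
      then have "1 / of_int (2 ^ Suc k) \<le> 1 / real (Suc n)" by (simp add: divide_left_mono del: power_Suc of_nat_Suc)
      then have e: "1 / of_int (2 ^ Suc k) < e" using n by linarith
      have "nat a < 2 ^ nat a" by (rule less_exp)
      also have "(2::nat) ^ nat a \<le> 2 ^ k" by (intro power_increasing) (auto simp: k_def)
      also have "(2::nat) ^ k \<le> 4 ^ k" by (intro power_mono) auto
      finally have "int (nat a) < int (4 ^ k)" by (simp only: of_nat_less_iff)
      then have "a < 4 ^ k" using a by simp
      moreover obtain u where "u > 0" "odd u" "\<bar>of_int u / of_int (2 ^ Suc k) - x\<bar> \<le> 1 / of_int (2 ^ Suc k)"
        using odd_approx[OF xe(1), of "2 ^ Suc k"] by auto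
      ultimately show ?thesis using e by (intro exI[of _ k] exI[of _ u]) linarith
    qed
    have "tau_j 1 s \<in> closure (J0 E)" if s: "s > 0" for s
    proof (rule closure_tau_j[OF _ s s0])
      fix e :: real assume "e > 0"
      then obtain k u where k: "u > 0" "odd u" "a < 4 ^ k" "\<bar>of_int u / of_int (2 ^ Suc k) - s / s0\<bar> < e"
        using approx[of "s / s0" e] s s0 by auto
      have "tau_j 1 (of_int u / of_int (2 ^ Suc k) * s0) \<in> J0 E"
        using k ratio_identity_even[OF ad a d k(3,2)] ev by (intro mem) (auto simp del: power_Suc)
      then show "\<exists>u v :: int. \<bar>of_int u / of_int v - s / s0\<bar> < e \<and> tau_j 1 (of_int u / of_int v * s0) \<in> J0 E"
        using k(4) by blast
    qed simp
    then have "{..1728} \<subseteq> closure (J0 E)" by (rule below)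
    moreover have "tau_j 0 s \<in> closure (J0 E)" if s: "s > 0" for s
    proof (rule closure_tau_j[OF _ s s0])
      fix e :: real assume "e > 0"
      then obtain k u where k: "u > 0" "odd u" "a < 4 ^ k" "\<bar>of_int u / of_int (2 ^ Suc k) - s / s0\<bar> < e"
        using approx[of "s / s0" e] s s0 by auto
      \<comment> \<open>With \<open>b = 0\<close> the product \<open>q * b\<close> is even for every
        \<open>q\<close>, so the same approximants serve the first family.\<close>
      have "tau_j 0 (of_int u / of_int (2 ^ Suc k) * s0) \<in> J0 E"
        using k ev by (intro mem) (auto simp del: power_Suc)
      then show "\<exists>u v :: int. \<bar>of_int u / of_int v - s / s0\<bar> < e \<and> tau_j 0 (of_int u / of_int v * s0) \<in> J0 E"
        using k(4) by blast
    qed simp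
    then have "{1728..} \<subseteq> closure (J0 E)" by (rule above)
    moreover have "{..1728} \<union> {1728..} = (UNIV :: real set)" by auto
    ultimately show ?thesis by blast
  qed
  ultimately show ?thesis by blast
qed

end
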